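(* Let $\Omega$ be a bounded Lipschitz domain in $\mathbb{R}^d$, $d\ge2$, and let $1<p<\infty$, $p'=\frac{p}{p-1}$. Suppose that $$\sup_{\substack{f,g\in C_0^\infty(\Omega;\mathbb{C}^d)\\ f,g\ne0}}\frac{|\langle Pf,g\rangle|}{\|f\|_{L^p(\Omega)}\|g\|_{L^{p'}(\Omega)}}=\infty,$$ where $P$ is the Helmholtz projection. Then $$\sup_{\substack{f,g\in C_0^\infty(\Omega;\mathbb{C}^d)\\ f,g\neq0,\ \lambda>0}}\frac{\lambda\,|\langle u,g\rangle|}{\|f\|_{L^p(\Omega)}\|g\|_{L^{p'}(\Omega)}}=\infty,$$ where $u=u_{f,\lambda}\in W^{1,2}_0(\Omega;\mathbb{C}^d)$ is the weak solution of $-\Delta u+\nabla\phi+\lambda u=f$, $\operatorname{div}(u)=0$ in $\Omega$, $u=0$ on $\partial\Omega$.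
   Context: $L^2_\sigma(\Omega)=\{u\in L^2(\Omega;\mathbb{C}^d): \int_\Omega u\cdot\nabla\varphi=0\text{ for all }\varphi\in C_0^\infty(\mathbb{R}^d;\mathbb{C})\}$. The Helmholtz projection $P:L^2(\Omega;\mathbb{C}^d)\to L^2_\sigma(\Omega)$ is $Pf=f-\nabla\phi$, where $\phi\in W^{1,2}(\Omega;\mathbb{C})$ is a weak solution of $\Delta\phi=\operatorname{div}(f)$ in $\Omega$, $\partial\phi/\partial n=n\cdot f$ on $\partial\Omega$, i.e. $\int_\Omega\nabla\phi\cdot\nabla\psi=\int_\Omega f\cdot\nabla\psi$ for all $\psi\in W^{1,2}(\Omega;\mathbb{C})$. $\langle\cdot,\cdot\rangle$ is the $L^2(\Omega;\mathbb{C}^d)$ inner product. Weak solution: $u\in W^{1,2}_0(\Omega;\mathbb{C}^d)$, $\operatorname{div}u=0$, and $\int_\Omega\nabla u\cdot\nabla v+\lambda\int_\Omega u\cdot v=\int_\Omega f\cdot v$ for all $v\in W^{1,2}_0(\Omega;\mathbb{C}^d)$ with $\operatorname{div}v=0$. *)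

theory Defs
  imports "HOL-Analysis.Analysis"
begin

text \<open>
  \<open>\<real>\<^sup>d\<close> is \<^typ>\<open>real ^ 'd\<close> and \<open>\<complex>\<^sup>d\<close> is \<^typ>\<open>complex ^ 'd\<close>. Functions on \<open>\<Omega>\<close> are total functions on
  \<^typ>\<open>real ^ 'd\<close> of which only the values on \<open>\<Omega>\<close> matter; functions in Lebesgue and Sobolev spaces
  are determined up to null sets only.
\<close>

section \<open>Bounded Lipschitz domains\<close>

text \<open>
  Near each boundary point, \<open>\<Omega>\<close> is the region above the graph of a Lipschitz function in some
  orthogonal coordinate system. The unit vector \<open>\<nu>\<close> is the last coordinate direction, and
  the hyperplane orthogonal to \<open>\<nu>\<close> plays the role of \<open>\<real>\<close> to the power \<open>d - 1\<close>.
\<close>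

definition bounded_lipschitz_domain :: "(real ^ 'd) set \<Rightarrow> bool" where
  "bounded_lipschitz_domain \<Omega> \<longleftrightarrow>
     open \<Omega> \<and> connected \<Omega> \<and> \<Omega> \<noteq> {} \<and> bounded \<Omega> \<and>
     (\<forall>x0 \<in> frontier \<Omega>. \<exists>r>0. \<exists>\<nu> \<gamma> L. norm \<nu> = 1 \<and>
        L-lipschitz_on {y. y \<bullet> \<nu> = 0} (\<gamma> :: real ^ 'd \<Rightarrow> real) \<and>
        \<Omega> \<inter> ball x0 r = {x \<in> ball x0 r. x \<bullet> \<nu> > \<gamma> (x - (x \<bullet> \<nu>) *\<^sub>R \<nu>)})"

section \<open>Test functions\<close>

definition partial :: "'d \<Rightarrow> (real ^ 'd \<Rightarrow> 'b::real_normed_vector) \<Rightarrow> real ^ 'd \<Rightarrow> 'b" where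
  "partial i f = (\<lambda>x. frechet_derivative f (at x) (axis i 1))"

primrec Ck :: "nat \<Rightarrow> (real ^ 'd \<Rightarrow> 'b::real_normed_vector) \<Rightarrow> bool" where
  "Ck 0 f \<longleftrightarrow> continuous_on UNIV f"
| "Ck (Suc k) f \<longleftrightarrow> (\<forall>x. f differentiable (at x)) \<and> (\<forall>i. Ck k (partial i f))"

definition test_fun :: "(real ^ 'd) set \<Rightarrow> (real ^ 'd \<Rightarrow> 'b::real_normed_vector) set" where
  "test_fun \<Omega> = {f. (\<forall>k. Ck k f) \<and> compact (closure {x. f x \<noteq> 0}) \<and> closure {x. f x \<noteq> 0} \<subseteq> \<Omega>}"

section \<open>Lebesgue spaces\<close>

definition Lp_norm :: "(real ^ 'd) set \<Rightarrow> real \<Rightarrow> (real ^ 'd \<Rightarrow> 'b::euclidean_space) \<Rightarrow> real" where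
  "Lp_norm \<Omega> p f = (LINT x|lebesgue_on \<Omega>. norm (f x) powr p) powr (1 / p)"

definition L2 :: "(real ^ 'd) set \<Rightarrow> (real ^ 'd \<Rightarrow> 'b::euclidean_space) set" where
  "L2 \<Omega> = {f \<in> borel_measurable (lebesgue_on \<Omega>). integrable (lebesgue_on \<Omega>) (\<lambda>x. (norm (f x))\<^sup>2)}"

text \<open>The product \<open>u \<cdot> v\<close> on \<open>\<complex>\<^sup>d\<close> is bilinear, without conjugation.\<close>

definition cdot :: "complex ^ 'd \<Rightarrow> complex ^ 'd \<Rightarrow> complex" where
  "cdot a b = (\<Sum>i\<in>UNIV. a $ i * b $ i)"

definition L2_inner :: "(real ^ 'd) set \<Rightarrow> (real ^ 'd \<Rightarrow> complex ^ 'd) \<Rightarrow> (real ^ 'd \<Rightarrow> complex ^ 'd) \<Rightarrow> complex" where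
  "L2_inner \<Omega> f g = (LINT x|lebesgue_on \<Omega>. (\<Sum>i\<in>UNIV. f x $ i * cnj (g x $ i)))"

section \<open>Weak derivatives and Sobolev spaces\<close>

definition loc_integrable :: "(real ^ 'd) set \<Rightarrow> (real ^ 'd \<Rightarrow> 'b::euclidean_space) \<Rightarrow> bool" where
  "loc_integrable \<Omega> f \<longleftrightarrow> (\<forall>K. compact K \<and> K \<subseteq> \<Omega> \<longrightarrow> integrable (lebesgue_on K) f)"

definition has_weak_partial ::
    "(real ^ 'd) set \<Rightarrow> 'd \<Rightarrow> (real ^ 'd \<Rightarrow> 'b::euclidean_space) \<Rightarrow> (real ^ 'd \<Rightarrow> 'b) \<Rightarrow> bool" where
  "has_weak_partial \<Omega> i u g \<longleftrightarrow> loc_integrable \<Omega> u \<and> loc_integrable \<Omega> g \<and>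
     (\<forall>\<psi> \<in> (test_fun \<Omega> :: (real ^ 'd \<Rightarrow> real) set).
        (LINT x|lebesgue_on \<Omega>. partial i \<psi> x *\<^sub>R u x) = - (LINT x|lebesgue_on \<Omega>. \<psi> x *\<^sub>R g x))"

text \<open>A chosen representative; weak derivatives are unique up to null sets.\<close>

definition wpartial :: "(real ^ 'd) set \<Rightarrow> 'd \<Rightarrow> (real ^ 'd \<Rightarrow> 'b::euclidean_space) \<Rightarrow> real ^ 'd \<Rightarrow> 'b" where
  "wpartial \<Omega> i u = (SOME g. has_weak_partial \<Omega> i u g)"

definition wgrad :: "(real ^ 'd) set \<Rightarrow> (real ^ 'd \<Rightarrow> complex) \<Rightarrow> real ^ 'd \<Rightarrow> complex ^ 'd" where
  "wgrad \<Omega> \<phi> x = (\<chi> i. wpartial \<Omega> i \<phi> x)"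

definition wdiv :: "(real ^ 'd) set \<Rightarrow> (real ^ 'd \<Rightarrow> complex ^ 'd) \<Rightarrow> real ^ 'd \<Rightarrow> complex" where
  "wdiv \<Omega> u x = (\<Sum>i\<in>UNIV. wpartial \<Omega> i u x $ i)"

definition W12 :: "(real ^ 'd) set \<Rightarrow> (real ^ 'd \<Rightarrow> 'b::euclidean_space) set" where
  "W12 \<Omega> = {u \<in> L2 \<Omega>. \<forall>i. \<exists>g \<in> L2 \<Omega>. has_weak_partial \<Omega> i u g}"

definition W12_norm :: "(real ^ 'd) set \<Rightarrow> (real ^ 'd \<Rightarrow> 'b::euclidean_space) \<Rightarrow> real" where
  "W12_norm \<Omega> u = sqrt ((Lp_norm \<Omega> 2 u)\<^sup>2 + (\<Sum>i\<in>UNIV. (Lp_norm \<Omega> 2 (wpartial \<Omega> i u))\<^sup>2))"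

definition W12_0 :: "(real ^ 'd) set \<Rightarrow> (real ^ 'd \<Rightarrow> 'b::euclidean_space) set" where
  "W12_0 \<Omega> = {u \<in> W12 \<Omega>. \<exists>\<eta>. (\<forall>k::nat. \<eta> k \<in> test_fun \<Omega>) \<and>
     (\<lambda>k. W12_norm \<Omega> (\<lambda>x. u x - \<eta> k x)) \<longlonglongrightarrow> 0}"

definition W12_0_divfree :: "(real ^ 'd) set \<Rightarrow> (real ^ 'd \<Rightarrow> complex ^ 'd) set" where
  "W12_0_divfree \<Omega> = {u \<in> W12_0 \<Omega>. AE x in lebesgue_on \<Omega>. wdiv \<Omega> u x = 0}"

section \<open>Helmholtz projection and Stokes resolvent problem\<close>

definition weak_neumann_solution ::
    "(real ^ 'd) set \<Rightarrow> (real ^ 'd \<Rightarrow> complex ^ 'd) \<Rightarrow> (real ^ 'd \<Rightarrow> complex) \<Rightarrow> bool" where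
  "weak_neumann_solution \<Omega> f \<phi> \<longleftrightarrow> \<phi> \<in> W12 \<Omega> \<and>
     (\<forall>\<psi> \<in> W12 \<Omega>. (LINT x|lebesgue_on \<Omega>. cdot (wgrad \<Omega> \<phi> x) (wgrad \<Omega> \<psi> x))
                = (LINT x|lebesgue_on \<Omega>. cdot (f x) (wgrad \<Omega> \<psi> x)))"

text \<open>
  The Neumann solution is unique up to an additive constant on a domain, so its gradient is
  unique up to null sets and the choice below is immaterial.
\<close>

definition helmholtz ::
    "(real ^ 'd) set \<Rightarrow> (real ^ 'd \<Rightarrow> complex ^ 'd) \<Rightarrow> real ^ 'd \<Rightarrow> complex ^ 'd" where
  "helmholtz \<Omega> f = (\<lambda>x. f x - wgrad \<Omega> (SOME \<phi>. weak_neumann_solution \<Omega> f \<phi>) x)"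

text \<open>
  Weak form of \<open>-\<Delta>u + \<nabla>\<phi> + \<lambda>u = f\<close>, \<open>div u = 0\<close> in \<open>\<Omega>\<close>, \<open>u = 0\<close> on the boundary: testing with
  divergence-free fields eliminates the pressure. The inner sum is \<open>\<nabla>u \<cdot> \<nabla>v\<close>, summed over
  all entries of the Jacobians.
\<close>

definition stokes_weak_solution ::
    "(real ^ 'd) set \<Rightarrow> real \<Rightarrow> (real ^ 'd \<Rightarrow> complex ^ 'd) \<Rightarrow> (real ^ 'd \<Rightarrow> complex ^ 'd) \<Rightarrow> bool" where
  "stokes_weak_solution \<Omega> lam f u \<longleftrightarrow> u \<in> W12_0_divfree \<Omega> \<and>
     (\<forall>v \<in> W12_0_divfree \<Omega>.
        (LINT x|lebesgue_on \<Omega>. (\<Sum>i\<in>UNIV. cdot (wpartial \<Omega> i u x) (wpartial \<Omega> i v x)))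
          + complex_of_real lam * (LINT x|lebesgue_on \<Omega>. cdot (u x) (v x))
        = (LINT x|lebesgue_on \<Omega>. cdot (f x) (v x)))"

end

theory Submission
  imports Defs
begin

text \<open>
  \<open>\<lambda> u\<^bsub>f,\<lambda>\<^esub>\<close> minimizes \<open>\<parallel>z - f\<parallel>\<^sup>2 + \<lambda>\<^sup>-\<^sup>1 \<parallel>\<nabla>z\<parallel>\<^sup>2\<close> over the solenoidal \<open>W\<^sup>1\<^sup>,\<^sup>2\<^sub>0\<close> fields, so it
  converges in \<open>L\<^sup>2\<close>, as \<open>\<lambda> \<rightarrow> \<infinity>\<close>, to the projection of \<open>f\<close> onto the \<open>L\<^sup>2\<close> closure of these fields.
  This limit is \<open>P f\<close>, hence every Helmholtz quotient is a limit of Stokes quotients, whatever \<open>p\<close> is.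

  That the projection is \<open>P f\<close> is the \<open>L\<^sup>2\<close> case of de Rham's theorem: a field orthogonal to the
  divergence-free test fields is a gradient. By Riesz representation this follows from a
  right inverse of the divergence on test fields which is bounded from \<open>L\<^sup>2\<close> to \<open>L\<^sup>2\<close>. It is obtained
  by transporting mass along segments: from the boundary into the interior along the direction in
  which \<open>\<Omega>\<close> is locally a graph, then inside \<open>\<Omega>\<close> to one fixed ball.
\<close>

section \<open>Square-integrable functions\<close>

text \<open>If \<open>f\<close> annihilates the divergence-free test fields, sending
  \<open>divg \<Psi>\<close> to \<open>- ip M f \<Psi>\<close> is well defined on divergences. It is
  bounded in L2 as soon as every \<open>divg \<Psi>\<close> has some preimage of norm at most
  \<open>C\<close> times its own, and the function representing it is a potential of
  \<open>f\<close>. Two obstacles shape the construction of such preimages. First, the domain need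
  not be star-shaped, so the given function has to be cut into pieces, and these lose the zero mean
  that a divergence must have. Local solvability therefore allows an error
  \<open>c * \<omega>\<close> with one fixed bump \<open>\<omega>\<close>; errors add up under
  gluing, and for a divergence the total error is forced to vanish by integration. Second, supports
  may come arbitrarily close to the boundary, while \<open>C\<close> must not depend on the support.
  Pushing a whole boundary piece inwards by a fixed amount achieves this: a translation preserves
  the L2 norm, and the piece lands in one fixed compact subset of \<open>\<Omega>\<close>.\<close>

definition sqint :: "'a measure \<Rightarrow> ('a \<Rightarrow> 'b::euclidean_space) \<Rightarrow> bool" where
  "sqint M f \<longleftrightarrow> f \<in> borel_measurable M \<and> integrable M (\<lambda>x. (norm (f x))\<^sup>2)"

text \<open>Functions are not identified modulo null sets, so the Hilbert space arguments are
  phrased with this squared seminorm, and L2 convergence means that \<open>nsq\<close> of the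
  difference tends to 0.\<close>

definition nsq :: "'a measure \<Rightarrow> ('a \<Rightarrow> 'b::euclidean_space) \<Rightarrow> real" where
  "nsq M f = (LINT x|M. (norm (f x))\<^sup>2)"

definition ip :: "'a measure \<Rightarrow> ('a \<Rightarrow> 'b::euclidean_space) \<Rightarrow> ('a \<Rightarrow> 'b) \<Rightarrow> real" where
  "ip M f g = (LINT x|M. f x \<bullet> g x)"

lemma L2_iff_sqint: "f \<in> L2 \<Omega> \<longleftrightarrow> sqint (lebesgue_on \<Omega>) f"
  by (simp add: L2_def sqint_def)

lemma sqint_measurable: "sqint M f \<Longrightarrow> f \<in> borel_measurable M"
  by (simp add: sqint_def)

lemma nsq_nonneg [simp]: "nsq M f \<ge> 0"
  by (simp add: nsq_def)

lemma sqint_zero [simp]: "sqint M (\<lambda>x. 0)"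
  by (simp add: sqint_def)

lemma sqint_norm_mult_integrable:
  assumes "sqint M f" "sqint M g"
  shows "integrable M (\<lambda>x. norm (f x) * norm (g x))"
proof (rule Bochner_Integration.integrable_bound)
  show "integrable M (\<lambda>x. (norm (f x))\<^sup>2 + (norm (g x))\<^sup>2)"
    using assms by (auto simp: sqint_def)
  show "(\<lambda>x. norm (f x) * norm (g x)) \<in> borel_measurable M"
    using assms by (auto simp: sqint_def)
  have "a * b \<le> a\<^sup>2 + b\<^sup>2" if "a \<ge> 0" "b \<ge> 0" for a b :: real
    using sum_squares_bound[of a b] mult_nonneg_nonneg[OF that] by linarith
  then show "AE x in M. norm (norm (f x) * norm (g x)) \<le> norm ((norm (f x))\<^sup>2 + (norm (g x))\<^sup>2)"
    by (auto simp: abs_mult)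
qed

lemma sqint_bilinear_integrable:
  fixes h :: "'a \<Rightarrow> 'e::euclidean_space"
  assumes "sqint M f" "sqint M g" "h \<in> borel_measurable M"
    and "\<And>x. norm (h x) \<le> K * (norm (f x) * norm (g x))"
  shows "integrable M h"
proof (rule Bochner_Integration.integrable_bound)
  show "integrable M (\<lambda>x. K * (norm (f x) * norm (g x)))"
    using sqint_norm_mult_integrable[OF assms(1,2)] by auto
qed (use assms in \<open>auto intro: order_trans abs_ge_self\<close>)

lemma sqint_inner_integrable: "sqint M f \<Longrightarrow> sqint M g \<Longrightarrow> integrable M (\<lambda>x. f x \<bullet> g x)"
  by (rule sqint_bilinear_integrable[of M f g _ 1]) (auto simp: sqint_def Cauchy_Schwarz_ineq2)

lemma sqint_mono:
  assumes "sqint M g" "f \<in> borel_measurable M" "\<And>x. norm (f x) \<le> K * norm (g x)"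
  shows "sqint M f" "nsq M f \<le> K\<^sup>2 * nsq M g"
proof -
  have le: "(norm (f x))\<^sup>2 \<le> K\<^sup>2 * (norm (g x))\<^sup>2" for x
    using power_mono[OF assms(3), of x 2] by (simp add: power_mult_distrib)
  have i: "integrable M (\<lambda>x. K\<^sup>2 * (norm (g x))\<^sup>2)"
    using assms by (auto simp: sqint_def)
  show "sqint M f"
    unfolding sqint_def using assms(2) le
    by (auto intro!: Bochner_Integration.integrable_bound[OF i])
  have "nsq M f \<le> (LINT x|M. K\<^sup>2 * (norm (g x))\<^sup>2)"
    unfolding nsq_def using \<open>sqint M f\<close> i le by (intro integral_mono) (auto simp: sqint_def)
  then show "nsq M f \<le> K\<^sup>2 * nsq M g" by (simp add: nsq_def)
qed

lemma norm_add_sq_le: "(norm (a + b :: 'b::real_normed_vector))\<^sup>2 \<le> 2 * (norm a)\<^sup>2 + 2 * (norm b)\<^sup>2"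
proof -
  have "(norm (a + b))\<^sup>2 \<le> (norm a + norm b)\<^sup>2"
    by (intro power_mono norm_triangle_ineq) auto
  also have "\<dots> \<le> 2 * (norm a)\<^sup>2 + 2 * (norm b)\<^sup>2"
    using sum_squares_bound[of "norm a" "norm b"] by (simp add: power2_sum)
  finally show ?thesis .
qed

lemma sqint_add:
  assumes "sqint M f" "sqint M g"
  shows "sqint M (\<lambda>x. f x + g x)" "nsq M (\<lambda>x. f x + g x) \<le> 2 * nsq M f + 2 * nsq M g"
proof -
  have i: "integrable M (\<lambda>x. 2 * (norm (f x))\<^sup>2 + 2 * (norm (g x))\<^sup>2)"
    using assms by (auto simp: sqint_def)
  show s: "sqint M (\<lambda>x. f x + g x)"
    unfolding sqint_def using assms norm_add_sq_le[of "f _" "g _"]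
    by (auto intro!: Bochner_Integration.integrable_bound[OF i] simp: sqint_def)
  have "nsq M (\<lambda>x. f x + g x) \<le> (LINT x|M. 2 * (norm (f x))\<^sup>2 + 2 * (norm (g x))\<^sup>2)"
    unfolding nsq_def using s i norm_add_sq_le by (intro integral_mono) (auto simp: sqint_def)
  also have "\<dots> = 2 * nsq M f + 2 * nsq M g"
    using assms by (simp add: nsq_def sqint_def)
  finally show "nsq M (\<lambda>x. f x + g x) \<le> 2 * nsq M f + 2 * nsq M g" .
qed

lemma sqint_bounded_linear:
  assumes "bounded_linear T" "sqint M f"
  shows "sqint M (\<lambda>x. T (f x))"
proof -
  obtain K where K: "\<And>x. norm (T x) \<le> norm x * K"
    using bounded_linear.bounded[OF assms(1)] by blast
  have "(\<lambda>x. T (f x)) \<in> borel_measurable M"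
    using assms by (intro borel_measurable_continuous_on[of T] linear_continuous_on) (auto simp: sqint_def)
  then show ?thesis
    using K by (intro sqint_mono(1)[OF assms(2), where K=K]) (auto simp: mult.commute)
qed

lemma nsq_bounded_linear_le:
  assumes "bounded_linear T" 
  obtains K where "K > 0" "\<And>M f. sqint M f \<Longrightarrow> nsq M (\<lambda>x. T (f x)) \<le> K * nsq M f"
proof -
  obtain K where K: "K > 0" "\<And>x. norm (T x) \<le> norm x * K"
    using bounded_linear.pos_bounded[OF assms(1)] by blast
  have "nsq M (\<lambda>x. T (f x)) \<le> K\<^sup>2 * nsq M f" if "sqint M f" for M :: "'c measure" and f
    using K sqint_measurable[OF sqint_bounded_linear[OF assms that]]
    by (intro sqint_mono(2)[OF that]) (auto simp: mult.commute)
  then show ?thesis using that[of "K\<^sup>2"] K(1) by auto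
qed

lemma sqint_scaleR: "sqint M f \<Longrightarrow> sqint M (\<lambda>x. c *\<^sub>R f x)"
  by (rule sqint_bounded_linear[OF bounded_linear_scaleR_right])

lemma sqint_minus: "sqint M f \<Longrightarrow> sqint M (\<lambda>x. - f x)"
  by (rule sqint_bounded_linear[OF bounded_linear_minus[OF bounded_linear_ident]])

lemma sqint_diff: "sqint M f \<Longrightarrow> sqint M g \<Longrightarrow> sqint M (\<lambda>x. f x - g x)"
  using sqint_add(1)[of M f "\<lambda>x. - g x"] sqint_minus[of M g] by simp

lemma nsq_minus_commute: "nsq M (\<lambda>x. f x - g x) = nsq M (\<lambda>x. g x - f x)"
  by (simp add: nsq_def norm_minus_commute)

lemma nsq_scaleR: "nsq M (\<lambda>x. c *\<^sub>R f x) = c\<^sup>2 * nsq M f"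
  by (simp add: nsq_def power_mult_distrib)

lemma ip_commute: "ip M f g = ip M g f"
  by (simp add: ip_def inner_commute)

lemma ip_self: "ip M f f = nsq M f"
  by (simp add: ip_def nsq_def power2_norm_eq_inner)

lemma ip_add_left: "sqint M f \<Longrightarrow> sqint M g \<Longrightarrow> sqint M h \<Longrightarrow> ip M (\<lambda>x. f x + g x) h = ip M f h + ip M g h"
  by (simp add: ip_def inner_add_left sqint_inner_integrable)

lemma ip_diff_left: "sqint M f \<Longrightarrow> sqint M g \<Longrightarrow> sqint M h \<Longrightarrow> ip M (\<lambda>x. f x - g x) h = ip M f h - ip M g h"
  by (simp add: ip_def inner_diff_left sqint_inner_integrable)

lemma ip_scaleR_left: "ip M (\<lambda>x. c *\<^sub>R f x) h = c * ip M f h"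
  by (simp add: ip_def)

lemma ip_scaleR_right: "ip M h (\<lambda>x. c *\<^sub>R f x) = c * ip M h f"
  by (simp add: ip_def)

lemma nsq_add: 
  assumes "sqint M f" "sqint M g"
  shows "nsq M (\<lambda>x. f x + g x) = nsq M f + 2 * ip M f g + nsq M g"
  using assms ip_add_left[OF assms sqint_add(1)[OF assms]]
    ip_add_left[OF assms assms(1)] ip_add_left[OF assms assms(2)]
  by (simp add: ip_self[symmetric] ip_commute)

lemma nsq_diff: 
  assumes "sqint M f" "sqint M g"
  shows "nsq M (\<lambda>x. f x - g x) = nsq M f - 2 * ip M f g + nsq M g"
  using assms ip_diff_left[OF assms sqint_diff[OF assms]]
    ip_diff_left[OF assms assms(1)] ip_diff_left[OF assms assms(2)]
  by (simp add: ip_self[symmetric] ip_commute)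

text \<open>Besides the Cauchy-Schwarz inequality this serves in \<open>sqint_riesz\<close>, where
  \<open>a\<close> is the amount by which a near-minimizer exceeds the infimum and \<open>b\<close>
  is its residual in the Euler equation.\<close>

lemma quadratic_nonneg_discriminant:
  fixes a b c :: real
  assumes "\<And>t. a - 2 * t * b + t\<^sup>2 * c \<ge> 0" "c \<ge> 0"
  shows "b\<^sup>2 \<le> a * c"
proof (cases "c = 0")
  case True
  have "b = 0"
  proof (rule ccontr)
    assume "b \<noteq> 0"
    \<comment> \<open>For \<open>c = 0\<close> this \<open>t\<close> gives the value
      \<open>a - (a + 1) = -1\<close>.\<close>
    then show False using assms(1)[of "(a + 1) / (2 * b)"] True by simp
  qed
  then show ?thesis using True by simp
next
  case False
  then show ?thesis using assms(1)[of "b / c"] assms(2)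
    by (simp add: field_simps power2_eq_square)
qed

lemma ip_sq_le:
  assumes "sqint M f" "sqint M g"
  shows "(ip M f g)\<^sup>2 \<le> nsq M f * nsq M g"
proof (rule quadratic_nonneg_discriminant)
  fix t
  have "0 \<le> nsq M (\<lambda>x. f x - t *\<^sub>R g x)" by simp
  also have "\<dots> = nsq M f - 2 * t * ip M f g + t\<^sup>2 * nsq M g"
    using nsq_diff[OF assms(1) sqint_scaleR[OF assms(2)], of t]
    by (simp add: nsq_scaleR ip_scaleR_right)
  finally show "0 \<le> nsq M f - 2 * t * ip M f g + t\<^sup>2 * nsq M g" .
qed simp

lemma ip_abs_le:
  assumes "sqint M f" "sqint M g"
  shows "\<bar>ip M f g\<bar> \<le> sqrt (nsq M f * nsq M g)"
  using ip_sq_le[OF assms] by (intro real_le_rsqrt) simp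

lemma bilinear_integral_le:
  fixes h :: "'a \<Rightarrow> 'e::euclidean_space"
  assumes "sqint M f" "sqint M g"
    and "\<And>x. norm (h x) \<le> K * (norm (f x) * norm (g x))" "K \<ge> 0"
  shows "norm (LINT x|M. h x) \<le> K * sqrt (nsq M f * nsq M g)"
\<comment> \<open>A function that is not integrable has integral 0 by convention, and then the bound
  is trivial.\<close>
proof (cases "integrable M h")
  case True
  have "norm (LINT x|M. h x) \<le> (LINT x|M. K * (norm (f x) * norm (g x)))"
    using True sqint_norm_mult_integrable[OF assms(1,2)] assms(3)
    by (intro order_trans[OF integral_norm_bound] integral_mono) auto
  also have "\<dots> = K * ip M (\<lambda>x. norm (f x)) (\<lambda>x. norm (g x))"
    by (simp add: ip_def)
  also have "ip M (\<lambda>x. norm (f x)) (\<lambda>x. norm (g x)) \<le> sqrt (nsq M f * nsq M g)"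
  proof -
    have "sqint M (\<lambda>x. norm (f x))" "sqint M (\<lambda>x. norm (g x))"
      using assms by (auto simp: sqint_def)
    from ip_abs_le[OF this] show ?thesis by (simp add: nsq_def)
  qed
  finally show ?thesis using assms(4) by (simp add: mult_left_mono)
qed (use assms in \<open>auto simp: not_integrable_integral_eq\<close>)

lemma sqint_bounded_bilinear_integrable:
  fixes T :: "'b::euclidean_space \<Rightarrow> 'c::euclidean_space \<Rightarrow> 'e::euclidean_space"
  assumes "bounded_bilinear T" "sqint M f" "sqint M g"
  shows "integrable M (\<lambda>x. T (f x) (g x))"
proof -
  interpret bounded_bilinear T by fact
  obtain K where K: "K > 0" "\<And>a b. norm (T a b) \<le> norm a * norm b * K"
    using pos_bounded by blast
  have "continuous_on UNIV (\<lambda>p. T (fst p) (snd p))"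
    by (intro continuous_on continuous_intros)
  moreover have "(\<lambda>x. (f x, g x)) \<in> borel_measurable M"
    using assms(2,3) by (auto simp: sqint_def)
  ultimately have "(\<lambda>x. T (f x) (g x)) \<in> borel_measurable M"
    using borel_measurable_continuous_on[of "\<lambda>p. T (fst p) (snd p)" "\<lambda>x. (f x, g x)" M] by simp
  then show ?thesis
    by (rule sqint_bilinear_integrable[OF assms(2,3), where K=K]) (use K(2) in \<open>simp add: mult_ac\<close>)
qed

text \<open>Kept general in \<open>T\<close> because it is applied to the inner product, to scaling,
  to complex multiplication, to \<open>cdot\<close> and to the Hermitian product.\<close>

lemma bilinear_integral_tendsto:
  fixes T :: "'b::euclidean_space \<Rightarrow> 'c::euclidean_space \<Rightarrow> 'e::euclidean_space"
  assumes "bounded_bilinear T" "\<And>k. sqint M (f k)" "sqint M f0" "sqint M g"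
    and "(\<lambda>k. nsq M (\<lambda>x. f k x - f0 x)) \<longlonglongrightarrow> 0"
  shows "(\<lambda>k. LINT x|M. T (f k x) (g x)) \<longlonglongrightarrow> (LINT x|M. T (f0 x) (g x))"
proof -
  interpret bounded_bilinear T by fact
  obtain K where K: "K > 0" "\<And>a b. norm (T a b) \<le> norm a * norm b * K"
    using pos_bounded by blast
  have int: "integrable M (\<lambda>x. T (f x) (g x))" if "sqint M f" for f
    by (rule sqint_bounded_bilinear_integrable[OF assms(1) that assms(4)])
  have le: "norm ((LINT x|M. T (f k x) (g x)) - (LINT x|M. T (f0 x) (g x)))
      \<le> K * sqrt (nsq M (\<lambda>x. f k x - f0 x) * nsq M g)" for k
  proof -
    have "(LINT x|M. T (f k x) (g x)) - (LINT x|M. T (f0 x) (g x)) = (LINT x|M. T (f k x - f0 x) (g x))"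
      using int[OF assms(2)] int[OF assms(3)] by (simp add: diff_left)
    also have "norm \<dots> \<le> K * sqrt (nsq M (\<lambda>x. f k x - f0 x) * nsq M g)"
      using K by (intro bilinear_integral_le sqint_diff assms)
        (simp_all add: mult_ac, metis mult.assoc mult.commute)
    finally show ?thesis .
  qed
  have "(\<lambda>k. K * sqrt (nsq M (\<lambda>x. f k x - f0 x) * nsq M g)) \<longlonglongrightarrow> K * sqrt (0 * nsq M g)"
    by (intro tendsto_intros assms(5))
  then have "(\<lambda>k. K * sqrt (nsq M (\<lambda>x. f k x - f0 x) * nsq M g)) \<longlonglongrightarrow> 0" by simp
  then have "(\<lambda>k. (LINT x|M. T (f k x) (g x)) - (LINT x|M. T (f0 x) (g x))) \<longlonglongrightarrow> 0"
    using le by (rule Lim_null_comparison[rotated, OF _ always_eventually[OF allI]])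
  then show ?thesis using Lim_null by blast
qed

lemma ip_tendsto_left:
  assumes "\<And>k. sqint M (f k)" "sqint M f0" "sqint M g"
    and "(\<lambda>k. nsq M (\<lambda>x. f k x - f0 x)) \<longlonglongrightarrow> 0"
  shows "(\<lambda>k. ip M (f k) g) \<longlonglongrightarrow> ip M f0 g"
  unfolding ip_def by (rule bilinear_integral_tendsto[OF bounded_bilinear_inner assms])

lemma nsq_bounded_linear_tendsto:
  assumes "bounded_linear T" "\<And>k. sqint M (f k)" "sqint M f0" "(\<lambda>k. nsq M (\<lambda>x. f k x - f0 x)) \<longlonglongrightarrow> 0"
  shows "(\<lambda>k. nsq M (\<lambda>x. T (f k x) - T (f0 x))) \<longlonglongrightarrow> 0"
proof -
  obtain K where K: "K > 0" "\<And>f. sqint M f \<Longrightarrow> nsq M (\<lambda>x. T (f x)) \<le> K * nsq M f"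
    using nsq_bounded_linear_le[OF assms(1)] by metis
  have "nsq M (\<lambda>x. T (f k x) - T (f0 x)) \<le> K * nsq M (\<lambda>x. f k x - f0 x)" for k
    using K(2)[OF sqint_diff[OF assms(2,3)], of k] by (simp add: linear_diff[OF bounded_linear.linear[OF assms(1)]])
  then have *: "\<forall>k. norm (nsq M (\<lambda>x. T (f k x) - T (f0 x))) \<le> K * nsq M (\<lambda>x. f k x - f0 x)" by simp
  have "(\<lambda>k. K * nsq M (\<lambda>x. f k x - f0 x)) \<longlonglongrightarrow> 0"
    using tendsto_mult_left[OF assms(4), of K] by simp
  then show ?thesis by (rule Lim_null_comparison[OF always_eventually[OF *]])
qed

lemma sqint_AE_cong:
  assumes "AE x in M. f x = g x" "sqint M f" "g \<in> borel_measurable M"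
  shows "sqint M g"
proof -
  have "AE x in M. (norm (f x))\<^sup>2 = (norm (g x))\<^sup>2"
    using assms(1) by auto
  then have "integrable M (\<lambda>x. (norm (f x))\<^sup>2) \<longleftrightarrow> integrable M (\<lambda>x. (norm (g x))\<^sup>2)"
    using assms by (intro integrable_cong_AE) (auto simp: sqint_def)
  then show ?thesis using assms by (simp add: sqint_def)
qed

lemma nsq_eq_0_AE: "sqint M f \<Longrightarrow> nsq M f = 0 \<longleftrightarrow> (AE x in M. f x = 0)"
  unfolding nsq_def sqint_def by (subst integral_nonneg_eq_0_iff_AE) auto

section \<open>Completeness of L2, Riesz representation and best approximation\<close>

lemma Cauchy_fast_subseq:
  fixes d :: "nat \<Rightarrow> nat \<Rightarrow> real" and e :: "nat \<Rightarrow> real"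
  assumes "\<And>e. e > 0 \<Longrightarrow> \<exists>n0. \<forall>m\<ge>n0. \<forall>n\<ge>n0. d m n < e" "\<And>k. e k > 0"
  obtains r where "strict_mono r" "\<And>k m n. m \<ge> r k \<Longrightarrow> n \<ge> r k \<Longrightarrow> d m n < e k"
proof -
  obtain n0 where n0: "\<And>k m n. m \<ge> n0 k \<Longrightarrow> n \<ge> n0 k \<Longrightarrow> d m n < e k"
    using assms(1)[OF assms(2)] by metis
  \<comment> \<open>These partial sums are strictly increasing and each \<open>r k\<close> dominates
    \<open>n0 k\<close>.\<close>
  define r where "r k = (\<Sum>j\<le>k. Suc (n0 j))" for k
  have "strict_mono r" by (simp add: strict_mono_Suc_iff r_def)
  moreover have "r k \<ge> n0 k" for k
  proof -
    have "Suc (n0 k) \<le> r k" unfolding r_def by (rule member_le_sum) auto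
    then show ?thesis by simp
  qed
  ultimately show ?thesis using that n0 by (meson le_trans)
qed

text \<open>Riesz-Fischer theorem. Along a subsequence whose squared increments have integral below
  \<open>(1/4)^k\<close>, even the sum of \<open>2^k\<close> times the squared increments has finite
  integral, which gives convergence almost everywhere. Fatou's lemma makes the pointwise limit an L2
  limit of the whole sequence.\<close>

lemma sqint_complete:
  fixes f :: "nat \<Rightarrow> 'a \<Rightarrow> 'b::euclidean_space"
  assumes f: "\<And>k. sqint M (f k)"
    and cau: "\<And>e. e > 0 \<Longrightarrow> \<exists>n0. \<forall>m\<ge>n0. \<forall>n\<ge>n0. nsq M (\<lambda>x. f m x - f n x) < e"
  obtains g where "sqint M g" "(\<lambda>k. nsq M (\<lambda>x. f k x - g x)) \<longlonglongrightarrow> 0"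
proof -
  have [measurable]: "f k \<in> borel_measurable M" for k using f by (simp add: sqint_def)
  obtain r where r: "strict_mono r"
    and r': "\<And>k m n. m \<ge> r k \<Longrightarrow> n \<ge> r k \<Longrightarrow> nsq M (\<lambda>x. f m x - f n x) < (1/4)^k"
    using Cauchy_fast_subseq[of "\<lambda>m n. nsq M (\<lambda>x. f m x - f n x)" "\<lambda>k. (1/4)^k"] cau by auto
  have nn: "(\<integral>\<^sup>+x. ennreal ((norm (h x))\<^sup>2) \<partial>M) = ennreal (nsq M h)" if "sqint M h" for h :: "'a \<Rightarrow> 'b"
    unfolding nsq_def using that by (intro nn_integral_eq_integral) (auto simp: sqint_def)
  define d where "d k x = (norm (f (r (Suc k)) x - f (r k) x))\<^sup>2" for k x
  have "(\<integral>\<^sup>+x. (\<Sum>k. ennreal (2^k * d k x)) \<partial>M) = (\<Sum>k. \<integral>\<^sup>+x. ennreal (2^k * d k x) \<partial>M)"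
    by (rule nn_integral_suminf) (simp add: d_def)
  also have "\<dots> \<le> (\<Sum>k. ennreal ((1/2)^k))"
  proof (intro suminf_le summableI)
    fix k
    have "(\<integral>\<^sup>+x. ennreal (2^k * d k x) \<partial>M) = 2^k * (\<integral>\<^sup>+x. ennreal (d k x) \<partial>M)"
      by (subst nn_integral_cmult[symmetric]) (auto simp: d_def ennreal_mult ennreal_power[symmetric])
    also have "\<dots> = ennreal (2^k * nsq M (\<lambda>x. f (r (Suc k)) x - f (r k) x))"
      unfolding d_def by (subst nn[OF sqint_diff[OF f f]]) (simp add: ennreal_mult ennreal_power[symmetric])
    also have "\<dots> \<le> ennreal (2^k * (1/4)^k)"
      using r'[of k "r (Suc k)" "r k"] strict_mono_less_eq[OF r, of k "Suc k"]
      by (intro ennreal_leI mult_left_mono) auto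
    also have "(2::real)^k * (1/4)^k = (1/2)^k"
      by (simp add: power_mult_distrib[symmetric])
    finally show "(\<integral>\<^sup>+x. ennreal (2^k * d k x) \<partial>M) \<le> ennreal ((1/2)^k)" .
  qed
  also have "\<dots> = ennreal (\<Sum>k. (1/2)^k)"
    by (rule suminf_ennreal2) auto
  finally have "(\<integral>\<^sup>+x. (\<Sum>k. ennreal (2^k * d k x)) \<partial>M) < \<infinity>"
    by (simp add: order_le_less_trans)
  then have "AE x in M. (\<Sum>k. ennreal (2^k * d k x)) \<noteq> \<infinity>"
    by (intro nn_integral_noteq_infinite) (auto simp: d_def)
  then have ae: "AE x in M. convergent (\<lambda>k. f (r k) x)"
  proof (eventually_elim)
    case (elim x)
    then have s: "summable (\<lambda>k. 2^k * d k x)"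
      by (intro summable_suminf_not_top) (auto simp: d_def)
    have "summable (\<lambda>k. 2^k * d k x + (1/2)^k)"
      by (intro summable_add s) simp
    then have "summable (\<lambda>k. norm (f (r (Suc k)) x - f (r k) x))"
    proof (rule summable_comparison_test_ev[rotated], intro always_eventually allI)
      fix k
      define a where "a = norm (f (r (Suc k)) x - f (r k) x)"
      \<comment> \<open>From \<open>y \<le> y^2 + 1\<close> with \<open>y = 2^k * a\<close>, divided
        by \<open>2^k\<close>: the increments themselves are dominated by the summable
        \<open>2^k * d k x + (1/2)^k\<close>.\<close>
      have "2 * (2^k * a) * 1 \<le> (2^k * a)\<^sup>2 + 1\<^sup>2" by (rule sum_squares_bound)
      then have "2^k * a \<le> (2^k * a)\<^sup>2 + 1" using zero_le_power2[of "2^k * a"]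
        by (smt (verit) power_one mult_cancel_left2)
      then have "(1/2)^k * (2^k * a) \<le> (1/2)^k * ((2^k * a)\<^sup>2 + 1)"
        by (intro mult_left_mono) auto
      also have "\<dots> = 2^k * a\<^sup>2 + (1/2)^k"
        by (simp add: field_simps power2_eq_square power_mult_distrib[symmetric])
      also have "(1/2)^k * (2^k * a) = a" by (simp add: field_simps power_mult_distrib[symmetric])
      finally have "a \<le> 2^k * a\<^sup>2 + (1/2)^k" .
      then show "norm (norm (f (r (Suc k)) x - f (r k) x)) \<le> 2^k * d k x + (1/2)^k"
        by (simp add: a_def d_def)
    qed
    then have "summable (\<lambda>k. f (r (Suc k)) x - f (r k) x)" by (rule summable_norm_cancel)
    then have "convergent (\<lambda>n. \<Sum>k<n. f (r (Suc k)) x - f (r k) x)"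
      by (simp add: summable_iff_convergent)
    then have "convergent (\<lambda>n. f (r n) x - f (r 0) x)"
      by (simp only: sum_lessThan_telescope[of "\<lambda>k. f (r k) x"])
    then show ?case
      using convergent_add[OF _ convergent_const[of "f (r 0) x"]] by fastforce
  qed
  define g where "g x = lim (\<lambda>k. f (r k) x)" for x
  have [measurable]: "g \<in> borel_measurable M" unfolding g_def by measurable
  have lim: "AE x in M. (\<lambda>k. f (r k) x) \<longlonglongrightarrow> g x"
    using ae by (eventually_elim) (simp add: g_def convergent_LIMSEQ_iff)
  have fatou: "(\<integral>\<^sup>+x. ennreal ((norm (f n x - g x))\<^sup>2) \<partial>M) \<le> ennreal ((1/4)^k)" if "n \<ge> r k" for n k
  proof -
    have "(\<integral>\<^sup>+x. ennreal ((norm (f n x - g x))\<^sup>2) \<partial>M)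
        = (\<integral>\<^sup>+x. liminf (\<lambda>j. ennreal ((norm (f n x - f (r j) x))\<^sup>2)) \<partial>M)"
      using lim
    proof (intro nn_integral_cong_AE, eventually_elim)
      case (elim x)
      then have "(\<lambda>j. ennreal ((norm (f n x - f (r j) x))\<^sup>2)) \<longlonglongrightarrow> ennreal ((norm (f n x - g x))\<^sup>2)"
        by (intro tendsto_intros)
      from lim_imp_Liminf[OF sequentially_bot this] show ?case by (rule sym)
    qed
    also have "\<dots> \<le> liminf (\<lambda>j. \<integral>\<^sup>+x. ennreal ((norm (f n x - f (r j) x))\<^sup>2) \<partial>M)"
      by (rule nn_integral_liminf) measurable
    also have "\<dots> \<le> ennreal ((1/4)^k)"
    proof (rule Liminf_le)
      show "\<forall>\<^sub>F j in sequentially. (\<integral>\<^sup>+x. ennreal ((norm (f n x - f (r j) x))\<^sup>2) \<partial>M) \<le> ennreal ((1/4)^k)"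
        using eventually_ge_at_top[of k]
      proof eventually_elim
        case (elim j)
        then have "r k \<le> r j" using strict_mono_less_eq[OF r] by simp
        with r'[OF that this] show ?case
          by (subst nn[OF sqint_diff[OF f f]]) (simp add: ennreal_leI)
      qed
    qed simp
    finally show ?thesis .
  qed
  have fg: "sqint M (\<lambda>x. f n x - g x)" if "n \<ge> r k" for n k
    unfolding sqint_def using fatou[OF that]
    by (auto intro!: integrableI_nonneg simp: le_less_trans[OF _ ennreal_less_top])
  have g: "sqint M g"
    using sqint_diff[OF f[of "r 0"] fg[OF order_refl[of "r 0"]]] by simp
  have le: "nsq M (\<lambda>x. f n x - g x) \<le> (1/4)^k" if "n \<ge> r k" for n k
    using fatou[OF that] nn[OF fg[OF that]] by simp
  have "(\<lambda>k. nsq M (\<lambda>x. f k x - g x)) \<longlonglongrightarrow> 0"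
  proof (rule LIMSEQ_I)
    fix e :: real assume "e > 0"
    then obtain k where "(1/4::real)^k < e"
      using real_arch_pow_inv[of e "1/4"] by auto
    then have "\<forall>n\<ge>r k. norm (nsq M (\<lambda>x. f n x - g x) - 0) < e"
      using le[of k] by (auto intro: le_less_trans)
    then show "\<exists>no. \<forall>n\<ge>no. norm (nsq M (\<lambda>x. f n x - g x) - 0) < e" by blast
  qed
  with g that show ?thesis by blast
qed

text \<open>The sequence \<open>u\<close> minimizes \<open>\<parallel>v\<parallel>\<^sup>2 - 2 L v\<close> over \<open>S\<close>, and \<open>w\<close> is its limit.\<close>

lemma sqint_riesz:
  fixes S :: "('a \<Rightarrow> 'b::euclidean_space) set" and L :: "('a \<Rightarrow> 'b) \<Rightarrow> real"
  assumes S: "\<And>v. v \<in> S \<Longrightarrow> sqint M v" and S0: "S \<noteq> {}"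
    and Sadd: "\<And>u v. u \<in> S \<Longrightarrow> v \<in> S \<Longrightarrow> (\<lambda>x. u x + v x) \<in> S"
    and Sscale: "\<And>c v. v \<in> S \<Longrightarrow> (\<lambda>x. c *\<^sub>R v x) \<in> S"
    and Ladd: "\<And>u v. u \<in> S \<Longrightarrow> v \<in> S \<Longrightarrow> L (\<lambda>x. u x + v x) = L u + L v"
    and Lscale: "\<And>c v. v \<in> S \<Longrightarrow> L (\<lambda>x. c *\<^sub>R v x) = c * L v"
    and Lbd: "\<And>v. v \<in> S \<Longrightarrow> (L v)\<^sup>2 \<le> C * nsq M v"
  obtains w u where "sqint M w" "\<And>k::nat. u k \<in> S" "(\<lambda>k. nsq M (\<lambda>x. u k x - w x)) \<longlonglongrightarrow> 0"
    "\<And>v. v \<in> S \<Longrightarrow> ip M w v = L v"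
proof -
  define J where "J v = nsq M v - 2 * L v" for v
  have Jge: "J v \<ge> - \<bar>C\<bar>" if "v \<in> S" for v
  proof -
    have "(L v)\<^sup>2 \<le> \<bar>C\<bar> * nsq M v"
      using Lbd[OF that] by (smt (verit) mult_right_mono nsq_nonneg)
    then have "\<bar>L v\<bar> \<le> sqrt (\<bar>C\<bar> * nsq M v)" by (intro real_le_rsqrt) simp
    also have "\<dots> = sqrt \<bar>C\<bar> * sqrt (nsq M v)" by (simp add: real_sqrt_mult)
    finally have "2 * L v \<le> 2 * sqrt \<bar>C\<bar> * sqrt (nsq M v)" by linarith
    also have "\<dots> \<le> (sqrt \<bar>C\<bar>)\<^sup>2 + (sqrt (nsq M v))\<^sup>2" by (rule sum_squares_bound)
    finally show ?thesis by (simp add: J_def)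
  qed
  define d where "d = Inf (J ` S)"
  have bdd: "bdd_below (J ` S)" using Jge by (intro bdd_belowI2)
  have dle: "d \<le> J v" if "v \<in> S" for v
    unfolding d_def using that bdd by (intro cInf_lower) auto
  have "\<exists>v\<in>S. J v < d + inverse (Suc k)" for k
    using cInf_lessD[of "J ` S" "d + inverse (Suc k)"] S0 by (auto simp: d_def)
  then obtain u where u: "\<And>k. u k \<in> S" "\<And>k. J (u k) < d + inverse (Suc k)" by metis
  \<comment> \<open>Parallelogram law: the midpoint \<open>m\<close> also satisfies
    \<open>d \<le> J m\<close>, which forces two near-minimizers to be close to each other.\<close>
  have par: "nsq M (\<lambda>x. a x - b x) \<le> 2 * (J a - d) + 2 * (J b - d)" if "a \<in> S" "b \<in> S" for a b
  proof -
    define m where "m = (\<lambda>x. (1/2) *\<^sub>R (a x + b x))"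
    have mS: "m \<in> S" unfolding m_def using that by (intro Sscale Sadd)
    have Lm: "L m = (L a + L b) / 2"
      unfolding m_def using that by (subst Lscale) (auto simp: Ladd Sadd)
    have nm: "nsq M m = nsq M (\<lambda>x. a x + b x) / 4"
      unfolding m_def by (subst nsq_scaleR) (simp add: power2_eq_square)
    show ?thesis
      using dle[OF mS] nsq_add[OF S[OF that(1)] S[OF that(2)]] nsq_diff[OF S[OF that(1)] S[OF that(2)]]
      by (simp add: J_def Lm nm field_simps)
  qed
  have cau: "\<exists>n0. \<forall>m\<ge>n0. \<forall>n\<ge>n0. nsq M (\<lambda>x. u m x - u n x) < e" if "e > 0" for e
  proof -
    obtain n0 where n0: "inverse (real (Suc n0)) < e / 4"
      using reals_Archimedean[of "e/4"] \<open>e > 0\<close> by auto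
    have "nsq M (\<lambda>x. u m x - u n x) < e" if "m \<ge> n0" "n \<ge> n0" for m n
    proof -
      have "inverse (real (Suc m)) \<le> inverse (real (Suc n0))" "inverse (real (Suc n)) \<le> inverse (real (Suc n0))"
        using that by (auto intro!: le_imp_inverse_le)
      then have "J (u m) < d + e / 4" "J (u n) < d + e / 4"
        using order.strict_trans[OF u(2)[of m]] order.strict_trans[OF u(2)[of n]] n0
        by (meson add_strict_left_mono order_le_less_trans)+
      then have "2 * (J (u m) - d) + 2 * (J (u n) - d) < 2 * (e / 4) + 2 * (e / 4)"
        by (intro add_strict_mono) simp_all
      also have "\<dots> = e" by simp
      finally show ?thesis
        using par[OF u(1)[of m] u(1)[of n]] by (rule order.strict_trans1[rotated])
    qed
    then show ?thesis by blast
  qed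
  obtain w where w: "sqint M w" "(\<lambda>k. nsq M (\<lambda>x. u k x - w x)) \<longlonglongrightarrow> 0"
    using sqint_complete[OF S[OF u(1)] cau] by blast
  have orth: "ip M w v = L v" if v: "v \<in> S" for v
  proof -
    have sq: "(ip M (u k) v - L v)\<^sup>2 \<le> inverse (Suc k) * nsq M v" for k
    proof -
      \<comment> \<open>First variation: \<open>J (u k - t v) - d\<close> is a nonnegative quadratic
        polynomial in \<open>t\<close>, and its discriminant bounds the residual by the excess of
        \<open>J (u k)\<close> over the infimum.\<close>
      have "(ip M (u k) v - L v)\<^sup>2 \<le> (J (u k) - d) * nsq M v"
      proof (rule quadratic_nonneg_discriminant)
        fix t
        have "(\<lambda>x. u k x + (- t) *\<^sub>R v x) \<in> S" using u v by (intro Sadd Sscale)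
        note d1 = dle[OF this]
        have "J (\<lambda>x. u k x + (- t) *\<^sub>R v x) = J (u k) - 2 * t * (ip M (u k) v - L v) + t\<^sup>2 * nsq M v"
          unfolding J_def 
          by (subst Ladd[OF u(1) Sscale[OF v]], subst Lscale[OF v],
              subst nsq_add[OF S[OF u(1)] sqint_scaleR[OF S[OF v]]], subst nsq_scaleR)
             (simp add: ip_scaleR_right[of _ _ "-t", simplified] algebra_simps)
        with d1 show "0 \<le> J (u k) - d - 2 * t * (ip M (u k) v - L v) + t\<^sup>2 * nsq M v" by simp
      qed simp
      also have "\<dots> \<le> inverse (Suc k) * nsq M v"
        using u(2)[of k] by (intro mult_right_mono) auto
      finally show ?thesis .
    qed
    have "(\<lambda>k. (ip M (u k) v - L v)\<^sup>2) \<longlonglongrightarrow> (ip M w v - L v)\<^sup>2"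
      by (intro tendsto_intros ip_tendsto_left w S u v)
    moreover have "(\<lambda>k. inverse (real (Suc k)) * nsq M v) \<longlonglongrightarrow> 0 * nsq M v"
      by (intro tendsto_intros LIMSEQ_inverse_real_of_nat)
    ultimately have "(ip M w v - L v)\<^sup>2 \<le> 0 * nsq M v"
      by (rule LIMSEQ_le) (use sq in auto)
    then show ?thesis by simp
  qed
  show ?thesis using that[OF w(1) u(1) w(2) orth] .
qed

text \<open>The limit \<open>w\<close> need not lie in \<open>S\<close>, so \<open>w - v\<close> is
  not itself an admissible test function; the orthogonality of \<open>f - w\<close> to it is
  obtained in the limit from \<open>u k - v\<close>. Pythagoras then gives the inequality.\<close>

lemma best_approximation:
  assumes S: "\<And>v. v \<in> S \<Longrightarrow> sqint M v" and f: "sqint M f" and w: "sqint M w"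
    and Sdiff: "\<And>u v. u \<in> S \<Longrightarrow> v \<in> S \<Longrightarrow> (\<lambda>x. u x - v x) \<in> S"
    and u: "\<And>k::nat. u k \<in> S" "(\<lambda>k. nsq M (\<lambda>x. u k x - w x)) \<longlonglongrightarrow> 0"
    and orth: "\<And>v. v \<in> S \<Longrightarrow> ip M w v = ip M f v" and v: "v \<in> S"
  shows "nsq M (\<lambda>x. f x - w x) \<le> nsq M (\<lambda>x. f x - v x)"
proof -
  have wv: "sqint M (\<lambda>x. w x - v x)" and fw: "sqint M (\<lambda>x. f x - w x)" 
    using S v f w by (auto intro: sqint_diff)
  have o: "ip M (\<lambda>x. f x - w x) y = 0" if "y \<in> S" for y
    using ip_diff_left[OF f w S[OF that]] orth[OF that] by simp
  have "(\<lambda>k. ip M (\<lambda>x. u k x - v x) (\<lambda>x. f x - w x)) \<longlonglongrightarrow> ip M (\<lambda>x. w x - v x) (\<lambda>x. f x - w x)"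
    using u by (intro ip_tendsto_left S Sdiff v wv fw) simp_all
  moreover have "ip M (\<lambda>x. u k x - v x) (\<lambda>x. f x - w x) = 0" for k
    using o[OF Sdiff[OF u(1) v]] by (simp add: ip_commute)
  ultimately have "ip M (\<lambda>x. w x - v x) (\<lambda>x. f x - w x) = 0"
    by (simp add: LIMSEQ_const_iff)
  then have "nsq M (\<lambda>x. (f x - w x) + (w x - v x)) = nsq M (\<lambda>x. f x - w x) + nsq M (\<lambda>x. w x - v x)"
    by (subst nsq_add[OF fw wv]) (simp add: ip_commute)
  then show ?thesis by simp
qed

section \<open>Smooth functions and cutoffs\<close>

definition smooth :: "(real ^ 'd \<Rightarrow> 'b::real_normed_vector) \<Rightarrow> bool" where
  "smooth f \<longleftrightarrow> (\<forall>k. Ck k f)"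

lemma partial_eq: "(f has_derivative D) (at x) \<Longrightarrow> partial i f x = D (axis i 1)"
  by (simp add: partial_def frechet_derivative_at[symmetric])

section \<open>Closure of smooth functions under algebraic operations\<close>

lemma Ck_Suc_imp: "Ck (Suc k) f \<Longrightarrow> Ck k f"
proof (induction k arbitrary: f)
  case 0
  then show ?case
    by (auto simp: continuous_on_eq_continuous_at intro: differentiable_imp_continuous_within)
qed auto

lemma Ck_continuous: "Ck k f \<Longrightarrow> continuous_on UNIV f"
proof (induction k)
  case (Suc k)
  then show ?case using Ck_Suc_imp by blast
qed simp

lemma smooth_continuous: "smooth f \<Longrightarrow> continuous_on UNIV f"
  unfolding smooth_def using Ck_continuous by blast

lemma smooth_differentiable: "smooth f \<Longrightarrow> f differentiable (at x)"
  unfolding smooth_def by (metis Ck.simps(2))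

lemma smooth_partial: "smooth f \<Longrightarrow> smooth (partial i f)"
  unfolding smooth_def by (metis Ck.simps(2))

lemma Ck_const [simp]: "Ck k (\<lambda>x::real^'d. c)"
proof (induction k arbitrary: c)
  case (Suc k)
  have "partial i (\<lambda>x::real^'d. c) = (\<lambda>x. 0)" for i
    by (rule ext, subst partial_eq[of _ "\<lambda>x. 0"]) auto
  then show ?case using Suc by simp
qed simp

lemma partial_bounded_linear:
  assumes "bounded_linear T" "f differentiable (at x)"
  shows "partial i (\<lambda>x. T (f x)) x = T (partial i f x)"
  using assms bounded_linear.has_derivative[OF assms(1) iffD1[OF frechet_derivative_works assms(2)]]
  by (auto simp: partial_def[of i f] intro!: partial_eq[THEN trans])

lemma Ck_bounded_linear:
  assumes "bounded_linear T"
  shows "Ck k f \<Longrightarrow> Ck k (\<lambda>x. T (f x))"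
proof (induction k arbitrary: f)
  case 0
  then show ?case using bounded_linear.continuous_on[OF assms] by auto
next
  case (Suc k)
  then have "partial i (\<lambda>x. T (f x)) = (\<lambda>x. T (partial i f x))" for i
    by (intro ext partial_bounded_linear[OF assms]) auto
  moreover have "(\<lambda>x. T (f x)) differentiable at x" for x
    using Suc.prems bounded_linear.has_derivative[OF assms iffD1[OF frechet_derivative_works]] 
    by (intro differentiableI) auto
  ultimately show ?case using Suc by simp
qed

lemma partial_bilinear:
  assumes "bounded_bilinear B" "f differentiable (at x)" "g differentiable (at x)"
  shows "partial i (\<lambda>x. B (f x) (g x)) x = B (f x) (partial i g x) + B (partial i f x) (g x)"
  using bounded_bilinear.FDERIV[OF assms(1) iffD1[OF frechet_derivative_works assms(2)] iffD1[OF frechet_derivative_works assms(3)]]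
  by (auto simp: partial_def[of i f] partial_def[of i g] intro!: partial_eq[THEN trans])

lemma partial_add:
  assumes "f differentiable (at x)" "g differentiable (at x)"
  shows "partial i (\<lambda>x. f x + g x) x = partial i f x + partial i g x"
  using has_derivative_add[OF iffD1[OF frechet_derivative_works assms(1)] iffD1[OF frechet_derivative_works assms(2)]]
  by (auto simp: partial_def[of i f] partial_def[of i g] intro!: partial_eq[THEN trans])

lemma Ck_add: "Ck k f \<Longrightarrow> Ck k g \<Longrightarrow> Ck k (\<lambda>x. f x + g x)"
proof (induction k arbitrary: f g)
  case 0
  then show ?case by (auto intro: continuous_intros)
next
  case (Suc k)
  then have "partial i (\<lambda>x. f x + g x) = (\<lambda>x. partial i f x + partial i g x)" for i
    by (intro ext partial_add) auto
  with Suc show ?case by (auto intro: differentiable_add)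
qed

lemma Ck_bilinear:
  assumes "bounded_bilinear B"
  shows "Ck k f \<Longrightarrow> Ck k g \<Longrightarrow> Ck k (\<lambda>x. B (f x) (g x))"
proof (induction k arbitrary: f g)
  case 0
  then show ?case using bounded_bilinear.continuous_on[OF assms] by auto
next
  case (Suc k)
  then have p: "partial i (\<lambda>x. B (f x) (g x)) = (\<lambda>x. B (f x) (partial i g x) + B (partial i f x) (g x))" for i
    by (intro ext partial_bilinear[OF assms]) auto
  have "(\<lambda>x. B (f x) (g x)) differentiable at x" for x
    using Suc.prems
    by (intro differentiableI[OF bounded_bilinear.FDERIV[OF assms iffD1[OF frechet_derivative_works]
            iffD1[OF frechet_derivative_works]]]) auto
  moreover have "Ck k f" "Ck k g" using Suc.prems Ck_Suc_imp by blast+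
  ultimately show ?case unfolding Ck.simps p using Suc by (auto intro!: Ck_add Suc.IH)
qed

lemma smooth_const [simp]: "smooth (\<lambda>x. c)" by (simp add: smooth_def)

lemma smooth_bounded_linear: "bounded_linear T \<Longrightarrow> smooth f \<Longrightarrow> smooth (\<lambda>x. T (f x))"
  by (simp add: smooth_def Ck_bounded_linear)

lemma smooth_bilinear: "bounded_bilinear B \<Longrightarrow> smooth f \<Longrightarrow> smooth g \<Longrightarrow> smooth (\<lambda>x. B (f x) (g x))"
  by (simp add: smooth_def Ck_bilinear)

lemma smooth_add: "smooth f \<Longrightarrow> smooth g \<Longrightarrow> smooth (\<lambda>x. f x + g x)"
  by (simp add: smooth_def Ck_add)

lemma smooth_minus: "smooth f \<Longrightarrow> smooth (\<lambda>x. - f x)"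
  by (rule smooth_bounded_linear[OF bounded_linear_minus[OF bounded_linear_ident]])

lemma smooth_diff: "smooth f \<Longrightarrow> smooth g \<Longrightarrow> smooth (\<lambda>x. f x - g x)"
  using smooth_add[of f "\<lambda>x. - g x"] smooth_minus[of g] by simp

lemma smooth_mult:
  fixes f g :: "real ^ 'd \<Rightarrow> real"
  shows "smooth f \<Longrightarrow> smooth g \<Longrightarrow> smooth (\<lambda>x. f x * g x)"
  by (rule smooth_bilinear[OF bounded_bilinear_mult])

lemma smooth_prod:
  fixes f :: "'i \<Rightarrow> real ^ 'd \<Rightarrow> real"
  shows "(\<And>i. i \<in> I \<Longrightarrow> smooth (f i)) \<Longrightarrow> smooth (\<lambda>x. \<Prod>i\<in>I. f i x)"
  by (induction I rule: infinite_finite_induct) (auto intro: smooth_mult)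

lemma has_derivative_translate:
  assumes "f differentiable (at (x - c))"
  shows "((\<lambda>x. f (x - c)) has_derivative frechet_derivative f (at (x - c))) (at x)"
proof -
  have "((\<lambda>x. x - c) has_derivative (\<lambda>x. x)) (at x)"
    by (auto intro!: derivative_eq_intros)
  from has_derivative_compose[OF this iffD1[OF frechet_derivative_works assms]] show ?thesis .
qed

lemma partial_translate:
  "f differentiable (at (x - c)) \<Longrightarrow> partial i (\<lambda>x. f (x - c)) x = partial i f (x - c)"
  by (simp add: partial_eq[OF has_derivative_translate] partial_def[of i f])

lemma smooth_translate: 
  assumes "smooth f"
  shows "smooth (\<lambda>x. f (x - c))"
proof -
  have "Ck k f \<Longrightarrow> Ck k (\<lambda>x. f (x - c))" for k
  proof (induction k arbitrary: f)
    case 0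
    then have "continuous_on UNIV f" by simp
    then have "continuous_on UNIV (\<lambda>x. f (x - c))"
      by (rule continuous_on_compose2) (auto intro: continuous_intros)
    then show ?case by simp
  next
    case (Suc k)
    then have "partial i (\<lambda>x. f (x - c)) = (\<lambda>x. partial i f (x - c))" for i
      by (intro ext partial_translate) auto
    moreover have "(\<lambda>x. f (x - c)) differentiable at x" for x
      using Suc.prems by (intro differentiableI[OF has_derivative_translate]) auto
    ultimately show ?case using Suc by simp
  qed
  then show ?thesis using assms by (simp add: smooth_def)
qed

lemma has_derivative_sum_partials:
  fixes f :: "real ^ 'd \<Rightarrow> 'b::real_normed_vector"
  assumes "f differentiable (at x)"
  shows "(f has_derivative (\<lambda>v. \<Sum>i\<in>UNIV. (v $ i) *\<^sub>R partial i f x)) (at x)"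
proof -
  have d: "(f has_derivative frechet_derivative f (at x)) (at x)"
    using assms frechet_derivative_works by blast
  interpret linear "frechet_derivative f (at x)" using d has_derivative_linear by blast
  have "frechet_derivative f (at x) v = (\<Sum>i\<in>UNIV. (v $ i) *\<^sub>R partial i f x)" for v
  proof -
    have "v = (\<Sum>i\<in>UNIV. (v $ i) *\<^sub>R axis i 1)" by (simp add: basis_expansion scalar_mult_eq_scaleR[symmetric])
    then have "frechet_derivative f (at x) v = frechet_derivative f (at x) (\<Sum>i\<in>UNIV. (v $ i) *\<^sub>R axis i 1)" by simp
    then show ?thesis by (simp add: sum scaleR partial_def)
  qed
  with d show ?thesis by (metis (no_types, lifting) ext)
qed

lemma partial_inverse:
  fixes f :: "real ^ 'd \<Rightarrow> real"
  assumes "f differentiable (at x)" "f x \<noteq> 0"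
  shows "partial i (\<lambda>x. inverse (f x)) x = - (inverse (f x) * partial i f x * inverse (f x))"
  using Deriv.has_derivative_inverse[OF assms(2) iffD1[OF frechet_derivative_works assms(1)]]
  by (auto simp: partial_def[of i f] intro!: partial_eq[THEN trans])

lemma smooth_inverse:
  fixes f :: "real ^ 'd \<Rightarrow> real"
  assumes "smooth f" "\<And>x. f x \<noteq> 0"
  shows "smooth (\<lambda>x. inverse (f x))"
proof -
  have "Ck k f \<Longrightarrow> Ck k (\<lambda>x. inverse (f x))" for k
  proof (induction k)
    case 0
    then show ?case using assms(2) by (auto intro: continuous_intros)
  next
    case (Suc k)
    then have p: "partial i (\<lambda>x. inverse (f x)) = (\<lambda>x. - (inverse (f x) * partial i f x * inverse (f x)))" for i
      using assms(2) by (intro ext partial_inverse) auto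
    have "Ck k (\<lambda>x. inverse (f x))" using Suc Ck_Suc_imp by blast
    then have "Ck k (\<lambda>x. - (inverse (f x) * partial i f x * inverse (f x)))" for i
      using Suc.prems by (intro Ck_bounded_linear[OF bounded_linear_minus[OF bounded_linear_ident]]
        Ck_bilinear[OF bounded_bilinear_mult]) auto
    moreover have "(\<lambda>x. inverse (f x)) differentiable (at x)" for x
      using Suc.prems assms(2) 
      by (intro differentiableI[OF Deriv.has_derivative_inverse[OF _ iffD1[OF frechet_derivative_works]]]) auto
    ultimately show ?case unfolding Ck.simps p by simp
  qed
  then show ?thesis using assms(1) by (simp add: smooth_def)
qed

section \<open>A flat function and smooth approximations of boxes\<close>

definition eflat :: "nat \<Rightarrow> real \<Rightarrow> real" where
  "eflat n t = (if t > 0 then exp (- (1 / t)) / t ^ n else 0)"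

lemma eflat_tendsto_0: "(eflat n \<longlongrightarrow> 0) (at 0)"
proof -
  have "((\<lambda>t::real. (inverse t) ^ n / exp (inverse t)) \<longlongrightarrow> 0) (at_right 0)"
    by (rule filterlim_compose[OF tendsto_power_div_exp_0 filterlim_inverse_at_top_right])
  moreover have "\<forall>\<^sub>F t in at_right 0. (inverse t) ^ n / exp (inverse t) = eflat n t"
    using eventually_at_right_less[of 0]
    by eventually_elim (simp add: eflat_def exp_minus field_simps inverse_eq_divide)
  ultimately have "(eflat n \<longlongrightarrow> 0) (at_right 0)"
    by (rule Lim_transform_eventually)
  moreover have "(eflat n \<longlongrightarrow> 0) (at_left 0)"
    by (rule tendsto_eventually) (auto simp: eventually_at eflat_def intro!: exI[of _ 1])
  ultimately show ?thesis by (simp add: filterlim_split_at)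
qed

text \<open>The powers of \<open>t\<close> are built into the family so that it is closed under
  differentiation up to linear combinations; smoothness then is a single induction on the order, for
  all \<open>n\<close> at once.\<close>

lemma eflat_deriv: "(eflat n has_real_derivative (eflat (n + 2) t - real n * eflat (n + 1) t)) (at t)"
proof -
  consider "t > 0" | "t < 0" | "t = 0" by linarith
  then show ?thesis
  proof cases
    case 1
    have "((\<lambda>t. exp (- (1 / t)) / t ^ n) has_real_derivative (eflat (n + 2) t - real n * eflat (n + 1) t)) (at t)"
      using 1 by (cases n) (auto intro!: derivative_eq_intros simp: eflat_def field_simps power2_eq_square,
          metis Suc_pred neq0_conv power_Suc)
    moreover have "\<forall>\<^sub>F t in nhds t. eflat n t = exp (- (1 / t)) / t ^ n"
      using eventually_nhds_in_open[of "{0<..}" t] 1 by (auto elim!: eventually_mono simp: eflat_def)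
    ultimately show ?thesis by (simp add: DERIV_cong_ev)
  next
    case 2
    have "\<forall>\<^sub>F t in nhds t. eflat n t = 0"
      using eventually_nhds_in_open[of "{..<0}" t] 2 by (auto elim!: eventually_mono simp: eflat_def)
    then have "(eflat n has_real_derivative 0) (at t)" by (simp add: DERIV_cong_ev[of t t "eflat n" "\<lambda>_. 0"])
    then show ?thesis using 2 by (simp add: eflat_def)
  next
    case 3
    \<comment> \<open>At 0 the difference quotient is the next member of the family, which tends to
      0 by \<open>eflat_tendsto_0\<close>.\<close>
    have "(\<lambda>h. (eflat n (0 + h) - eflat n 0) / h) = eflat (Suc n)"
      by (auto simp: eflat_def)
    then have "(eflat n has_real_derivative 0) (at 0)"
      using eflat_tendsto_0[of "Suc n"] by (simp add: DERIV_def)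
    then show ?thesis using 3 by (simp add: eflat_def)
  qed
qed

lemma eflat_affine_has_derivative:
  "((\<lambda>x::real^'d. eflat n (c + s * x $ i)) has_derivative
     (\<lambda>v. (eflat (n + 2) (c + s * x $ i) - real n * eflat (n + 1) (c + s * x $ i)) * (s * v $ i))) (at x)"
proof -
  have g: "((\<lambda>x::real^'d. c + s * x $ i) has_derivative (\<lambda>v. s * v $ i)) (at x)"
    by (auto intro!: derivative_eq_intros bounded_linear.has_derivative[OF bounded_linear_vec_nth])
  show ?thesis
    using has_derivative_compose[OF g eflat_deriv[of n "c + s * x $ i", unfolded has_field_derivative_def]]
    by simp
qed

lemma smooth_eflat: "smooth (\<lambda>x::real^'d. eflat n (c + s * x $ i))"
proof -
  have "Ck k (\<lambda>x::real^'d. eflat n (c + s * x $ i))" for k n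
  proof (induction k arbitrary: n)
    case 0
    have "(\<lambda>x::real^'d. eflat n (c + s * x $ i)) differentiable at x" for x
      using eflat_affine_has_derivative differentiable_def by blast
    then show ?case
      by (auto simp: continuous_on_eq_continuous_at intro: differentiable_imp_continuous_within)
  next
    case (Suc k)
    have p: "partial j (\<lambda>x::real^'d. eflat n (c + s * x $ i)) = (\<lambda>x. (eflat (n + 2) (c + s * x $ i)
        + (- real n) * eflat (n + 1) (c + s * x $ i)) * (s * axis j 1 $ i))" for j
      by (rule ext, subst partial_eq[OF eflat_affine_has_derivative]) simp
    have "Ck k (\<lambda>x::real^'d. (eflat (n + 2) (c + s * x $ i)
        + (- real n) * eflat (n + 1) (c + s * x $ i)) * (s * axis j 1 $ i))" for j
      by (intro Ck_bilinear[OF bounded_bilinear_mult] Ck_add Ck_const Suc)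
    then show ?case unfolding Ck.simps p
      using eflat_affine_has_derivative differentiable_def by blast
  qed
  then show ?thesis by (simp add: smooth_def)
qed

text \<open>The standard smooth step from 0 to 1 over the unit interval. The denominator is positive
  since \<open>t\<close> or \<open>1 - t\<close> is.\<close>

definition ramp :: "real \<Rightarrow> real" where
  "ramp t = eflat 0 t * inverse (eflat 0 t + eflat 0 (1 - t))"

lemma eflat_0_sum_pos: "eflat 0 t + eflat 0 (1 - t) > 0"
  by (auto simp: eflat_def intro: add_pos_nonneg add_nonneg_pos)

lemma ramp_bounds: "0 \<le> ramp t" "ramp t \<le> 1"
  using eflat_0_sum_pos[of t] 
  by (auto simp: ramp_def field_simps eflat_def split: if_splits)

lemma ramp_0: "t \<le> 0 \<Longrightarrow> ramp t = 0" and ramp_1: "t \<ge> 1 \<Longrightarrow> ramp t = 1"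
  by (auto simp: ramp_def eflat_def)

lemma smooth_ramp: "smooth (\<lambda>x::real^'d. ramp (c + s * x $ i))"
proof -
  have "smooth (\<lambda>x::real^'d. eflat 0 ((1 - c) + (- s) * x $ i))" by (rule smooth_eflat)
  then have "smooth (\<lambda>x::real^'d. eflat 0 (1 - (c + s * x $ i)))" by (simp add: algebra_simps)
  then show ?thesis unfolding ramp_def using eflat_0_sum_pos
    by (intro smooth_mult smooth_inverse smooth_add smooth_eflat) (auto simp: less_imp_neq[symmetric])
qed

text \<open>For large steepness \<open>s\<close> this approximates the indicator of the open box
  from below. Boxes are used instead of balls because products of one-variable ramps suffice and
  because the differentiation theorem used in \<open>AE_zero_of_test_integrals_zero\<close> averages
  over cubes.\<close>

definition box_bump :: "real \<Rightarrow> real ^ 'd \<Rightarrow> real ^ 'd \<Rightarrow> real ^ 'd \<Rightarrow> real" where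
  "box_bump s a b x = (\<Prod>i\<in>UNIV. ramp (s * (x $ i - a $ i)) * ramp (s * (b $ i - x $ i)))"

lemma smooth_box_bump: "smooth (box_bump s (a::real^'d) b)"
proof -
  have "smooth (\<lambda>x::real^'d. ramp (s * (x $ i - a $ i)))" for i
    using smooth_ramp[of "- s * a $ i" s i] by (simp add: algebra_simps)
  moreover have "smooth (\<lambda>x::real^'d. ramp (s * (b $ i - x $ i)))" for i
    using smooth_ramp[of "s * b $ i" "- s" i] by (simp add: algebra_simps)
  ultimately show ?thesis unfolding box_bump_def[abs_def] by (intro smooth_prod smooth_mult)
qed

lemma box_bump_bounds: "0 \<le> box_bump s a b x" "box_bump s a b x \<le> 1"
  unfolding box_bump_def by (auto intro!: prod_nonneg prod_le_1 mult_le_one simp: ramp_bounds)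

lemma box_bump_eq_0: "s \<ge> 0 \<Longrightarrow> x \<notin> box a b \<Longrightarrow> box_bump s a b x = 0"
  unfolding box_bump_def mem_box_cart
  by (auto simp: not_less intro!: bexI[rotated] ramp_0 mult_nonneg_nonpos)

lemma box_bump_eq_1:
  "(\<And>i. s * (x $ i - a $ i) \<ge> 1) \<Longrightarrow> (\<And>i. s * (b $ i - x $ i) \<ge> 1) \<Longrightarrow> box_bump s a b x = 1"
  unfolding box_bump_def by (simp add: ramp_1)

lemma box_bump_tendsto: "(\<lambda>n. box_bump (real n) a b x) \<longlonglongrightarrow> indicator (box a b) x"
proof (cases "x \<in> box a b")
  case True
  then have pos: "x $ i - a $ i > 0" "b $ i - x $ i > 0" for i by (auto simp: mem_box_cart)
  have ev: "\<forall>\<^sub>F n in sequentially. real n * e \<ge> 1" if e: "e > 0" for e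
  proof -
    obtain N where N: "real N * e > 1" using reals_Archimedean3[OF e] by auto
    show ?thesis using eventually_ge_at_top[of N]
      by eventually_elim (use N e in \<open>smt (verit) mult_right_mono of_nat_mono\<close>)
  qed
  have "\<forall>\<^sub>F n in sequentially. \<forall>i\<in>UNIV. real n * (x $ i - a $ i) \<ge> 1 \<and> real n * (b $ i - x $ i) \<ge> 1"
    using pos ev by (intro eventually_ball_finite) (auto intro: eventually_conj)
  then have "\<forall>\<^sub>F n in sequentially. box_bump (real n) a b x = 1"
    by eventually_elim (simp add: box_bump_eq_1)
  then show ?thesis using True by (simp add: tendsto_eventually)
qed (simp add: box_bump_eq_0)

section \<open>Test functions and smooth Urysohn functions\<close>

lemma test_funI:
  assumes "smooth f" "compact K" "K \<subseteq> \<Omega>" "\<And>x. x \<notin> K \<Longrightarrow> f x = 0"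
  shows "f \<in> test_fun \<Omega>"
proof -
  have "closure {x. f x \<noteq> 0} \<subseteq> K"
    using assms by (intro closure_minimal) (auto intro: compact_imp_closed)
  moreover have "bounded {x. f x \<noteq> 0}"
    using assms by (intro bounded_subset[OF compact_imp_bounded[OF assms(2)]]) auto
  ultimately show ?thesis using assms 
    unfolding test_fun_def smooth_def by auto
qed

lemma test_funE:
  assumes "f \<in> test_fun \<Omega>"
  obtains K where "smooth f" "compact K" "K \<subseteq> \<Omega>" "\<And>x. x \<notin> K \<Longrightarrow> f x = 0"
proof (rule that[of "closure {x. f x \<noteq> 0}"])
  show "x \<notin> closure {x. f x \<noteq> 0} \<Longrightarrow> f x = 0" for x
    using closure_subset[of "{x. f x \<noteq> 0}"] by auto
qed (use assms in \<open>auto simp: test_fun_def smooth_def\<close>)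

lemma test_fun_smooth: "f \<in> test_fun \<Omega> \<Longrightarrow> smooth f"
  by (simp add: test_fun_def smooth_def)

lemma test_fun_outside: "f \<in> test_fun \<Omega> \<Longrightarrow> x \<notin> \<Omega> \<Longrightarrow> f x = 0"
  by (metis test_funE subsetD)

lemma partial_eq_0_outside:
  assumes "closed K" "\<And>x. x \<notin> K \<Longrightarrow> f x = 0" "x \<notin> K"
  shows "partial i f x = 0"
proof -
  have "(f has_derivative (\<lambda>v. 0)) (at x)"
    using assms by (intro has_derivative_transform_within_open[OF has_derivative_const[of 0], of "- K"]) auto
  from partial_eq[OF this] show ?thesis .
qed

lemma test_fun_partial: "f \<in> test_fun \<Omega> \<Longrightarrow> partial i f \<in> test_fun \<Omega>"
  by (erule test_funE, rule test_funI)
     (auto intro: smooth_partial partial_eq_0_outside dest: compact_imp_closed)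

lemma test_fun_zero [simp]: "(\<lambda>x. 0) \<in> test_fun \<Omega>"
  by (rule test_funI[of _ "{}"]) auto

lemma test_fun_add:
  assumes "f \<in> test_fun \<Omega>" "g \<in> test_fun \<Omega>"
  shows "(\<lambda>x. f x + g x) \<in> test_fun \<Omega>"
proof -
  obtain K where "smooth f" "compact K" "K \<subseteq> \<Omega>" "\<And>x. x \<notin> K \<Longrightarrow> f x = 0" using assms test_funE by blast
  moreover obtain K' where "smooth g" "compact K'" "K' \<subseteq> \<Omega>" "\<And>x. x \<notin> K' \<Longrightarrow> g x = 0" using assms test_funE by blast
  ultimately show ?thesis by (intro test_funI[of _ "K \<union> K'"] smooth_add) auto
qed

lemma test_fun_bounded_linear:
  assumes "bounded_linear T" "f \<in> test_fun \<Omega>"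
  shows "(\<lambda>x. T (f x)) \<in> test_fun \<Omega>"
proof -
  obtain K where K: "smooth f" "compact K" "K \<subseteq> \<Omega>" "\<And>x. x \<notin> K \<Longrightarrow> f x = 0"
    by (rule test_funE[OF assms(2)]) (rule that)
  show ?thesis
    by (rule test_funI[OF smooth_bounded_linear[OF assms(1) K(1)] K(2,3)])
       (simp add: K(4) linear_0[OF bounded_linear.linear[OF assms(1)]])
qed

lemma test_fun_bilinear:
  assumes "bounded_bilinear B" "f \<in> test_fun \<Omega>" "smooth g"
  shows "(\<lambda>x. B (f x) (g x)) \<in> test_fun \<Omega>"
proof -
  obtain K where K: "smooth f" "compact K" "K \<subseteq> \<Omega>" "\<And>x. x \<notin> K \<Longrightarrow> f x = 0"
    by (rule test_funE[OF assms(2)]) (rule that)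
  show ?thesis
    by (rule test_funI[OF smooth_bilinear[OF assms(1) K(1) assms(3)] K(2,3)])
       (simp add: K(4) bounded_bilinear.zero_left[OF assms(1)])
qed

lemma test_fun_scaleR: "f \<in> test_fun \<Omega> \<Longrightarrow> (\<lambda>x. c *\<^sub>R f x) \<in> test_fun \<Omega>"
  by (rule test_fun_bounded_linear[OF bounded_linear_scaleR_right])

lemma box_bump_test_fun: "cbox a b \<subseteq> \<Omega> \<Longrightarrow> s \<ge> 0 \<Longrightarrow> box_bump s a b \<in> test_fun \<Omega>"
  by (rule test_funI[OF smooth_box_bump compact_cbox]) (auto simp: box_bump_eq_0 dest!: contra_subsetD[OF box_subset_cbox])

lemma bump_at_point:
  fixes x :: "real ^ 'd"
  assumes "open U" "x \<in> U"
  obtains f V where "f \<in> test_fun U" "\<And>y. 0 \<le> f y" "\<And>y. f y \<le> (1::real)" "open V" "x \<in> V" "\<And>y. y \<in> V \<Longrightarrow> f y = 1"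
proof -
  obtain e where e: "e > 0" "cball x e \<subseteq> U" using assms open_contains_cball by blast
  \<comment> \<open>The sum of the coordinates' absolute values bounds the norm, so a cube of
    half-side \<open>e / CARD('d)\<close> fits into the ball of radius \<open>e\<close>.\<close>
  define r where "r = e / real CARD('d)"
  have r: "r > 0" using e by (simp add: r_def)
  define a b where "a = (\<chi> i. x $ i - r)" and "b = (\<chi> i. x $ i + r)"
  have "cbox a b \<subseteq> cball x e"
  proof
    fix y assume "y \<in> cbox a b"
    then have c: "\<bar>x $ i - y $ i\<bar> \<le> r" for i by (auto simp: mem_box_cart a_def b_def abs_le_iff algebra_simps)
    have "norm (x - y) \<le> (\<Sum>i\<in>UNIV. \<bar>(x - y) $ i\<bar>)" by (rule norm_le_l1_cart)
    also have "\<dots> \<le> (\<Sum>i\<in>(UNIV::'d set). r)" using c by (intro sum_mono) simp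
    finally show "y \<in> cball x e" by (simp add: dist_norm r_def)
  qed
  \<comment> \<open>With steepness \<open>2 / r\<close> all ramps have reached 1 at depth
    \<open>r / 2\<close> inside the cube, hence on \<open>ball x (r/2)\<close>.\<close>
  then have t: "box_bump (2 / r) a b \<in> test_fun U" using e r by (intro box_bump_test_fun) auto
  show ?thesis
  proof (rule that[OF t box_bump_bounds, of "ball x (r/2)"])
    fix y assume y: "y \<in> ball x (r / 2)"
    have "\<bar>x $ i - y $ i\<bar> \<le> r / 2" for i
      using component_le_norm_cart[of "x - y" i] y by (simp add: dist_norm)
    then have "r / 2 \<le> y $ i - a $ i" "r / 2 \<le> b $ i - y $ i" for i
      by (auto simp: a_def b_def abs_le_iff algebra_simps) (smt (verit) field_sum_of_halves)+
    then have "2 / r * (r / 2) \<le> 2 / r * (y $ i - a $ i)" "2 / r * (r / 2) \<le> 2 / r * (b $ i - y $ i)" for i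
      using r by (intro mult_left_mono; simp)+
    then show "box_bump (2 / r) a b y = 1" using r by (intro box_bump_eq_1) auto
  qed (use r in auto)
qed

text \<open>That \<open>f\<close> is 1 on a neighbourhood of \<open>K\<close>, and not only on
  \<open>K\<close>, is what \<open>div_solvable_Un\<close> relies on: there \<open>1 - f\<close> has
  to vanish near the part of a support that \<open>U2\<close> misses.\<close>

lemma smooth_urysohn:
  fixes U :: "(real ^ 'd) set"
  assumes "compact K" "open U" "K \<subseteq> U"
  obtains f V where "f \<in> test_fun U" "\<And>y. 0 \<le> f y" "\<And>y. f y \<le> (1::real)"
    "open V" "K \<subseteq> V" "\<And>y. y \<in> V \<Longrightarrow> f y = 1"
proof -
  define Q where "Q x f V \<longleftrightarrow> f \<in> test_fun U \<and> (\<forall>y. 0 \<le> f y) \<and> (\<forall>y. f y \<le> (1::real)) \<and>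
      open V \<and> x \<in> V \<and> (\<forall>y\<in>V. f y = 1)" for x f V
  have "\<exists>f V. Q x f V" if "x \<in> K" for x
    unfolding Q_def using bump_at_point[of U x] assms that by (metis subsetD)
  then obtain F V where FV: "\<And>x. x \<in> K \<Longrightarrow> Q x (F x) (V x)" by metis
  have F: "\<And>x. x \<in> K \<Longrightarrow> F x \<in> test_fun U" "\<And>x y. x \<in> K \<Longrightarrow> 0 \<le> F x y"
      "\<And>x y. x \<in> K \<Longrightarrow> F x y \<le> (1::real)" and V: "\<And>x. x \<in> K \<Longrightarrow> open (V x)" "\<And>x. x \<in> K \<Longrightarrow> x \<in> V x"
      "\<And>x y. x \<in> K \<Longrightarrow> y \<in> V x \<Longrightarrow> F x y = 1"
    using FV[unfolded Q_def] by simp_all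
  obtain D where D: "D \<subseteq> K" "finite D" "K \<subseteq> (\<Union>x\<in>D. V x)"
    by (rule compactE_image[OF assms(1), of K V]) (use V in blast)+
  \<comment> \<open>This combination stays between 0 and 1 and equals 1 as soon as one
    \<open>F x y\<close> does, so no normalization by a sum is involved.\<close>
  define f where "f y = 1 - (\<Prod>x\<in>D. 1 - F x y)" for y
  have "\<exists>C. compact C \<and> C \<subseteq> U \<and> (\<forall>y. y \<notin> C \<longrightarrow> F x y = 0)" if "x \<in> D" for x
    using test_funE[OF F(1)[of x]] D(1) that by (metis subsetD)
  then obtain C where C: "\<And>x. x \<in> D \<Longrightarrow> compact (C x)" "\<And>x. x \<in> D \<Longrightarrow> C x \<subseteq> U" 
      "\<And>x y. x \<in> D \<Longrightarrow> y \<notin> C x \<Longrightarrow> F x y = 0" by metis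
  have "f \<in> test_fun U"
  proof (rule test_funI[of _ "\<Union>x\<in>D. C x"])
    show "smooth f" unfolding f_def[abs_def]
      using F(1) D(1) by (intro smooth_diff smooth_prod smooth_const) (auto intro: test_fun_smooth)
  qed (use C D in \<open>auto simp: f_def\<close>)
  moreover have "0 \<le> f y \<and> f y \<le> 1" for y
    unfolding f_def using F D by (auto intro!: prod_nonneg prod_le_1)
  moreover have "f y = 1" if y: "y \<in> (\<Union>x\<in>D. V x)" for y
  proof -
    obtain x where "x \<in> D" "y \<in> V x" using y by blast
    then have "1 - F x y = 0" using V D by auto
    then show ?thesis unfolding f_def using D(2) \<open>x \<in> D\<close> by (auto simp: prod_zero_iff)
  qed
  moreover have "open (\<Union>x\<in>D. V x)" using V(1) D(1) by blast
  ultimately show ?thesis using D(3) by (intro that[of f "\<Union>x\<in>D. V x"]) simp_all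
qed

section \<open>Superpositions of translates\<close>

lemma compact_support_integrable:
  fixes f :: "'a::euclidean_space \<Rightarrow> 'b::euclidean_space"
  assumes "continuous_on UNIV f" "compact K" "\<And>x. x \<notin> K \<Longrightarrow> f x = 0"
  shows "integrable lborel f"
proof -
  have "integrable lborel (\<lambda>x. indicator K x *\<^sub>R f x)"
    using assms by (intro borel_integrable_compact continuous_on_subset[OF assms(1)]) auto
  moreover have "(\<lambda>x. indicator K x *\<^sub>R f x) = f"
    using assms(3) by (auto simp: indicator_def fun_eq_iff)
  ultimately show ?thesis by simp
qed

lemma compact_support_integral_cbox:
  fixes f :: "'a::euclidean_space \<Rightarrow> 'b::euclidean_space"
  assumes "continuous_on UNIV f" "\<And>x. x \<notin> cbox a b \<Longrightarrow> f x = 0"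
  shows "integral (cbox a b) f = (LINT x|lborel. f x)"
proof -
  have "integral (cbox a b) f = integral UNIV (\<lambda>x. if x \<in> cbox a b then f x else 0)"
    by (simp add: Henstock_Kurzweil_Integration.integral_restrict_UNIV)
  also have "(\<lambda>x. if x \<in> cbox a b then f x else 0) = f" using assms(2) by auto
  also have "integral UNIV f = (LINT x|lborel. f x)"
    by (intro integral_lborel compact_support_integrable[OF assms(1) compact_cbox] assms(2))
  finally show ?thesis .
qed

text \<open>Fields are constructed and estimated over \<open>lborel\<close>, where Fubini's theorem
  and translation invariance apply, while the Sobolev notions use
  \<open>lebesgue_on \<Omega>\<close>. For functions vanishing off \<open>\<Omega>\<close> this
  passes between the two.\<close>

lemma integral_lebesgue_on_eq_lborel:
  fixes f :: "'a::euclidean_space \<Rightarrow> 'b::euclidean_space"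
  assumes "f \<in> borel_measurable borel" "\<Omega> \<in> sets lebesgue" "\<And>x. x \<notin> \<Omega> \<Longrightarrow> f x = 0"
  shows "(LINT x|lebesgue_on \<Omega>. f x) = (LINT x|lborel. f x)"
    and "integrable lborel f \<Longrightarrow> integrable (lebesgue_on \<Omega>) f"
proof -
  have eq: "(\<lambda>x. if x \<in> \<Omega> then f x else 0) = f" using assms(3) by auto
  have [measurable]: "f \<in> borel_measurable lborel" using assms(1) by simp
  have "(LINT x|lebesgue_on \<Omega>. f x) = integral\<^sup>L lebesgue (\<lambda>x. if x \<in> \<Omega> then f x else 0)"
    using assms(2) by (simp add: Lebesgue_Measure.integral_restrict_UNIV)
  also have "\<dots> = (LINT x|lborel. f x)" unfolding eq by (rule integral_completion) measurable
  finally show "(LINT x|lebesgue_on \<Omega>. f x) = (LINT x|lborel. f x)" .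
  show "integrable (lebesgue_on \<Omega>) f" if "integrable lborel f"
    using that integrable_completion[of f lborel] Lebesgue_Measure.integrable_restrict_UNIV[OF assms(2), of f] eq by simp
qed

lemma smooth_borel_measurable: "smooth f \<Longrightarrow> f \<in> borel_measurable borel"
  by (intro borel_measurable_continuous_onI smooth_continuous)

lemma test_fun_integrable:
  fixes f :: "real ^ 'd \<Rightarrow> 'b::euclidean_space"
  assumes "f \<in> test_fun \<Omega>"
  shows "integrable lborel f"
proof -
  obtain K where K: "smooth f" "compact K" "K \<subseteq> \<Omega>" "\<And>x. x \<notin> K \<Longrightarrow> f x = 0"
    by (rule test_funE[OF assms]) (rule that)
  show ?thesis by (rule compact_support_integrable[OF smooth_continuous[OF K(1)] K(2,4)])
qed

lemma test_fun_sqint_lborel: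
  fixes f :: "real ^ 'd \<Rightarrow> 'b::euclidean_space"
  assumes "f \<in> test_fun \<Omega>"
  shows "sqint lborel f"
proof -
  obtain K where K: "smooth f" "compact K" "K \<subseteq> \<Omega>" "\<And>x. x \<notin> K \<Longrightarrow> f x = 0"
    by (rule test_funE[OF assms]) (rule that)
  have "integrable lborel (\<lambda>x. (norm (f x))\<^sup>2)"
    by (rule compact_support_integrable[OF _ K(2)])
       (auto intro!: continuous_intros smooth_continuous[OF K(1)] simp: K(4))
  then show ?thesis using smooth_borel_measurable[OF K(1)] by (simp add: sqint_def)
qed

lemma test_fun_sqint:
  fixes f :: "real ^ 'd \<Rightarrow> 'b::euclidean_space"
  assumes "f \<in> test_fun \<Omega>" "\<Omega> \<in> sets lebesgue"
  shows "sqint (lebesgue_on \<Omega>) f" "nsq (lebesgue_on \<Omega>) f = nsq lborel f"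
proof -
  have s: "sqint lborel f" by (rule test_fun_sqint_lborel[OF assms(1)])
  have z: "f x = 0" if "x \<notin> \<Omega>" for x using test_fun_outside[OF assms(1) that] .
  have m: "f \<in> borel_measurable borel" using s by (simp add: sqint_def)
  have m2: "(\<lambda>x. (norm (f x))\<^sup>2) \<in> borel_measurable borel" using m by simp
  have "f \<in> borel_measurable (lebesgue_on \<Omega>)"
    using m by (simp add: measurable_completion measurable_restrict_space1)
  moreover have "integrable (lebesgue_on \<Omega>) (\<lambda>x. (norm (f x))\<^sup>2)"
    using s z by (intro integral_lebesgue_on_eq_lborel(2)[OF m2 assms(2)]) (auto simp: sqint_def)
  ultimately show "sqint (lebesgue_on \<Omega>) f" by (simp add: sqint_def)
  show "nsq (lebesgue_on \<Omega>) f = nsq lborel f"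
    unfolding nsq_def using z by (intro integral_lebesgue_on_eq_lborel(1)[OF m2 assms(2)]) simp
qed

lemma lborel_distr_reflect: "distr lborel borel (\<lambda>y::'a::euclidean_space. x - y) = lborel"
  using lborel_affine[of "-1" x] by (simp add: density_1)

lemma lborel_integral_reflect:
  fixes F :: "'a::euclidean_space \<Rightarrow> 'b::euclidean_space"
  assumes "F \<in> borel_measurable borel"
  shows "(LINT y|lborel. F (x - y)) = (LINT y|lborel. F y)"
  by (subst lborel_distr_reflect[of x, symmetric], subst integral_distr) (use assms in auto)

lemma lborel_nn_integral_translate:
  fixes F :: "'a::euclidean_space \<Rightarrow> ennreal"
  assumes "F \<in> borel_measurable borel"
  shows "(\<integral>\<^sup>+y. F (y - x) \<partial>lborel) = (\<integral>\<^sup>+y. F y \<partial>lborel)"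
  by (subst lborel_distr_plus[of "-x", symmetric], subst nn_integral_distr) (use assms in auto)

section \<open>Averages of translates: derivatives and an L2 bound\<close>

definition grad :: "(real ^ 'd \<Rightarrow> real) \<Rightarrow> real ^ 'd \<Rightarrow> real ^ 'd" where
  "grad h x = (\<chi> i. partial i h x)"

text \<open>The variable \<open>x\<close> enters through \<open>h\<close> alone, so all derivatives
  fall on \<open>h\<close>, and the average is smooth although \<open>\<kappa>\<close> and
  \<open>\<theta>\<close> are merely continuous. The parameter space is a general Euclidean space
  because a time variable will be adjoined to the space variable.\<close>

definition trans_avg :: "'q::euclidean_space \<Rightarrow> 'q \<Rightarrow> ('q \<Rightarrow> real) \<Rightarrow> ('q \<Rightarrow> real ^ 'd) \<Rightarrow>
    (real ^ 'd \<Rightarrow> real) \<Rightarrow> real ^ 'd \<Rightarrow> real" where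
  "trans_avg a b \<kappa> \<theta> h x = integral (cbox a b) (\<lambda>q. \<kappa> q * h (x - \<theta> q))"

lemma differentiable_has_derivative_grad:
  assumes "h differentiable (at x)"
  shows "(h has_derivative (\<lambda>v. v \<bullet> grad h x)) (at x)"
  using has_derivative_sum_partials[OF assms] by (simp add: inner_vec_def grad_def)

lemma continuous_on_compose_UNIV:
  "continuous_on UNIV g \<Longrightarrow> continuous_on S f \<Longrightarrow> continuous_on S (\<lambda>x. g (f x))"
  by (rule continuous_on_compose2[of UNIV g]) auto

context
  fixes a b :: "'q::euclidean_space" and \<kappa> :: "'q \<Rightarrow> real" and \<theta> :: "'q \<Rightarrow> real ^ 'd"
  assumes \<kappa>: "continuous_on UNIV \<kappa>" and \<theta>: "continuous_on UNIV \<theta>"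
begin

lemma translate_continuous:
  assumes "continuous_on UNIV h"
  shows "continuous_on S (\<lambda>q. h (x - \<theta> q))"
  by (rule continuous_on_compose_UNIV[OF assms]) (intro continuous_intros continuous_on_subset[OF \<theta>] subset_UNIV)

lemma trans_avg_continuous_integrand:
  "continuous_on UNIV h \<Longrightarrow> continuous_on S (\<lambda>q. \<kappa> q * h (x - \<theta> q))"
  by (rule continuous_on_mult[OF continuous_on_subset[OF \<kappa> subset_UNIV] translate_continuous])

lemma trans_avg_has_derivative:
  assumes "Ck (Suc 0) h"
  shows "(trans_avg a b \<kappa> \<theta> h has_derivative
    (\<lambda>v. integral (cbox a b) (\<lambda>q. \<kappa> q * (v \<bullet> grad h (x - \<theta> q))))) (at x)"
proof -
  have d: "h differentiable (at y)" and c: "continuous_on UNIV (partial i h)" for y i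
    using assms by auto
  have ch: "continuous_on UNIV h" using Ck_continuous[OF assms] .
  have cg: "continuous_on UNIV (grad h)"
    unfolding grad_def[abs_def] using c by (intro continuous_on_vec_lambda)
  \<comment> \<open>The Leibniz rule asks for the derivative as a bounded linear map that is jointly
    continuous in the point and the parameter.\<close>
  define fx where "fx y q = \<kappa> q *\<^sub>R blinfun_inner_left (grad h (y - \<theta> q))" for y q
  have cfx: "continuous_on S (\<lambda>p. fx (fst p) (snd p))" for S
    unfolding fx_def
    by (intro continuous_on_scaleR bounded_linear.continuous_on[OF bounded_linear_blinfun_inner_left]
      continuous_on_compose_UNIV[OF \<kappa>] continuous_on_compose_UNIV[OF cg] continuous_on_diff
      continuous_on_compose_UNIV[OF \<theta>] continuous_on_fst continuous_on_snd continuous_on_id)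
  have "((\<lambda>y. integral (cbox a b) (\<lambda>q. \<kappa> q * h (y - \<theta> q))) has_derivative
      blinfun_apply (integral (cbox a b) (fx x))) (at x within UNIV)"
  proof (rule leibniz_rule)
    fix y q
    have "((\<lambda>y. h (y - \<theta> q)) has_derivative (\<lambda>v. v \<bullet> grad h (y - \<theta> q))) (at y)"
    proof -
      have "((\<lambda>y. y - \<theta> q) has_derivative (\<lambda>v. v)) (at y)"
        by (auto intro!: derivative_eq_intros)
      from has_derivative_compose[OF this differentiable_has_derivative_grad[OF d]] show ?thesis .
    qed
    from has_derivative_mult_right[OF this, of "\<kappa> q"]
    show "((\<lambda>y. \<kappa> q * h (y - \<theta> q)) has_derivative blinfun_apply (fx y q)) (at y within UNIV)"
      by (simp add: fx_def scaleR_blinfun.rep_eq)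
  next
    show "(\<lambda>q. \<kappa> q * h (y - \<theta> q)) integrable_on cbox a b" for y
      by (intro integrable_continuous trans_avg_continuous_integrand ch)
    show "continuous_on (UNIV \<times> cbox a b) (\<lambda>(x, y). fx x y)"
      using cfx by (simp add: case_prod_beta)
  qed auto
  moreover have "fx x integrable_on cbox a b"
  proof (rule integrable_continuous)
    have "continuous_on (cbox a b) (\<lambda>q. fx (fst (x, q)) (snd (x, q)))"
      by (rule continuous_on_compose_UNIV[OF cfx]) (intro continuous_intros)
    then show "continuous_on (cbox a b) (fx x)" by simp
  qed
  then have "blinfun_apply (integral (cbox a b) (fx x)) = (\<lambda>v. integral (cbox a b) (\<lambda>q. \<kappa> q * (v \<bullet> grad h (x - \<theta> q))))"
    by (intro ext) (simp add: blinfun_apply_integral fx_def blinfun.scaleR_left)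
  ultimately show ?thesis by (simp add: trans_avg_def[abs_def])
qed

lemma partial_trans_avg:
  assumes "Ck (Suc 0) h"
  shows "partial i (trans_avg a b \<kappa> \<theta> h) = trans_avg a b \<kappa> \<theta> (partial i h)"
  by (rule ext, subst partial_eq[OF trans_avg_has_derivative[OF assms]])
     (simp add: trans_avg_def inner_axis' grad_def)

lemma smooth_trans_avg:
  assumes "smooth h"
  shows "smooth (trans_avg a b \<kappa> \<theta> h)"
proof -
  \<comment> \<open>One order of differentiability is given away because the Leibniz rule needs a
    continuous gradient; for smooth \<open>h\<close> this costs nothing.\<close>
  have "Ck (Suc k) h \<Longrightarrow> Ck k (trans_avg a b \<kappa> \<theta> h)" for k
  proof (induction k arbitrary: h)
    case 0
    then have "trans_avg a b \<kappa> \<theta> h differentiable (at x)" for x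
      by (rule differentiableI[OF trans_avg_has_derivative])
    then show ?case
      by (auto simp: continuous_on_eq_continuous_at intro: differentiable_imp_continuous_within)
  next
    case (Suc k)
    have "continuous_on UNIV (partial i h)" for i
      using Suc.prems Ck_continuous[of "Suc k" "partial i h"] by simp
    then have 1: "Ck (Suc 0) h" using Suc.prems by simp
    have "Ck k (trans_avg a b \<kappa> \<theta> (partial i h))" for i
      using Suc.prems by (intro Suc.IH) simp
    then show ?case
      using differentiableI[OF trans_avg_has_derivative[OF 1]] by (simp add: partial_trans_avg[OF 1])
  qed
  then show ?thesis using assms unfolding smooth_def by blast
qed

lemma trans_avg_test_fun:
  assumes "smooth h" "compact K" "K \<subseteq> \<Omega>"
    and "\<And>q x. q \<in> cbox a b \<Longrightarrow> \<kappa> q \<noteq> 0 \<Longrightarrow> h (x - \<theta> q) \<noteq> 0 \<Longrightarrow> x \<in> K"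
  shows "trans_avg a b \<kappa> \<theta> h \<in> test_fun \<Omega>"
proof (rule test_funI[OF smooth_trans_avg[OF assms(1)] assms(2,3)])
  fix x assume "x \<notin> K"
  then have "integral (cbox a b) (\<lambda>q. \<kappa> q * h (x - \<theta> q)) = integral (cbox a b) (\<lambda>q. 0)"
    using assms(4) by (intro integral_cong) auto
  then show "trans_avg a b \<kappa> \<theta> h x = 0" by (simp add: trans_avg_def)
qed

lemma trans_avg_sq_le:
  assumes "continuous_on UNIV h"
  shows "(trans_avg a b \<kappa> \<theta> h x)\<^sup>2 \<le>
    integral (cbox a b) (\<lambda>q. (\<kappa> q)\<^sup>2) * integral (cbox a b) (\<lambda>q. (h (x - \<theta> q))\<^sup>2)"
proof -
  define M where "M = lebesgue_on (cbox a b)"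
  have int: "integrable M f" "integral (cbox a b) f = (LINT q|M. f q)" 
    if "continuous_on UNIV f" for f :: "'q \<Rightarrow> real"
    using continuous_imp_integrable[OF continuous_on_subset[OF that subset_UNIV], of a b]
      lebesgue_integral_eq_integral[of "cbox a b" f]
    by (auto simp: M_def)
  have c2: "continuous_on UNIV (\<lambda>q. h (x - \<theta> q))" by (rule translate_continuous[OF assms])
  have s: "sqint M \<kappa>" "sqint M (\<lambda>q. h (x - \<theta> q))"
    using int(1)[OF \<kappa>] int(1)[OF c2] \<kappa> c2
    by (auto simp: sqint_def intro!: int continuous_intros)
  have "(\<kappa> q)\<^sup>2 = (norm (\<kappa> q))\<^sup>2" for q by simp
  then show ?thesis
    using ip_sq_le[OF s] \<kappa> c2
    by (simp add: trans_avg_def int continuous_intros ip_def nsq_def)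
qed

text \<open>Cauchy-Schwarz in \<open>q\<close>, then Tonelli: every translate of \<open>h\<close>
  has the norm of \<open>h\<close>, and integrating over the box contributes its volume. Both
  \<open>\<kappa>\<close> and \<open>h\<close> enter in L2, so the function to be estimated can be
  placed in either role; \<open>div_solvable_base\<close> uses both.\<close>

lemma nsq_trans_avg_le:
  assumes h: "h \<in> test_fun \<Omega>"
  shows "nsq lborel (trans_avg a b \<kappa> \<theta> h) \<le>
    integral (cbox a b) (\<lambda>q. (\<kappa> q)\<^sup>2) * measure lborel (cbox a b) * nsq lborel h"
proof -
  have ch: "continuous_on UNIV h" using h by (intro smooth_continuous test_fun_smooth)
  define A where "A = integral (cbox a b) (\<lambda>q. (\<kappa> q)\<^sup>2)"
  have A: "A \<ge> 0" unfolding A_def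
    by (intro integral_nonneg integrable_continuous continuous_intros continuous_on_subset[OF \<kappa>]) auto
  have c2: "continuous_on UNIV (\<lambda>p. h (fst p - \<theta> (snd p)))"
    by (intro continuous_on_compose_UNIV[OF ch] continuous_on_diff
      continuous_on_compose_UNIV[OF \<theta>] continuous_on_fst continuous_on_snd continuous_on_id)
  have m0: "(\<lambda>p. h (fst p - \<theta> (snd p))) \<in> borel_measurable borel"
    by (rule borel_measurable_continuous_onI[OF c2])
  have m: "(\<lambda>p. indicator (cbox a b) (snd p) * ennreal ((h (fst p - \<theta> (snd p)))\<^sup>2)) 
      \<in> borel_measurable (lborel \<Otimes>\<^sub>M lborel)"
    unfolding measurable_cong_sets[OF lborel_prod[THEN arg_cong[where f=sets]] refl]
    using m0 by (simp add: borel_prod[symmetric])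
  have in1: "ennreal (integral (cbox a b) (\<lambda>q. (h (x - \<theta> q))\<^sup>2))
      = (\<integral>\<^sup>+q. indicator (cbox a b) q * ennreal ((h (x - \<theta> q))\<^sup>2) \<partial>lborel)" for x
  proof -
    have c: "continuous_on (cbox a b) (\<lambda>q. (h (x - \<theta> q))\<^sup>2)"
      by (intro continuous_on_power translate_continuous ch)
    have i: "integrable lborel (\<lambda>q. indicator (cbox a b) q *\<^sub>R (h (x - \<theta> q))\<^sup>2)"
      by (intro borel_integrable_compact c) auto
    have "integral (cbox a b) (\<lambda>q. (h (x - \<theta> q))\<^sup>2) = (LINT q:cbox a b|lborel. (h (x - \<theta> q))\<^sup>2)"
      using i by (intro set_borel_integral_eq_integral(2)[symmetric]) (simp add: set_integrable_def)
    also have "ennreal \<dots> = (\<integral>\<^sup>+q. ennreal (indicator (cbox a b) q *\<^sub>R (h (x - \<theta> q))\<^sup>2) \<partial>lborel)"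
      unfolding set_lebesgue_integral_def by (rule nn_integral_eq_integral[symmetric, OF i]) simp
    finally show ?thesis by (simp add: ennreal_mult'' indicator_def if_distrib cong: if_cong) 
        (auto intro!: nn_integral_cong)
  qed
  have nn: "(\<integral>\<^sup>+x. ennreal ((h (x - c))\<^sup>2) \<partial>lborel) = ennreal (nsq lborel h)" for c
  proof -
    have "(\<integral>\<^sup>+x. ennreal ((h (x - c))\<^sup>2) \<partial>lborel) = (\<integral>\<^sup>+x. ennreal ((h x)\<^sup>2) \<partial>lborel)"
      using borel_measurable_continuous_onI[OF ch] by (intro lborel_nn_integral_translate) simp
    also have "\<dots> = ennreal (nsq lborel h)"
      unfolding nsq_def using test_fun_sqint_lborel[OF h] 
      by (subst nn_integral_eq_integral) (auto simp: sqint_def)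
    finally show ?thesis .
  qed
  have "(\<integral>\<^sup>+x. ennreal ((norm (trans_avg a b \<kappa> \<theta> h x))\<^sup>2) \<partial>lborel)
      \<le> (\<integral>\<^sup>+x. ennreal A * ennreal (integral (cbox a b) (\<lambda>q. (h (x - \<theta> q))\<^sup>2)) \<partial>lborel)"
    using trans_avg_sq_le[OF ch] A
    by (intro nn_integral_mono) (simp add: A_def ennreal_mult'[symmetric] ennreal_leI)
  also have "\<dots> = (\<integral>\<^sup>+x. ennreal A * (\<integral>\<^sup>+q. indicator (cbox a b) q * ennreal ((h (x - \<theta> q))\<^sup>2) \<partial>lborel) \<partial>lborel)"
    by (simp add: in1)
  also have "\<dots> = ennreal A * (\<integral>\<^sup>+x. (\<integral>\<^sup>+q. indicator (cbox a b) q * ennreal ((h (x - \<theta> q))\<^sup>2) \<partial>lborel) \<partial>lborel)"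
    using lborel.borel_measurable_nn_integral_fst[OF m]
    by (intro nn_integral_cmult) simp
  also have "(\<integral>\<^sup>+x. (\<integral>\<^sup>+q. indicator (cbox a b) q * ennreal ((h (x - \<theta> q))\<^sup>2) \<partial>lborel) \<partial>lborel)
      = (\<integral>\<^sup>+q. (\<integral>\<^sup>+x. indicator (cbox a b) q * ennreal ((h (x - \<theta> q))\<^sup>2) \<partial>lborel) \<partial>lborel)"
    using lborel_pair.Fubini[OF m] by simp
  also have "\<dots> = (\<integral>\<^sup>+q. ennreal (nsq lborel h) * indicator (cbox a b) q \<partial>lborel)"
  proof (rule nn_integral_cong)
    fix q
    have "(\<integral>\<^sup>+x. indicator (cbox a b) q * ennreal ((h (x - \<theta> q))\<^sup>2) \<partial>lborel)
      = indicator (cbox a b) q * (\<integral>\<^sup>+x. ennreal ((h (x - \<theta> q))\<^sup>2) \<partial>lborel)"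
      by (cases "q \<in> cbox a b") auto
    then show "(\<integral>\<^sup>+x. indicator (cbox a b) q * ennreal ((h (x - \<theta> q))\<^sup>2) \<partial>lborel)
      = ennreal (nsq lborel h) * indicator (cbox a b) q"
      by (simp add: nn mult.commute)
  qed
  also have "\<dots> = ennreal (nsq lborel h) * emeasure lborel (cbox a b)"
    by (simp add: nn_integral_cmult_indicator)
  also have "emeasure lborel (cbox a b) = ennreal (measure lborel (cbox a b))"
    using emeasure_lborel_cbox_finite[of a b] by (intro emeasure_eq_ennreal_measure) simp
  finally have "(\<integral>\<^sup>+x. ennreal ((norm (trans_avg a b \<kappa> \<theta> h x))\<^sup>2) \<partial>lborel)
      \<le> ennreal (A * measure lborel (cbox a b) * nsq lborel h)"
    using A by (simp add: ennreal_mult' mult_ac)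
  then show ?thesis unfolding nsq_def[of lborel "trans_avg a b \<kappa> \<theta> h"] A_def[symmetric]
    by (intro integral_real_bounded[rotated]) (simp_all add: A)
qed

end

section \<open>Right inverses of the divergence\<close>

definition divg :: "(real ^ 'd \<Rightarrow> 'a::real_normed_vector ^ 'd) \<Rightarrow> real ^ 'd \<Rightarrow> 'a" where
  "divg \<Phi> x = (\<Sum>i\<in>UNIV. partial i \<Phi> x $ i)"

lemma nsq_translate:
  assumes "h \<in> borel_measurable borel"
  shows "nsq lborel (\<lambda>x. h (x - c)) = nsq lborel h"
proof -
  have "nsq lborel h = (LINT x|distr lborel borel ((+) (- c)). (norm (h x))\<^sup>2)"
    by (simp add: nsq_def lborel_distr_plus)
  also have "\<dots> = nsq lborel (\<lambda>x. h (x - c))"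
    using assms by (subst integral_distr) (auto simp: nsq_def)
  finally show ?thesis by simp
qed

lemma test_fun_mono: "U \<subseteq> V \<Longrightarrow> f \<in> test_fun U \<Longrightarrow> f \<in> test_fun V"
  by (auto simp: test_fun_def)

lemma compact_subset_symmetric_cbox:
  fixes K :: "'a::euclidean_space set"
  assumes "compact K"
  obtains a where "K \<subseteq> cbox (-a) a"
  using bounded_subset_cbox_symmetric[OF compact_imp_bounded[OF assms]] by blast

text \<open>By translation invariance the average of \<open>f\<close> with weight 1 is constant near
  0, so its derivative there vanishes; differentiating under the integral, that derivative is the
  integral of \<open>partial i f\<close>.\<close>

lemma integral_partial_eq_0:
  fixes f :: "real ^ 'd \<Rightarrow> real"
  assumes "f \<in> test_fun \<Omega>"
  shows "(LINT x|lborel. partial i f x) = 0"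
proof -
  obtain K where K: "smooth f" "compact K" "K \<subseteq> \<Omega>" "\<And>x. x \<notin> K \<Longrightarrow> f x = 0"
    by (rule test_funE[OF assms]) (rule that)
  \<comment> \<open>Differentiating at 0 needs a whole neighbourhood of base points, so one box has
    to contain every \<open>q\<close> with \<open>y - q\<close> in \<open>K\<close> for all
    \<open>y\<close> in the unit ball.\<close>
  define K' where "K' = (\<lambda>(x, y). x - y) ` (cball 0 1 \<times> K)"
  have "compact K'" unfolding K'_def case_prod_beta
    by (intro compact_continuous_image compact_Times K compact_cball continuous_intros)
  then obtain a where a: "K' \<subseteq> cbox (-a) a" by (rule compact_subset_symmetric_cbox)
  have out: "y - q \<notin> K" if "q \<notin> cbox (-a) a" "y \<in> cball 0 1" for y q
  proof
    assume "y - q \<in> K"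
    then have "q \<in> K'" using that(2) unfolding K'_def by (auto intro!: image_eqI[of _ _ "(y, y - q)"])
    then show False using a that(1) by blast
  qed
  define G where "G = trans_avg (-a) a (\<lambda>_. 1) (\<lambda>q. q) f"
  have eq: "trans_avg (-a) a (\<lambda>_. 1) (\<lambda>q. q) g y = (LINT x|lborel. g x)"
    if g: "smooth g" "\<And>x. x \<notin> K \<Longrightarrow> g x = 0" and y: "y \<in> cball 0 1" for g y
  proof -
    have "continuous_on UNIV (\<lambda>q. g (y - q))"
      by (rule continuous_on_compose_UNIV[OF smooth_continuous[OF g(1)]]) (intro continuous_intros)
    then have "trans_avg (-a) a (\<lambda>_. 1) (\<lambda>q. q) g y = (LINT q|lborel. g (y - q))"
      unfolding trans_avg_def using out[OF _ y] g(2)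
      by (subst compact_support_integral_cbox) auto
    also have "\<dots> = (LINT x|lborel. g x)"
      by (rule lborel_integral_reflect[OF smooth_borel_measurable[OF g(1)]])
    finally show ?thesis .
  qed
  have c: "continuous_on UNIV (\<lambda>_::real^'d. 1::real)" "continuous_on UNIV (\<lambda>q::real^'d. q)"
    by (intro continuous_intros)+
  have "(G has_derivative (\<lambda>v. 0)) (at 0)"
    unfolding G_def
    by (rule has_derivative_transform_within_open[OF has_derivative_const[of "LINT x|lborel. f x"], of "ball 0 1"])
       (auto simp: eq[OF K(1,4)])
  then have "0 = partial i G 0" by (simp add: partial_eq)
  also have "\<dots> = trans_avg (-a) a (\<lambda>_. 1) (\<lambda>q. q) (partial i f) 0"
    unfolding G_def using K(1) by (subst partial_trans_avg[OF c]) (auto simp: smooth_def simp del: Ck.simps)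
  also have "\<dots> = (LINT x|lborel. partial i f x)"
    by (rule eq) (auto intro: smooth_partial K partial_eq_0_outside[OF compact_imp_closed[OF K(2)] K(4)])
  finally show ?thesis by simp
qed

text \<open>Fundamental theorem of calculus along the segment from \<open>x\<close> to
  \<open>x - w\<close>. Read as a divergence: the field \<open>w\<close> times the integral of
  \<open>h (x - t w)\<close> over \<open>t\<close> carries the mass of \<open>h\<close> along
  \<open>w\<close>, and its divergence is \<open>h\<close> minus its translate.\<close>

lemma integral_ray:
  fixes h :: "real ^ 'd \<Rightarrow> real"
  assumes "smooth h"
  shows "integral (cbox 0 1) (\<lambda>t. \<Sum>i\<in>UNIV. w $ i * partial i h (x - t *\<^sub>R w)) = h x - h (x - w)"
proof -
  have "((\<lambda>t. - h (x - t *\<^sub>R w)) has_vector_derivative (w \<bullet> grad h (x - t *\<^sub>R w))) (at t within {0..1})" for t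
  proof -
    have "((\<lambda>t. x - t *\<^sub>R w) has_derivative (\<lambda>t. - (t *\<^sub>R w))) (at t)"
      by (auto intro!: derivative_eq_intros)
    from has_derivative_compose[OF this differentiable_has_derivative_grad[OF smooth_differentiable[OF assms]]]
    have "((\<lambda>t. h (x - t *\<^sub>R w)) has_derivative (\<lambda>s. - (s *\<^sub>R w) \<bullet> grad h (x - t *\<^sub>R w))) (at t)" .
    from has_derivative_minus[OF this] show ?thesis
      by (simp add: has_vector_derivative_def has_derivative_at_withinI)
  qed
  then have "((\<lambda>t. w \<bullet> grad h (x - t *\<^sub>R w)) has_integral (- h (x - 1 *\<^sub>R w)) - (- h (x - 0 *\<^sub>R w))) {0..1}"
    by (intro fundamental_theorem_of_calculus) auto
  then show ?thesis by (simp add: integral_unique inner_vec_def grad_def)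
qed

lemma vector_field_components:
  fixes F :: "'d \<Rightarrow> real ^ 'd \<Rightarrow> real"
  assumes F: "\<And>i. F i \<in> test_fun \<Omega>"
  shows "(\<lambda>x. \<chi> i. F i x) \<in> test_fun \<Omega>"
    and "divg (\<lambda>x. \<chi> i. F i x) x = (\<Sum>i\<in>UNIV. partial i (F i) x)"
    and "nsq lborel (\<lambda>x. \<chi> i. F i x) = (\<Sum>i\<in>UNIV. nsq lborel (F i))"
proof -
  have eq: "(\<lambda>x. \<chi> i. F i x) = (\<lambda>x. \<Sum>i\<in>UNIV. F i x *\<^sub>R axis i 1)"
    by (auto simp: vec_eq_iff axis_def if_distrib cong: if_cong)
  have "(\<lambda>x. \<Sum>i\<in>I. F i x *\<^sub>R axis i 1) \<in> test_fun \<Omega>" if "finite I" for I :: "'d set"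
    using that
  proof induction
    case (insert j I)
    then show ?case
      by (simp add: test_fun_add test_fun_bounded_linear[OF bounded_linear_scaleR_left F])
  qed simp
  then show t: "(\<lambda>x. \<chi> i. F i x) \<in> test_fun \<Omega>" unfolding eq by simp
  have "partial i (\<lambda>x. \<chi> i. F i x) x $ i = partial i (F i) x" for i
    using partial_bounded_linear[OF bounded_linear_vec_nth smooth_differentiable[OF test_fun_smooth[OF t]], of i i x]
    by simp
  then show "divg (\<lambda>x. \<chi> i. F i x) x = (\<Sum>i\<in>UNIV. partial i (F i) x)"
    by (simp add: divg_def)
  have "integrable lborel (\<lambda>x. (F i x)\<^sup>2)" for i
    using test_fun_sqint_lborel[OF F, of i] by (simp add: sqint_def)
  then show "nsq lborel (\<lambda>x. \<chi> i. F i x) = (\<Sum>i\<in>UNIV. nsq lborel (F i))"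
    by (simp add: nsq_def norm_vec_def L2_set_def sum_nonneg)
qed

lemma divg_add:
  assumes "\<Phi> differentiable (at x)" "\<Psi> differentiable (at x)"
  shows "divg (\<lambda>x. \<Phi> x + \<Psi> x) x = divg \<Phi> x + divg \<Psi> x"
  by (simp add: divg_def partial_add[OF assms] sum.distrib)

lemma divg_scaleR:
  assumes "\<Phi> differentiable (at x)"
  shows "divg (\<lambda>x. c *\<^sub>R \<Phi> x) x = c *\<^sub>R divg \<Phi> x"
  by (simp add: divg_def partial_bounded_linear[OF bounded_linear_scaleR_right assms] scaleR_sum_right)

lemma divg_test_fun:
  assumes "\<Phi> \<in> test_fun \<Omega>"
  shows "divg (\<Phi> :: real ^ 'd \<Rightarrow> 'a::real_normed_vector ^ 'd) \<in> test_fun \<Omega>"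
proof -
  have "(\<lambda>x. \<Sum>i\<in>I. partial i \<Phi> x $ i) \<in> test_fun \<Omega>" if "finite I" for I
    using that
  proof induction
    case (insert j I)
    then show ?case
      by (simp add: test_fun_add test_fun_bounded_linear[OF bounded_linear_vec_nth test_fun_partial[OF assms]])
  qed simp
  then show ?thesis unfolding divg_def[abs_def] by simp
qed

lemma integral_divg_eq_0:
  fixes \<Phi> :: "real ^ 'd \<Rightarrow> real ^ 'd"
  assumes "\<Phi> \<in> test_fun \<Omega>"
  shows "(LINT x|lborel. divg \<Phi> x) = 0"
proof -
  have c: "(\<lambda>x. \<Phi> x $ i) \<in> test_fun \<Omega>" for i
    by (rule test_fun_bounded_linear[OF bounded_linear_vec_nth assms])
  have p: "partial i \<Phi> x $ i = partial i (\<lambda>x. \<Phi> x $ i) x" for i x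
    using partial_bounded_linear[OF bounded_linear_vec_nth smooth_differentiable[OF test_fun_smooth[OF assms]], of i i x]
    by simp
  show ?thesis unfolding divg_def p
    using test_fun_integrable[OF test_fun_partial[OF c]] integral_partial_eq_0[OF c]
    by (subst Bochner_Integration.integral_sum) auto
qed

text \<open>The pair \<open>(w, t)\<close> is treated as one parameter of \<open>trans_avg\<close>;
  Fubini splits it again, and the inner integral over \<open>t\<close> is
  \<open>integral_ray\<close>.\<close>

lemma ray_superposition_divg:
  fixes h g :: "real ^ 'd \<Rightarrow> real" and v :: "real ^ 'd \<Rightarrow> real ^ 'd"
  assumes h: "smooth h" and g: "continuous_on UNIV g" and v: "continuous_on UNIV v"
  shows "(\<Sum>i\<in>UNIV. trans_avg (a, 0) (b, 1) (\<lambda>p. g (fst p) * v (fst p) $ i)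
        (\<lambda>p. s + snd p *\<^sub>R v (fst p)) (partial i h) x)
    = integral (cbox a b) (\<lambda>w. g w * (h (x - s) - h (x - s - v w)))"
proof -
  have c: "continuous_on S (\<lambda>p. g (fst p) * v (fst p) $ i * partial i h (x - (s + snd p *\<^sub>R v (fst p))))" 
    for i and S :: "((real ^ 'd) \<times> real) set"
    by (intro continuous_on_mult continuous_on_compose_UNIV[OF g] continuous_on_component continuous_on_compose_UNIV[OF v]
      continuous_on_compose_UNIV[OF smooth_continuous[OF smooth_partial[OF h]]] continuous_on_diff continuous_on_add 
      continuous_on_scaleR continuous_on_const continuous_on_fst continuous_on_snd continuous_on_id)
  have "(\<Sum>i\<in>UNIV. trans_avg (a, 0) (b, 1) (\<lambda>p. g (fst p) * v (fst p) $ i)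
        (\<lambda>p. s + snd p *\<^sub>R v (fst p)) (partial i h) x)
    = integral (cbox (a, 0) (b, 1)) (\<lambda>p. \<Sum>i\<in>UNIV. g (fst p) * v (fst p) $ i * partial i h (x - (s + snd p *\<^sub>R v (fst p))))"
    unfolding trans_avg_def by (intro integral_sum[symmetric] integrable_continuous c) auto
  also have "\<dots> = integral (cbox a b) (\<lambda>w. integral (cbox 0 1) (\<lambda>t. 
      \<Sum>i\<in>UNIV. g w * v w $ i * partial i h (x - (s + t *\<^sub>R v w))))"
    by (subst integral_prod_continuous) (auto intro!: continuous_on_sum c)
  also have "\<dots> = integral (cbox a b) (\<lambda>w. g w * (h (x - s) - h (x - s - v w)))"
  proof (rule integral_cong)
    fix w
    have "integral (cbox 0 1) (\<lambda>t. \<Sum>i\<in>UNIV. g w * v w $ i * partial i h (x - (s + t *\<^sub>R v w)))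
        = integral (cbox 0 1) (\<lambda>t. g w * (\<Sum>i\<in>UNIV. v w $ i * partial i h (x - s - t *\<^sub>R v w)))"
      by (simp add: sum_distrib_left mult.assoc diff_diff_eq)
    also have "\<dots> = g w * (h (x - s) - h (x - s - v w))"
      using integral_ray[OF h, of "v w" "x - s"] by (simp add: integral_mult_right)
    finally show "integral (cbox 0 1) (\<lambda>t. \<Sum>i\<in>UNIV. g w * v w $ i * partial i h (x - (s + t *\<^sub>R v w)))
        = g w * (h (x - s) - h (x - s - v w))" .
  qed
  finally show ?thesis .
qed

text \<open>The field transports \<open>h\<close>, shifted by \<open>s\<close>, along the segments
  with direction \<open>v w\<close>, superposed with density \<open>g w\<close>. Hypothesis
  \<open>supp\<close> keeps all these segments in the compact set \<open>K\<close>, which makes the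
  field a test field on \<open>\<Omega>\<close>. The time interval has length 1 and so leaves no
  trace in the constant.\<close>

lemma ray_superposition:
  fixes h g :: "real ^ 'd \<Rightarrow> real" and v :: "real ^ 'd \<Rightarrow> real ^ 'd"
  assumes h: "h \<in> test_fun \<Omega>'" and g: "continuous_on UNIV g" and v: "continuous_on UNIV v"
    and K: "compact K" "K \<subseteq> \<Omega>" 
    and supp: "\<And>w t x. w \<in> cbox a b \<Longrightarrow> t \<in> {0..1} \<Longrightarrow> g w \<noteq> 0 \<Longrightarrow> h (x - (s + t *\<^sub>R v w)) \<noteq> 0 \<Longrightarrow> x \<in> K"
  obtains \<Phi> where "\<Phi> \<in> test_fun \<Omega>"
    "\<And>x. divg \<Phi> x = integral (cbox a b) (\<lambda>w. g w * (h (x - s) - h (x - s - v w)))"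
    "nsq lborel \<Phi> \<le> (\<Sum>i\<in>UNIV. integral (cbox a b) (\<lambda>w. (g w * v w $ i)\<^sup>2)) * measure lborel (cbox a b) * nsq lborel h"
proof -
  define \<kappa> :: "'d \<Rightarrow> (real ^ 'd) \<times> real \<Rightarrow> real" where "\<kappa> = (\<lambda>i p. g (fst p) * v (fst p) $ i)"
  define \<theta> :: "(real ^ 'd) \<times> real \<Rightarrow> real ^ 'd" where "\<theta> = (\<lambda>p. s + snd p *\<^sub>R v (fst p))"
  have c\<kappa>: "continuous_on S (\<kappa> i)" for S i unfolding \<kappa>_def
    by (intro continuous_on_mult continuous_on_compose_UNIV[OF g] continuous_on_component continuous_on_compose_UNIV[OF v]
      continuous_on_fst continuous_on_id)
  have c\<theta>: "continuous_on UNIV \<theta>" unfolding \<theta>_def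
    by (intro continuous_on_add continuous_on_scaleR continuous_on_const continuous_on_compose_UNIV[OF v]
      continuous_on_fst continuous_on_snd continuous_on_id)
  define F where "F i = trans_avg (a, 0) (b, 1) (\<kappa> i) \<theta> h" for i
  have sh: "smooth h" using h by (rule test_fun_smooth)
  have F: "F i \<in> test_fun \<Omega>" for i
    unfolding F_def
  proof (rule trans_avg_test_fun[OF c\<kappa> c\<theta> sh K])
    fix q x assume q: "q \<in> cbox (a, 0) (b, 1)" and nz: "\<kappa> i q \<noteq> 0" "h (x - \<theta> q) \<noteq> 0"
    obtain w t where wt: "q = (w, t)" by (cases q)
    show "x \<in> K" using q nz unfolding wt
      by (intro supp[of w t]) (auto simp: \<kappa>_def \<theta>_def cbox_Pair_eq)
  qed
  note V = vector_field_components[of F, OF F]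
  show ?thesis
  proof (rule that[OF V(1)])
    fix x
    have "divg (\<lambda>x. \<chi> i. F i x) x = (\<Sum>i\<in>UNIV. trans_avg (a, 0) (b, 1) (\<kappa> i) \<theta> (partial i h) x)"
      unfolding V(2) unfolding F_def using sh by (subst partial_trans_avg[OF c\<kappa> c\<theta>]) (auto simp: smooth_def simp del: Ck.simps)
    also have "\<dots> = integral (cbox a b) (\<lambda>w. g w * (h (x - s) - h (x - s - v w)))"
      unfolding \<kappa>_def \<theta>_def by (rule ray_superposition_divg[OF sh g v])
    finally show "divg (\<lambda>x. \<chi> i. F i x) x = integral (cbox a b) (\<lambda>w. g w * (h (x - s) - h (x - s - v w)))" .
  next
    have int: "integral (cbox (a, 0) (b, 1)) (\<lambda>p. (\<kappa> i p)\<^sup>2) = integral (cbox a b) (\<lambda>w. (g w * v w $ i)\<^sup>2)" for i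
    proof -
      have "integral (cbox (a, 0) (b, 1)) (\<lambda>p. (\<kappa> i p)\<^sup>2)
          = integral (cbox a b) (\<lambda>w. integral (cbox 0 1) (\<lambda>t::real. (\<kappa> i (w, t))\<^sup>2))"
        by (intro integral_prod_continuous continuous_on_power c\<kappa>)
      then show ?thesis by (simp add: \<kappa>_def)
    qed
    have vol: "measure lborel (cbox (a, 0::real) (b, 1)) = measure lborel (cbox a b)"
      using content_Pair[of a 0 b "1::real"] by simp
    have "nsq lborel (F i) \<le> integral (cbox a b) (\<lambda>w. (g w * v w $ i)\<^sup>2) * measure lborel (cbox a b) * nsq lborel h" for i
      using nsq_trans_avg_le[OF c\<kappa> c\<theta> h, of "(a, 0)" "(b, 1)" i] unfolding F_def int vol .
    then show "nsq lborel (\<lambda>x. \<chi> i. F i x) \<le>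
        (\<Sum>i\<in>UNIV. integral (cbox a b) (\<lambda>w. (g w * v w $ i)\<^sup>2)) * measure lborel (cbox a b) * nsq lborel h"
      unfolding V(3) sum_distrib_right by (intro sum_mono)
  qed
qed

text \<open>
  Unlike in Bogovskii's construction no bound on the derivatives of \<open>\<Phi>\<close> is required, so that
  partitions of unity are harmless.
\<close>

definition div_solvable :: "(real ^ 'd) set \<Rightarrow> (real ^ 'd \<Rightarrow> real) \<Rightarrow> (real ^ 'd) set \<Rightarrow> bool" where
  "div_solvable \<Omega> \<omega> U \<longleftrightarrow> (\<exists>C. \<forall>h \<in> test_fun U. \<exists>\<Phi> \<in> test_fun \<Omega>. \<exists>c.
     (\<forall>x. divg \<Phi> x = h x - c * \<omega> x) \<and> nsq lborel \<Phi> \<le> C * nsq lborel h)"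

section \<open>Solvability of the divergence equation under shifts and unions\<close>

lemma div_solvable_mono: "div_solvable \<Omega> \<omega> V \<Longrightarrow> U \<subseteq> V \<Longrightarrow> div_solvable \<Omega> \<omega> U"
  unfolding div_solvable_def using test_fun_mono by meson

text \<open>Carrying \<open>h\<close> along \<open>w\<close> inside \<open>\<Omega>\<close> costs a
  field with divergence \<open>h x - h (x - w)\<close>; the remaining translate is supported in
  \<open>V\<close>, where the equation is solvable, and has the same L2 norm as
  \<open>h\<close>.\<close>

lemma div_solvable_shift:
  fixes w :: "real ^ 'd"
  assumes V: "div_solvable \<Omega> \<omega> V" and path: "\<And>y t. y \<in> U \<Longrightarrow> t \<in> {0..1} \<Longrightarrow> y + t *\<^sub>R w \<in> \<Omega>"
    and UV: "\<And>y. y \<in> U \<Longrightarrow> y + w \<in> V"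
  shows "div_solvable \<Omega> \<omega> U"
proof -
  obtain C where C: "\<And>h. h \<in> test_fun V \<Longrightarrow> \<exists>\<Phi> \<in> test_fun \<Omega>. \<exists>c.
     (\<forall>x. divg \<Phi> x = h x - c * \<omega> x) \<and> nsq lborel \<Phi> \<le> C * nsq lborel h"
    using V by (auto simp: div_solvable_def)
  \<comment> \<open>The averaging variable is a dummy here: weight 1 and direction \<open>w\<close>
    are constant on the unit cube, whose volume is 1.\<close>
  define B where "B = (\<Sum>i\<in>UNIV. integral (cbox 0 One) (\<lambda>_::real^'d. (1 * w $ i)\<^sup>2)) * measure lborel (cbox 0 (One::real^'d))"
  have "\<exists>\<Phi> \<in> test_fun \<Omega>. \<exists>c. (\<forall>x. divg \<Phi> x = h x - c * \<omega> x) \<and> nsq lborel \<Phi> \<le> (2 * B + 2 * C) * nsq lborel h"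
    if h: "h \<in> test_fun U" for h
  proof -
    obtain K where K: "smooth h" "compact K" "K \<subseteq> U" "\<And>x. x \<notin> K \<Longrightarrow> h x = 0"
      by (rule test_funE[OF h]) (rule that)
    define K' where "K' = (\<lambda>(y, t). y + t *\<^sub>R w) ` (K \<times> {0..1})"
    have K': "compact K'" unfolding K'_def case_prod_beta
      by (intro compact_continuous_image compact_Times K compact_Icc continuous_intros)
    have "K' \<subseteq> \<Omega>" using path K(3) by (auto simp: K'_def)
    have c: "continuous_on UNIV (\<lambda>_::real^'d. 1::real)" "continuous_on UNIV (\<lambda>_::real^'d. w)"
      by (intro continuous_intros)+
    have mem: "x \<in> K'" if "t \<in> {0..1}" "h (x - (0 + t *\<^sub>R w)) \<noteq> 0" for t x
    proof -
      have "x - t *\<^sub>R w \<in> K" using K(4) that(2) by force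
      then show ?thesis using that(1) unfolding K'_def by (intro image_eqI[of _ _ "(x - t *\<^sub>R w, t)"]) auto
    qed
    obtain \<Phi>1 where \<Phi>1: "\<Phi>1 \<in> test_fun \<Omega>"
      "\<And>x. divg \<Phi>1 x = integral (cbox 0 One) (\<lambda>_::real^'d. 1 * (h (x - 0) - h (x - 0 - w)))"
      "nsq lborel \<Phi>1 \<le> B * nsq lborel h"
    proof (rule ray_superposition[OF h c K' \<open>K' \<subseteq> \<Omega>\<close>, of 0 One 0])
      show "x \<in> K'" if "t \<in> {0..1}" "h (x - (0 + t *\<^sub>R w)) \<noteq> 0" for t x by (rule mem[OF that])
    qed (rule that, simp_all only: B_def)
    have h': "(\<lambda>x. h (x - w)) \<in> test_fun V"
    proof (rule test_funI[OF smooth_translate[OF K(1)]])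
      show "compact ((\<lambda>x. x + w) ` K)" by (intro compact_continuous_image K continuous_intros)
      show "(\<lambda>x. x + w) ` K \<subseteq> V" using UV K(3) by auto
      show "h (x - w) = 0" if "x \<notin> (\<lambda>x. x + w) ` K" for x
        using that by (intro K(4)) (auto simp: image_iff algebra_simps)
    qed
    obtain \<Phi>2 c where \<Phi>2: "\<Phi>2 \<in> test_fun \<Omega>" "\<And>x. divg \<Phi>2 x = h (x - w) - c * \<omega> x"
       "nsq lborel \<Phi>2 \<le> C * nsq lborel (\<lambda>x. h (x - w))"
      using C[OF h'] by blast
    have d: "\<Phi> differentiable (at x)" if "\<Phi> \<in> test_fun \<Omega>" for \<Phi> :: "real ^ 'd \<Rightarrow> real ^ 'd" and x
      using that test_fun_smooth smooth_differentiable by blast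
    have "divg (\<lambda>x. \<Phi>1 x + \<Phi>2 x) x = h x - c * \<omega> x" for x
      unfolding divg_add[OF d[OF \<Phi>1(1)] d[OF \<Phi>2(1)]] \<Phi>1(2) \<Phi>2(2) by (simp add: content_unit)
    moreover have "nsq lborel (\<lambda>x. \<Phi>1 x + \<Phi>2 x) \<le> (2 * B + 2 * C) * nsq lborel h"
      using sqint_add(2)[OF test_fun_sqint_lborel[OF \<Phi>1(1)] test_fun_sqint_lborel[OF \<Phi>2(1)]] \<Phi>1(3) \<Phi>2(3)
      unfolding nsq_translate[OF smooth_borel_measurable[OF K(1)]] by (simp add: algebra_simps)
    ultimately show ?thesis using test_fun_add[OF \<Phi>1(1) \<Phi>2(1)] by blast
  qed
  then show ?thesis unfolding div_solvable_def by blast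
qed

lemma div_solvable_empty: "div_solvable (\<Omega> :: (real ^ 'd) set) \<omega> {}"
proof -
  have z: "h = (\<lambda>x. 0)" if "h \<in> test_fun {}" for h :: "real ^ 'd \<Rightarrow> real"
    using test_fun_outside[OF that] by auto
  have "divg (\<lambda>x::real^'d. 0 :: real^'d) x = 0" for x
    unfolding divg_def partial_eq[OF has_derivative_const[of "0 :: real^'d"]] by simp
  then have "\<exists>\<Phi> \<in> test_fun \<Omega>. \<exists>c. (\<forall>x. divg \<Phi> x = h x - c * \<omega> x) \<and> nsq lborel \<Phi> \<le> 0 * nsq lborel h"
    if "h \<in> test_fun {}" for h
    using z[OF that] by (intro bexI[of _ "\<lambda>x. 0"] exI[of _ 0]) (auto simp: nsq_def)
  then show ?thesis unfolding div_solvable_def by blast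
qed

text \<open>The cutoff is chosen anew for every \<open>h\<close>, depending on its support; the
  constant is nevertheless uniform because only \<open>0 \<le> f\<close> and
  \<open>f \<le> 1\<close> enter the estimate. The errors \<open>c1 * \<omega>\<close> and
  \<open>c2 * \<omega>\<close> of the two pieces simply add up.\<close>

lemma div_solvable_Un:
  fixes U1 U2 :: "(real ^ 'd) set"
  assumes U1: "div_solvable \<Omega> \<omega> U1" and U2: "div_solvable \<Omega> \<omega> U2" and "open U1" "open U2"
  shows "div_solvable \<Omega> \<omega> (U1 \<union> U2)"
proof -
  obtain C1 where C1: "\<And>h. h \<in> test_fun U1 \<Longrightarrow> \<exists>\<Phi> \<in> test_fun \<Omega>. \<exists>c.
     (\<forall>x. divg \<Phi> x = h x - c * \<omega> x) \<and> nsq lborel \<Phi> \<le> C1 * nsq lborel h"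
    using U1 by (auto simp: div_solvable_def)
  obtain C2 where C2: "\<And>h. h \<in> test_fun U2 \<Longrightarrow> \<exists>\<Phi> \<in> test_fun \<Omega>. \<exists>c.
     (\<forall>x. divg \<Phi> x = h x - c * \<omega> x) \<and> nsq lborel \<Phi> \<le> C2 * nsq lborel h"
    using U2 by (auto simp: div_solvable_def)
  have "\<exists>\<Phi> \<in> test_fun \<Omega>. \<exists>c. (\<forall>x. divg \<Phi> x = h x - c * \<omega> x) \<and> nsq lborel \<Phi> \<le> (2 * \<bar>C1\<bar> + 2 * \<bar>C2\<bar>) * nsq lborel h"
    if h: "h \<in> test_fun (U1 \<union> U2)" for h
  proof -
    obtain K where K: "smooth h" "compact K" "K \<subseteq> U1 \<union> U2" "\<And>x. x \<notin> K \<Longrightarrow> h x = 0"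
      by (rule test_funE[OF h]) (rule that)
    have "compact (K - U2)" using K(2) \<open>open U2\<close> by (rule compact_diff)
    moreover have "K - U2 \<subseteq> U1" using K(3) by auto
    ultimately obtain f V where f: "f \<in> test_fun U1" "\<And>y. 0 \<le> f y" "\<And>y. f y \<le> (1::real)"
      "open V" "K - U2 \<subseteq> V" "\<And>y. y \<in> V \<Longrightarrow> f y = 1"
      by (rule smooth_urysohn[OF _ \<open>open U1\<close>]) (rule that)
    define h1 h2 where "h1 = (\<lambda>x. f x * h x)" and "h2 = (\<lambda>x. (1 - f x) * h x)"
    have h1: "h1 \<in> test_fun U1" unfolding h1_def
      by (rule test_fun_bilinear[OF bounded_bilinear_mult f(1) K(1)])
    have h2: "h2 \<in> test_fun U2"
    proof (rule test_funI)
      show "smooth h2" unfolding h2_def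
        by (intro smooth_mult smooth_diff smooth_const K(1) test_fun_smooth[OF f(1)])
      show "compact (K - V)" using K(2) \<open>open V\<close> by (rule compact_diff)
      show "K - V \<subseteq> U2" using f(5) by auto
      show "h2 x = 0" if "x \<notin> K - V" for x using that K(4) f(6) unfolding h2_def by auto
    qed
    have sh: "sqint lborel h" by (rule test_fun_sqint_lborel[OF h])
    have le: "nsq lborel h1 \<le> nsq lborel h" "nsq lborel h2 \<le> nsq lborel h"
    proof -
      have "norm (h1 x) \<le> 1 * norm (h x)" "norm (h2 x) \<le> 1 * norm (h x)" for x
        unfolding h1_def h2_def norm_mult using f(2,3)[of x] by (intro mult_right_mono; simp)+
      then show "nsq lborel h1 \<le> nsq lborel h" "nsq lborel h2 \<le> nsq lborel h"
        using sqint_mono(2)[OF sh, of h1 1] sqint_mono(2)[OF sh, of h2 1]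
          smooth_borel_measurable[OF test_fun_smooth[OF h1]] smooth_borel_measurable[OF test_fun_smooth[OF h2]] by auto
    qed
    obtain \<Phi>1 c1 where \<Phi>1: "\<Phi>1 \<in> test_fun \<Omega>" "\<And>x. divg \<Phi>1 x = h1 x - c1 * \<omega> x" "nsq lborel \<Phi>1 \<le> C1 * nsq lborel h1"
      using C1[OF h1] by blast
    obtain \<Phi>2 c2 where \<Phi>2: "\<Phi>2 \<in> test_fun \<Omega>" "\<And>x. divg \<Phi>2 x = h2 x - c2 * \<omega> x" "nsq lborel \<Phi>2 \<le> C2 * nsq lborel h2"
      using C2[OF h2] by blast
    have d: "\<Phi> differentiable (at x)" if "\<Phi> \<in> test_fun \<Omega>" for \<Phi> :: "real ^ 'd \<Rightarrow> real ^ 'd" and x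
      using that test_fun_smooth smooth_differentiable by blast
    have "divg (\<lambda>x. \<Phi>1 x + \<Phi>2 x) x = h x - (c1 + c2) * \<omega> x" for x
      unfolding divg_add[OF d[OF \<Phi>1(1)] d[OF \<Phi>2(1)]] \<Phi>1(2) \<Phi>2(2) by (simp add: h1_def h2_def algebra_simps)
    moreover have "nsq lborel (\<lambda>x. \<Phi>1 x + \<Phi>2 x) \<le> (2 * \<bar>C1\<bar> + 2 * \<bar>C2\<bar>) * nsq lborel h"
    proof -
      have "C1 * nsq lborel h1 \<le> \<bar>C1\<bar> * nsq lborel h" "C2 * nsq lborel h2 \<le> \<bar>C2\<bar> * nsq lborel h"
        using le by (intro mult_mono; simp)+
      then show ?thesis
        using sqint_add(2)[OF test_fun_sqint_lborel[OF \<Phi>1(1)] test_fun_sqint_lborel[OF \<Phi>2(1)]] \<Phi>1(3) \<Phi>2(3)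
        by (simp add: algebra_simps)
    qed
    ultimately show ?thesis using test_fun_add[OF \<Phi>1(1) \<Phi>2(1)] by blast
  qed
  then show ?thesis unfolding div_solvable_def by blast
qed

lemma div_solvable_UN:
  "finite I \<Longrightarrow> (\<And>i. i \<in> I \<Longrightarrow> open (U i)) \<Longrightarrow> (\<And>i. i \<in> I \<Longrightarrow> div_solvable \<Omega> \<omega> (U i)) \<Longrightarrow>
    div_solvable \<Omega> \<omega> (\<Union>i\<in>I. U i)"
  by (induction I rule: finite_induct) (auto intro!: div_solvable_empty div_solvable_Un)

text \<open>
  Writing \<open>*\<close> for convolution and \<open>m\<close> for the integral of \<open>\<eta>\<close>, both \<open>m h - \<eta> * h\<close> and
  \<open>(\<integral>h) \<eta>(\<cdot> - z) - \<eta> * h\<close> are averages of differences of translates, hence divergences.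
\<close>

lemma div_solvable_base:
  fixes z :: "real ^ 'd"
  assumes "open \<Omega>" "z \<in> \<Omega>"
  obtains \<omega> r where "\<omega> \<in> test_fun \<Omega>" "(LINT x|lborel. \<omega> x) \<noteq> 0" "r > 0" "div_solvable \<Omega> \<omega> (ball z r)"
proof -
  obtain e where e: "e > 0" "cball z e \<subseteq> \<Omega>" using assms open_contains_cball by blast
  \<comment> \<open>The supports of \<open>\<eta>\<close> and \<open>h\<close> have radius
    \<open>r\<close> around 0 and \<open>z\<close>, so all points reached by the transport stay
    within \<open>2 * r\<close> of \<open>z\<close>.\<close>
  define r where "r = e / 2"
  have r: "r > 0" and r2: "cball z (2 * r) \<subseteq> \<Omega>" using e by (auto simp: r_def)
  obtain \<eta> :: "real ^ 'd \<Rightarrow> real" and V where \<eta>: "\<eta> \<in> test_fun (ball 0 r)" "\<And>y. 0 \<le> \<eta> y" "\<And>y. \<eta> y \<le> (1::real)"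
      "open V" "0 \<in> V" "\<And>y. y \<in> V \<Longrightarrow> \<eta> y = 1"
    by (rule bump_at_point[OF open_ball centre_in_ball[THEN iffD2, OF r]]) (rule that)
  have s\<eta>: "smooth \<eta>" using \<eta>(1) by (rule test_fun_smooth)
  note c\<eta> = smooth_continuous[OF s\<eta>]
  define m where "m = (LINT x|lborel. \<eta> x)"
  have m: "m \<noteq> 0"
  proof
    assume "m = 0"
    then have "AE x in lborel. \<eta> x = 0"
      using integral_nonneg_eq_0_iff_AE[OF test_fun_integrable[OF \<eta>(1)]] \<eta>(2) by (simp add: m_def)
    then have "AE x in lebesgue. x \<in> {x. \<eta> x = 0}" by (auto intro: AE_completion)
    moreover have "closed {x. \<eta> x = 0}"
      using continuous_closed_vimage[of "{0}" \<eta>] c\<eta> 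
      by (simp add: vimage_def continuous_on_eq_continuous_at)
    ultimately have "0 \<in> {x. \<eta> x = 0}" using mem_closed_if_AE_lebesgue by blast
    then show False using \<eta>(5,6) by auto
  qed
  obtain a where a: "cball (0::real^'d) r \<subseteq> cbox (-a) a" using compact_subset_symmetric_cbox[OF compact_cball] by blast
  obtain b where b: "cball z r \<subseteq> cbox (-b) b" using compact_subset_symmetric_cbox[OF compact_cball] by blast
  define \<omega> where "\<omega> = (\<lambda>x. \<eta> (x - z))"
  have \<omega>: "\<omega> \<in> test_fun \<Omega>" unfolding \<omega>_def
  proof (rule test_funI[OF smooth_translate[OF s\<eta>] compact_cball r2])
    show "\<eta> (x - z) = 0" if "x \<notin> cball z (2 * r)" for x
      using that r by (intro test_fun_outside[OF \<eta>(1)]) (auto simp: dist_norm norm_minus_commute)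
  qed
  have \<omega>m: "(LINT x|lborel. \<omega> x) = m"
  proof -
    have "m = (LINT x|distr lborel borel ((+) (- z)). \<eta> x)" by (simp add: m_def lborel_distr_plus)
    also have "\<dots> = (LINT x|lborel. \<omega> x)"
      using smooth_borel_measurable[OF s\<eta>] by (subst integral_distr) (auto simp: \<omega>_def)
    finally show ?thesis by simp
  qed
  define v where "v = (\<lambda>y. y - z)"
  have cv: "continuous_on UNIV v" unfolding v_def by (intro continuous_intros)
  define B1 where "B1 = (\<Sum>i\<in>UNIV. integral (cbox (-a) a) (\<lambda>w. (\<eta> w * w $ i)\<^sup>2)) * measure lborel (cbox (-a) a)"
  define B2 where "B2 = real CARD('d) * r\<^sup>2 * measure lborel (cbox (-b) b) * nsq lborel \<eta>"
  have "\<exists>\<Phi> \<in> test_fun \<Omega>. \<exists>c. (\<forall>x. divg \<Phi> x = h x - c * \<omega> x) \<and>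
      nsq lborel \<Phi> \<le> ((1 / m)\<^sup>2 * (2 * B1 + 2 * B2)) * nsq lborel h"
    if h: "h \<in> test_fun (ball z r)" for h
  proof -
    have sh: "smooth h" using h by (rule test_fun_smooth)
    note ch = smooth_continuous[OF sh]
    have h0: "norm (x - z) < r" if "h x \<noteq> 0" for x 
      using that test_fun_outside[OF h, of x] by (auto simp: dist_norm norm_minus_commute)
    have \<eta>0: "norm x < r" if "\<eta> x \<noteq> 0" for x 
      using that test_fun_outside[OF \<eta>(1), of x] by auto
    have tr: "norm (t *\<^sub>R y) \<le> norm y" if "t \<in> {0..1}" for t and y :: "real ^ 'd"
      using that mult_left_le_one_le[of "norm y" t] by simp
    have sum2: "x \<in> cball z (2 * r)" if "x - z = p + q" "norm p < r" "norm q < r" for x p q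
      using that norm_triangle_ineq[of p q] by (simp add: dist_norm norm_minus_commute)
    \<comment> \<open>Here \<open>h\<close> is transported and \<open>\<eta>\<close> is the density;
      the divergence is \<open>m * h\<close> minus the convolution.\<close>
    obtain \<Phi>1 where \<Phi>1: "\<Phi>1 \<in> test_fun \<Omega>"
      "\<And>x. divg \<Phi>1 x = integral (cbox (-a) a) (\<lambda>w. \<eta> w * (h (x - 0) - h (x - 0 - w)))"
      "nsq lborel \<Phi>1 \<le> B1 * nsq lborel h"
    proof (rule ray_superposition[OF h c\<eta> continuous_on_id compact_cball r2])
      fix w t x assume "t \<in> {0..1}" "\<eta> w \<noteq> 0" "h (x - (0 + t *\<^sub>R w)) \<noteq> 0"
      then show "x \<in> cball z (2 * r)"
        using tr[of t w] \<eta>0[of w] h0[of "x - (0 + t *\<^sub>R w)"]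
        by (intro sum2[of x "x - t *\<^sub>R w - z" "t *\<^sub>R w"]) auto
    qed (use that in \<open>auto simp: B1_def\<close>)
    \<comment> \<open>Roles exchanged: \<open>\<eta>\<close> is transported from \<open>z\<close> to
      \<open>y\<close> with density \<open>h y\<close>, so \<open>h\<close> enters the L2 bound
      through its weight. Since \<open>h y\<close> vanishes unless \<open>y\<close> is within
      \<open>r\<close> of \<open>z\<close>, the directions contribute at most
      \<open>r\<^sup>2\<close> per component.\<close>
    obtain \<Phi>2 where \<Phi>2: "\<Phi>2 \<in> test_fun \<Omega>"
      "\<And>x. divg \<Phi>2 x = integral (cbox (-b) b) (\<lambda>y. h y * (\<eta> (x - z) - \<eta> (x - z - v y)))"
      "nsq lborel \<Phi>2 \<le> (\<Sum>i\<in>UNIV. integral (cbox (-b) b) (\<lambda>w. (h w * v w $ i)\<^sup>2)) * measure lborel (cbox (-b) b) * nsq lborel \<eta>"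
    proof (rule ray_superposition[OF \<eta>(1) ch cv compact_cball r2])
      fix y t x assume "t \<in> {0..1}" "h y \<noteq> 0" "\<eta> (x - (z + t *\<^sub>R v y)) \<noteq> 0"
      then show "x \<in> cball z (2 * r)"
        using tr[of t "y - z"] h0[of y] \<eta>0[of "x - (z + t *\<^sub>R v y)"]
        by (intro sum2[of x "x - (z + t *\<^sub>R v y)" "t *\<^sub>R (y - z)"]) (auto simp: v_def)
    qed (use that in auto)
    have B2: "nsq lborel \<Phi>2 \<le> B2 * nsq lborel h"
    proof -
      have "integral (cbox (-b) b) (\<lambda>w. (h w * v w $ i)\<^sup>2) \<le> r\<^sup>2 * nsq lborel h" for i
      proof -
        have "integral (cbox (-b) b) (\<lambda>w. (h w * v w $ i)\<^sup>2) \<le> integral (cbox (-b) b) (\<lambda>w. r\<^sup>2 * (h w)\<^sup>2)"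
        proof (intro integral_le integrable_continuous)
          show "continuous_on (cbox (- b) b) (\<lambda>w. (h w * v w $ i)\<^sup>2)"
            by (intro continuous_on_power continuous_on_mult continuous_on_component 
              continuous_on_subset[OF ch] continuous_on_subset[OF cv]) auto
          show "continuous_on (cbox (- b) b) (\<lambda>w. r\<^sup>2 * (h w)\<^sup>2)"
            by (intro continuous_on_power continuous_on_mult continuous_on_const continuous_on_subset[OF ch]) auto
          fix w
          show "(h w * v w $ i)\<^sup>2 \<le> r\<^sup>2 * (h w)\<^sup>2"
          proof (cases "h w = 0")
            case False
            have "(v w $ i)\<^sup>2 \<le> r\<^sup>2"
              using h0[OF False] component_le_norm_cart[of "w - z" i]
              by (intro abs_le_square_iff[THEN iffD1]) (simp add: v_def)
            then show ?thesis
              using mult_right_mono[of "(v w $ i)\<^sup>2" "r\<^sup>2" "(h w)\<^sup>2"] by (simp add: power_mult_distrib mult.commute)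
          qed simp
        qed
        also have "\<dots> = r\<^sup>2 * integral (cbox (-b) b) (\<lambda>w. (h w)\<^sup>2)" by (simp add: integral_mult_right)
        also have "integral (cbox (-b) b) (\<lambda>w. (h w)\<^sup>2) = (LINT w|lborel. (h w)\<^sup>2)"
        proof (rule compact_support_integral_cbox)
          show "continuous_on UNIV (\<lambda>w. (h w)\<^sup>2)" by (intro continuous_intros ch)
          fix w assume "w \<notin> cbox (-b) b"
          then have "w \<notin> cball z r" using b by blast
          then show "(h w)\<^sup>2 = 0" using h0[of w] by (auto simp: dist_norm norm_minus_commute)
        qed
        finally show ?thesis by (simp add: nsq_def)
      qed
      then have "(\<Sum>i\<in>UNIV. integral (cbox (-b) b) (\<lambda>w. (h w * v w $ i)\<^sup>2)) \<le> (\<Sum>i\<in>(UNIV::'d set). r\<^sup>2 * nsq lborel h)"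
        by (intro sum_mono)
      also have "\<dots> = real CARD('d) * r\<^sup>2 * nsq lborel h" by simp
      finally have "(\<Sum>i\<in>UNIV. integral (cbox (-b) b) (\<lambda>w. (h w * v w $ i)\<^sup>2)) * (measure lborel (cbox (-b) b) * nsq lborel \<eta>)
          \<le> real CARD('d) * r\<^sup>2 * nsq lborel h * (measure lborel (cbox (-b) b) * nsq lborel \<eta>)"
        by (intro mult_right_mono) auto
      then show ?thesis using \<Phi>2(3) by (simp add: B2_def mult_ac)
    qed
    \<comment> \<open>The only possible value: a divergence of a test field has integral 0, and
      \<open>\<omega>\<close> has integral \<open>m\<close>.\<close>
    define c where "c = (LINT y|lborel. h y) / m"
    have div: "divg \<Phi>1 x - divg \<Phi>2 x = m * (h x - c * \<omega> x)" for x
    proof -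
      have c1: "continuous_on UNIV (\<lambda>w. \<eta> w * h (x - w))" and c2: "continuous_on UNIV (\<lambda>y. \<eta> (x - y) * h y)"
        by (intro continuous_on_mult c\<eta> ch continuous_on_compose_UNIV[OF ch] continuous_on_compose_UNIV[OF c\<eta>] continuous_intros)+
      have z1: "\<eta> w = 0" if "w \<notin> cbox (-a) a" for w
      proof (rule ccontr)
        assume "\<eta> w \<noteq> 0"
        then have "w \<in> cball 0 r" using \<eta>0[of w] by simp
        then show False using a that by blast
      qed
      have z2: "h y = 0" if "y \<notin> cbox (-b) b" for y
      proof (rule ccontr)
        assume "h y \<noteq> 0"
        then have "y \<in> cball z r" using h0[of y] by (simp add: dist_norm norm_minus_commute)
        then show False using b that by blast
      qed
      have "divg \<Phi>1 x = integral (cbox (-a) a) (\<lambda>w. h x * \<eta> w - \<eta> w * h (x - w))"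
        unfolding \<Phi>1(2) by (simp add: algebra_simps)
      also have "\<dots> = integral (cbox (-a) a) (\<lambda>w. h x * \<eta> w) - integral (cbox (-a) a) (\<lambda>w. \<eta> w * h (x - w))"
        by (intro integral_diff integrable_continuous continuous_on_mult continuous_on_const
            continuous_on_subset[OF c\<eta>] continuous_on_subset[OF c1]) auto
      also have "integral (cbox (-a) a) (\<lambda>w. h x * \<eta> w) = h x * m"
        using compact_support_integral_cbox[OF c\<eta> z1] by (simp add: integral_mult_right m_def)
      also have "integral (cbox (-a) a) (\<lambda>w. \<eta> w * h (x - w)) = (LINT w|lborel. \<eta> w * h (x - w))"
        by (rule compact_support_integral_cbox[OF c1]) (simp add: z1)
      also have "\<dots> = (LINT y|lborel. \<eta> (x - y) * h y)"
        using lborel_integral_reflect[OF borel_measurable_continuous_onI[OF c2], of x] by simp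
      finally have d1: "divg \<Phi>1 x = h x * m - (LINT y|lborel. \<eta> (x - y) * h y)" .
      have "divg \<Phi>2 x = integral (cbox (-b) b) (\<lambda>y. \<omega> x * h y - \<eta> (x - y) * h y)"
        unfolding \<Phi>2(2) by (simp add: algebra_simps \<omega>_def v_def)
      also have "\<dots> = integral (cbox (-b) b) (\<lambda>y. \<omega> x * h y) - integral (cbox (-b) b) (\<lambda>y. \<eta> (x - y) * h y)"
        by (intro integral_diff integrable_continuous continuous_on_mult continuous_on_const
            continuous_on_subset[OF ch] continuous_on_subset[OF c2]) auto
      also have "integral (cbox (-b) b) (\<lambda>y. \<omega> x * h y) = \<omega> x * (LINT y|lborel. h y)"
        using compact_support_integral_cbox[OF ch z2] by (simp add: integral_mult_right)
      also have "integral (cbox (-b) b) (\<lambda>y. \<eta> (x - y) * h y) = (LINT y|lborel. \<eta> (x - y) * h y)"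
        by (rule compact_support_integral_cbox[OF c2]) (simp add: z2)
      finally show ?thesis using d1 m by (simp add: c_def algebra_simps)
    qed
    define \<Phi> where "\<Phi> = (\<lambda>x. (1 / m) *\<^sub>R (\<Phi>1 x + (- 1) *\<^sub>R \<Phi>2 x))"
    have t2: "(\<lambda>x. (- 1) *\<^sub>R \<Phi>2 x) \<in> test_fun \<Omega>" by (rule test_fun_scaleR[OF \<Phi>2(1)])
    have t12: "(\<lambda>x. \<Phi>1 x + (- 1) *\<^sub>R \<Phi>2 x) \<in> test_fun \<Omega>" by (rule test_fun_add[OF \<Phi>1(1) t2])
    have d: "\<Phi> differentiable (at x)" if "\<Phi> \<in> test_fun \<Omega>" for \<Phi> :: "real ^ 'd \<Rightarrow> real ^ 'd" and x
      using that test_fun_smooth smooth_differentiable by blast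
    have "divg \<Phi> x = h x - c * \<omega> x" for x
      unfolding \<Phi>_def divg_scaleR[OF d[OF t12]] divg_add[OF d[OF \<Phi>1(1)] d[OF t2]] divg_scaleR[OF d[OF \<Phi>2(1)]]
      using div[of x] m by (simp add: field_simps)
    moreover have "nsq lborel \<Phi> \<le> ((1 / m)\<^sup>2 * (2 * B1 + 2 * B2)) * nsq lborel h"
    proof -
      have "nsq lborel (\<lambda>x. \<Phi>1 x + (- 1) *\<^sub>R \<Phi>2 x) \<le> 2 * nsq lborel \<Phi>1 + 2 * nsq lborel (\<lambda>x. (- 1) *\<^sub>R \<Phi>2 x)"
        by (rule sqint_add(2)[OF test_fun_sqint_lborel[OF \<Phi>1(1)] test_fun_sqint_lborel[OF t2]])
      also have "nsq lborel (\<lambda>x. (- 1) *\<^sub>R \<Phi>2 x) = nsq lborel \<Phi>2" by (simp add: nsq_def)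
      finally have "nsq lborel (\<lambda>x. \<Phi>1 x + (- 1) *\<^sub>R \<Phi>2 x) \<le> (2 * B1 + 2 * B2) * nsq lborel h"
        using \<Phi>1(3) B2 by (simp add: algebra_simps)
      then have "(1 / m)\<^sup>2 * nsq lborel (\<lambda>x. \<Phi>1 x + (- 1) *\<^sub>R \<Phi>2 x) \<le> (1 / m)\<^sup>2 * ((2 * B1 + 2 * B2) * nsq lborel h)"
        by (rule mult_left_mono) simp
      then show ?thesis unfolding \<Phi>_def nsq_scaleR by (simp only: mult.assoc)
    qed
    moreover have "\<Phi> \<in> test_fun \<Omega>" unfolding \<Phi>_def by (rule test_fun_scaleR[OF t12])
    ultimately show ?thesis by blast
  qed
  then have "div_solvable \<Omega> \<omega> (ball z r)" unfolding div_solvable_def by blast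
  then show ?thesis using that[OF \<omega>] \<omega>m m r by simp
qed

text \<open>Solvability near a point propagates along connected sets: inside a ball contained in
  \<open>\<Omega>\<close>, a small ball around one point is moved straight to a small ball around
  any other, and \<open>div_solvable_shift\<close> applies.\<close>

lemma div_solvable_ball:
  fixes z :: "real ^ 'd"
  assumes \<Omega>: "open \<Omega>" "connected \<Omega>" and z: "z \<in> \<Omega>" "r > 0" "div_solvable \<Omega> \<omega> (ball z r)" and x: "x \<in> \<Omega>"
  obtains e where "e > 0" "div_solvable \<Omega> \<omega> (ball x e)"
proof -
  have "\<exists>e>0. div_solvable \<Omega> \<omega> (ball x e)"
  proof (rule connected_induction_simple[OF \<Omega>(2) z(1) x])
    show "\<exists>e>0. div_solvable \<Omega> \<omega> (ball z e)" using z by blast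
    fix a assume "a \<in> \<Omega>"
    then obtain \<delta>' where \<delta>': "\<delta>' > 0" "cball a \<delta>' \<subseteq> \<Omega>" using \<Omega>(1) open_contains_cball by blast
    \<comment> \<open>By convexity the segment between two points of \<open>ball a \<delta>\<close>
      stays in it; a parallel segment at distance below \<open>\<delta>\<close> stays in
      \<open>cball a (2 * \<delta>)\<close>.\<close>
    define \<delta> where "\<delta> = \<delta>' / 2"
    have \<delta>: "\<delta> > 0" "cball a (2 * \<delta>) \<subseteq> \<Omega>" using \<delta>' by (auto simp: \<delta>_def)
    have step: "\<exists>e>0. div_solvable \<Omega> \<omega> (ball y e)"
      if x: "x \<in> ball a \<delta>" and y: "y \<in> ball a \<delta>" and e: "e > 0" "div_solvable \<Omega> \<omega> (ball x e)" for x y e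
    proof (intro exI[of _ "min e \<delta>"] conjI)
      show "min e \<delta> > 0" using e \<delta> by simp
      show "div_solvable \<Omega> \<omega> (ball y (min e \<delta>))"
      proof (rule div_solvable_shift[OF e(2), of _ "x - y"])
        fix y' and t :: real assume y': "y' \<in> ball y (min e \<delta>)" and t: "t \<in> {0..1}"
        have "norm ((1 - t) *\<^sub>R (y - a) + t *\<^sub>R (x - a)) \<le> (1 - t) * norm (y - a) + t * norm (x - a)"
          using t by (intro order_trans[OF norm_triangle_ineq]) auto
        also have "\<dots> \<le> (1 - t) * \<delta> + t * \<delta>"
          using x y t by (intro add_mono mult_left_mono) (auto simp: dist_norm norm_minus_commute)
        finally have "norm ((1 - t) *\<^sub>R (y - a) + t *\<^sub>R (x - a)) \<le> \<delta>" by (simp add: algebra_simps)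
        moreover have "norm (y' - y) \<le> \<delta>" using y' by (auto simp: dist_norm norm_minus_commute)
        ultimately have "norm ((y' - y) + ((1 - t) *\<^sub>R (y - a) + t *\<^sub>R (x - a))) \<le> 2 * \<delta>"
          using norm_triangle_ineq[of "y' - y" "(1 - t) *\<^sub>R (y - a) + t *\<^sub>R (x - a)"] by linarith
        also have "(y' - y) + ((1 - t) *\<^sub>R (y - a) + t *\<^sub>R (x - a)) = y' + t *\<^sub>R (x - y) - a"
          by (simp add: algebra_simps)
        finally have "y' + t *\<^sub>R (x - y) \<in> cball a (2 * \<delta>)" by (simp add: dist_norm norm_minus_commute)
        then show "y' + t *\<^sub>R (x - y) \<in> \<Omega>" using \<delta>(2) by blast
      next
        fix y' assume "y' \<in> ball y (min e \<delta>)"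
        then show "y' + (x - y) \<in> ball x e" by (auto simp: dist_norm algebra_simps)
      qed
    qed
    show "\<exists>T. openin (top_of_set \<Omega>) T \<and> a \<in> T \<and> (\<forall>x\<in>T. \<forall>y\<in>T. 
        (\<exists>e>0. div_solvable \<Omega> \<omega> (ball x e)) \<longrightarrow> (\<exists>e>0. div_solvable \<Omega> \<omega> (ball y e)))"
    proof (intro exI[of _ "ball a \<delta>"] conjI ballI impI)
      have "ball a \<delta> \<subseteq> \<Omega>" using \<delta> by (intro order_trans[OF _ \<delta>(2)] ball_subset_cball[THEN order_trans]) auto
      then show "openin (top_of_set \<Omega>) (ball a \<delta>)" by (simp add: openin_open_eq \<Omega>(1))
    qed (use \<delta> step in auto)
  qed
  then show ?thesis using that by blast
qed

text \<open>Radius and constant vary from point to point; compactness leaves finitely many of them,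
  to be merged by \<open>div_solvable_UN\<close>.\<close>

lemma div_solvable_compact:
  fixes z :: "real ^ 'd"
  assumes \<Omega>: "open \<Omega>" "connected \<Omega>" and z: "z \<in> \<Omega>" "r > 0" "div_solvable \<Omega> \<omega> (ball z r)"
    and K: "compact K" "K \<subseteq> \<Omega>"
  obtains U where "K \<subseteq> U" "div_solvable \<Omega> \<omega> U"
proof -
  have "\<exists>e>0. div_solvable \<Omega> \<omega> (ball x e)" if "x \<in> K" for x
    using div_solvable_ball[OF \<Omega> z] K(2) that by blast
  then obtain e where e: "\<And>x. x \<in> K \<Longrightarrow> e x > 0" "\<And>x. x \<in> K \<Longrightarrow> div_solvable \<Omega> \<omega> (ball x (e x))" by metis
  have "K \<subseteq> (\<Union>x\<in>K. ball x (e x))" using e(1) by fastforce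
  then obtain D where D: "D \<subseteq> K" "finite D" "K \<subseteq> (\<Union>x\<in>D. ball x (e x))"
    by (rule compactE_image[OF K(1) open_ball]) (rule that)
  have "div_solvable \<Omega> \<omega> (\<Union>x\<in>D. ball x (e x))"
    using D e by (intro div_solvable_UN) auto
  then show ?thesis using that D(3) by blast
qed

text \<open>Translation by a fixed amount \<open>\<tau>\<close> along \<open>\<nu>\<close> keeps
  points above the graph inside \<open>\<Omega>\<close> and lifts them to height at least
  \<open>\<tau>\<close> over it. The translated piece lies in a compact subset of
  \<open>\<Omega>\<close>, on which the equation is already solvable.\<close>

lemma div_solvable_boundary:
  fixes \<Omega> :: "(real ^ 'd) set"
  assumes "bounded_lipschitz_domain \<Omega>" and z: "z \<in> \<Omega>" "r > 0" "div_solvable \<Omega> \<omega> (ball z r)"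
    and x0: "x0 \<in> frontier \<Omega>"
  obtains e where "e > 0" "div_solvable \<Omega> \<omega> (\<Omega> \<inter> ball x0 e)"
proof -
  have \<Omega>: "open \<Omega>" "connected \<Omega>" using assms(1) by (auto simp: bounded_lipschitz_domain_def)
  obtain R \<nu> \<gamma> L where R: "R > 0" and \<nu>: "norm \<nu> = 1" 
    and \<gamma>: "L-lipschitz_on {y. y \<bullet> \<nu> = 0} (\<gamma> :: real ^ 'd \<Rightarrow> real)"
    and eq: "\<Omega> \<inter> ball x0 R = {x \<in> ball x0 R. x \<bullet> \<nu> > \<gamma> (x - (x \<bullet> \<nu>) *\<^sub>R \<nu>)}"
    using assms(1) x0 unfolding bounded_lipschitz_domain_def by blast
  have \<nu>\<nu>: "\<nu> \<bullet> \<nu> = 1" using \<nu> by (simp add: norm_eq_1)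
  define \<Gamma> where "\<Gamma> x = \<gamma> (x - (x \<bullet> \<nu>) *\<^sub>R \<nu>)" for x
  have c\<Gamma>: "continuous_on UNIV \<Gamma>" unfolding \<Gamma>_def
    by (rule continuous_on_compose2[OF lipschitz_on_continuous_on[OF \<gamma>]])
       (auto intro!: continuous_intros simp: inner_diff_left \<nu>\<nu>)
  have \<Gamma>_shift: "\<Gamma> (x + s *\<^sub>R \<nu>) = \<Gamma> x" for x s
    by (simp add: \<Gamma>_def inner_add_left \<nu>\<nu> algebra_simps)
  \<comment> \<open>Points within \<open>\<tau>\<close> of \<open>x0\<close>, moved by at most
    \<open>\<tau>\<close>, stay in \<open>cball x0 (2 * \<tau>)\<close> and thus where the graph
    describes \<open>\<Omega>\<close>.\<close>
  define \<tau> where "\<tau> = R / 4"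
  have \<tau>: "\<tau> > 0" using R by (simp add: \<tau>_def)
  have ball: "y + s *\<^sub>R \<nu> \<in> cball x0 (2 * \<tau>)" if "y \<in> ball x0 \<tau>" "0 \<le> s" "s \<le> \<tau>" for y s
  proof -
    have "norm (y + s *\<^sub>R \<nu> - x0) \<le> norm (y - x0) + norm (s *\<^sub>R \<nu>)"
      using norm_triangle_ineq[of "y - x0" "s *\<^sub>R \<nu>"] by (simp add: algebra_simps)
    then show ?thesis using that \<nu> by (simp add: dist_norm norm_minus_commute)
  qed
  have sub: "cball x0 (2 * \<tau>) \<subseteq> ball x0 R" using R by (auto simp: \<tau>_def)
  have in\<Omega>: "x \<in> \<Omega> \<longleftrightarrow> x \<bullet> \<nu> > \<Gamma> x" if "x \<in> ball x0 R" for x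
  proof -
    have "x \<in> \<Omega> \<longleftrightarrow> x \<in> \<Omega> \<inter> ball x0 R" using that by simp
    also have "\<dots> \<longleftrightarrow> x \<bullet> \<nu> > \<Gamma> x" unfolding eq \<Gamma>_def using that by simp
    finally show ?thesis .
  qed
  define U where "U = \<Omega> \<inter> ball x0 \<tau>"
  have U: "y \<in> ball x0 R" "y \<bullet> \<nu> > \<Gamma> y" if "y \<in> U" for y
    using that in\<Omega>[of y] R by (auto simp: U_def \<tau>_def)
  \<comment> \<open>While \<open>U\<close> reaches up to the boundary, this set does not: it is
    compact, contained in \<open>\<Omega>\<close>, and contains the shifted
    \<open>U\<close>.\<close>
  define T where "T = cball x0 (2 * \<tau>) \<inter> {p. \<Gamma> p + \<tau> \<le> p \<bullet> \<nu>}"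
  have "closed {p. \<Gamma> p + \<tau> \<le> p \<bullet> \<nu>}"
    by (intro closed_Collect_le continuous_intros c\<Gamma>)
  then have cT: "compact T" unfolding T_def by (intro compact_Int_closed compact_cball)
  have "T \<subseteq> \<Omega>" 
  proof
    fix p assume "p \<in> T"
    then show "p \<in> \<Omega>" using in\<Omega>[of p] sub \<tau> by (auto simp: T_def)
  qed
  then obtain V where V: "T \<subseteq> V" "div_solvable \<Omega> \<omega> V"
    using div_solvable_compact[OF \<Omega> z cT] by blast
  have "div_solvable \<Omega> \<omega> U"
  proof (rule div_solvable_shift[OF V(2), of _ "\<tau> *\<^sub>R \<nu>"])
    fix y and t :: real assume y: "y \<in> U" and t: "t \<in> {0..1}"
    have "t * \<tau> \<le> \<tau>" using t \<tau> by (simp add: mult_left_le_one_le)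
    then have "y + (t * \<tau>) *\<^sub>R \<nu> \<in> ball x0 R"
      using ball[of y "t * \<tau>"] sub y t \<tau> by (auto simp: U_def)
    moreover have "(y + (t * \<tau>) *\<^sub>R \<nu>) \<bullet> \<nu> > \<Gamma> (y + (t * \<tau>) *\<^sub>R \<nu>)"
    proof -
      have "0 \<le> t * \<tau>" using t \<tau> by simp
      then show ?thesis unfolding \<Gamma>_shift inner_add_left inner_scaleR_left \<nu>\<nu> using U(2)[OF y] by linarith
    qed
    ultimately show "y + t *\<^sub>R \<tau> *\<^sub>R \<nu> \<in> \<Omega>" using in\<Omega> by simp
  next
    fix y assume y: "y \<in> U"
    have "y + \<tau> *\<^sub>R \<nu> \<in> T"
      unfolding T_def using ball[of y \<tau>] y \<tau> U(2)[OF y]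
      by (auto simp: U_def \<Gamma>_shift inner_add_left \<nu>\<nu>)
    then show "y + \<tau> *\<^sub>R \<nu> \<in> V" using V(1) by blast
  qed
  then show ?thesis using that \<tau> by (simp add: U_def)
qed

text \<open>The compact closure of \<open>\<Omega>\<close> is covered by finitely many interior
  balls and boundary pieces, so \<open>div_solvable\<close> holds on all of \<open>\<Omega>\<close>.
  For a right-hand side that is itself a divergence, integrating the equation gives
  \<open>c = 0\<close>.\<close>

proposition divergence_right_inverse_bound:
  fixes \<Omega> :: "(real ^ 'd) set"
  assumes \<Omega>: "bounded_lipschitz_domain \<Omega>"
  obtains C where "\<And>\<Psi>. \<Psi> \<in> test_fun \<Omega> \<Longrightarrow> \<exists>\<Phi> \<in> test_fun \<Omega>. (\<forall>x. divg \<Phi> x = divg \<Psi> x) \<and>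
    nsq lborel \<Phi> \<le> C * nsq lborel (divg \<Psi> :: real ^ 'd \<Rightarrow> real)"
proof -
  have o: "open \<Omega>" and c: "connected \<Omega>" and ne: "\<Omega> \<noteq> {}" and b: "bounded \<Omega>"
    using \<Omega> by (auto simp: bounded_lipschitz_domain_def)
  obtain z where z: "z \<in> \<Omega>" using ne by blast
  obtain \<omega> r where \<omega>: "\<omega> \<in> test_fun \<Omega>" "(LINT x|lborel. \<omega> x) \<noteq> 0" and r: "r > 0" "div_solvable \<Omega> \<omega> (ball z r)"
    using div_solvable_base[OF o z] by blast
  have "\<exists>e>0. div_solvable \<Omega> \<omega> (\<Omega> \<inter> ball x e)" if x: "x \<in> closure \<Omega>" for x
  proof (cases "x \<in> \<Omega>")
    case True
    then show ?thesis using div_solvable_ball[OF o c z r True] div_solvable_mono[OF _ Int_lower2] by metis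
  next
    case False
    then have "x \<in> frontier \<Omega>" using x o by (simp add: frontier_def interior_open)
    then show ?thesis using div_solvable_boundary[OF \<Omega> z r] by metis
  qed
  then obtain e where e: "\<And>x. x \<in> closure \<Omega> \<Longrightarrow> e x > 0" 
    "\<And>x. x \<in> closure \<Omega> \<Longrightarrow> div_solvable \<Omega> \<omega> (\<Omega> \<inter> ball x (e x))" by metis
  have cc: "compact (closure \<Omega>)" using b by simp
  have "closure \<Omega> \<subseteq> (\<Union>x\<in>closure \<Omega>. ball x (e x))" using e(1) by fastforce
  then obtain D where D: "D \<subseteq> closure \<Omega>" "finite D" "closure \<Omega> \<subseteq> (\<Union>x\<in>D. ball x (e x))"
    by (rule compactE_image[OF cc open_ball]) (rule that)
  have "div_solvable \<Omega> \<omega> (\<Union>x\<in>D. \<Omega> \<inter> ball x (e x))"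
    using D e o by (intro div_solvable_UN) auto
  moreover have "\<Omega> \<subseteq> (\<Union>x\<in>D. \<Omega> \<inter> ball x (e x))" using D(3) closure_subset[of \<Omega>] by blast
  ultimately have "div_solvable \<Omega> \<omega> \<Omega>" by (rule div_solvable_mono)
  then obtain C where C: "\<And>h. h \<in> test_fun \<Omega> \<Longrightarrow> \<exists>\<Phi> \<in> test_fun \<Omega>. \<exists>c.
     (\<forall>x. divg \<Phi> x = h x - c * \<omega> x) \<and> nsq lborel \<Phi> \<le> C * nsq lborel h"
    by (auto simp: div_solvable_def)
  show ?thesis
  proof (rule that)
    fix \<Psi> :: "real ^ 'd \<Rightarrow> real ^ 'd" assume \<Psi>: "\<Psi> \<in> test_fun \<Omega>"
    note d\<Psi> = divg_test_fun[OF \<Psi>]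
    obtain \<Phi> c where \<Phi>: "\<Phi> \<in> test_fun \<Omega>" "\<And>x. divg \<Phi> x = divg \<Psi> x - c * \<omega> x"
      "nsq lborel \<Phi> \<le> C * nsq lborel (divg \<Psi>)"
      using C[OF d\<Psi>] by blast
    have "0 = (LINT x|lborel. divg \<Psi> x - c * \<omega> x)"
      using integral_divg_eq_0[OF \<Phi>(1)] unfolding \<Phi>(2) by simp
    also have "\<dots> = - (c * (LINT x|lborel. \<omega> x))"
      using test_fun_integrable[OF d\<Psi>] test_fun_integrable[OF \<omega>(1)] integral_divg_eq_0[OF \<Psi>] by simp
    finally have "c = 0" using \<omega>(2) by simp
    then show "\<exists>\<Phi> \<in> test_fun \<Omega>. (\<forall>x. divg \<Phi> x = divg \<Psi> x) \<and> nsq lborel \<Phi> \<le> C * nsq lborel (divg \<Psi>)"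
      using \<Phi> by (intro bexI[of _ \<Phi>]) simp_all
  qed
qed

section \<open>Weak derivatives\<close>

lemma AE_lebesgue_on_iff:
  "\<Omega> \<in> sets lebesgue \<Longrightarrow> (AE x in lebesgue_on \<Omega>. P x) \<longleftrightarrow> (AE x in lebesgue. x \<in> \<Omega> \<longrightarrow> P x)"
  by (simp add: AE_restrict_space_iff)

text \<open>This is completeness of Lebesgue measure. It makes the chosen representative
  \<open>wpartial\<close>, which is known only up to null sets, measurable on
  \<open>\<Omega>\<close>.\<close>

lemma measurable_lebesgue_on_AE_cong:
  fixes f g :: "'a::euclidean_space \<Rightarrow> 'b::euclidean_space"
  assumes \<Omega>: "\<Omega> \<in> sets lebesgue" and ae: "AE x in lebesgue_on \<Omega>. f x = g x"
    and g: "g \<in> borel_measurable (lebesgue_on \<Omega>)"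
  shows "f \<in> borel_measurable (lebesgue_on \<Omega>)"
proof -
  have iff: "h \<in> borel_measurable (lebesgue_on \<Omega>) \<longleftrightarrow> (\<lambda>x. indicator \<Omega> x *\<^sub>R h x) \<in> borel_measurable lebesgue"
    for h :: "'a \<Rightarrow> 'b"
    using \<Omega> by (intro borel_measurable_restrict_space_iff) simp
  have "(\<lambda>x. indicator \<Omega> x *\<^sub>R f x) \<in> borel_measurable lebesgue"
  proof (rule measurableI)
    fix A :: "'b set" assume A: "A \<in> sets borel"
    show "(\<lambda>x. indicator \<Omega> x *\<^sub>R f x) -` A \<inter> space lebesgue \<in> sets lebesgue"
    proof (rule completion.in_sets_AE)
      show "(\<lambda>x. indicator \<Omega> x *\<^sub>R g x) -` A \<inter> space lebesgue \<in> sets lebesgue"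
        using g iff A by (intro measurable_sets) auto
      have "AE x in lebesgue. x \<in> \<Omega> \<longrightarrow> f x = g x" using ae AE_lebesgue_on_iff[OF \<Omega>] by simp
      then show "AE x in lebesgue. x \<in> (\<lambda>x. indicator \<Omega> x *\<^sub>R g x) -` A \<inter> space lebesgue \<longleftrightarrow>
          x \<in> (\<lambda>x. indicator \<Omega> x *\<^sub>R f x) -` A \<inter> space lebesgue"
        by eventually_elim (auto simp: indicator_def)
    qed simp
  qed simp
  then show ?thesis using iff by blast
qed

lemma loc_integrable_test_scaleR:
  fixes g :: "real ^ 'd \<Rightarrow> 'b::euclidean_space" and \<psi> :: "real ^ 'd \<Rightarrow> real"
  assumes \<Omega>: "\<Omega> \<in> sets lebesgue" and g: "loc_integrable \<Omega> g" and \<psi>: "\<psi> \<in> test_fun \<Omega>"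
  shows "integrable (lebesgue_on \<Omega>) (\<lambda>x. \<psi> x *\<^sub>R g x)"
proof -
  obtain K where K: "smooth \<psi>" "compact K" "K \<subseteq> \<Omega>" "\<And>x. x \<notin> K \<Longrightarrow> \<psi> x = 0"
    by (rule test_funE[OF \<psi>]) (rule that)
  have sK: "K \<in> sets lebesgue" using K(2) by (simp add: borel_compact)
  define G where "G = (\<lambda>x. if x \<in> K then g x else 0)"
  have "integrable (lebesgue_on K) g" using g K by (simp add: loc_integrable_def)
  then have G: "integrable lebesgue G"
    unfolding G_def by (subst Lebesgue_Measure.integrable_restrict_UNIV[OF sK])
  have "bounded (\<psi> ` K)"
    using K(2) continuous_on_subset[OF smooth_continuous[OF K(1)]] by (intro compact_imp_bounded compact_continuous_image) auto
  then obtain B where B: "\<And>x. x \<in> K \<Longrightarrow> \<bar>\<psi> x\<bar> \<le> B" by (auto simp: bounded_iff)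
  have "integrable lebesgue (\<lambda>x. \<psi> x *\<^sub>R G x)"
  proof (rule Bochner_Integration.integrable_bound)
    show "integrable lebesgue (\<lambda>x. B *\<^sub>R G x)" using G by simp
    have "\<psi> \<in> borel_measurable lebesgue"
      using smooth_borel_measurable[OF K(1)] by (simp add: measurable_completion)
    then show "(\<lambda>x. \<psi> x *\<^sub>R G x) \<in> borel_measurable lebesgue" using G by auto
    show "AE x in lebesgue. norm (\<psi> x *\<^sub>R G x) \<le> norm (B *\<^sub>R G x)"
    proof (rule AE_I2)
      fix x show "norm (\<psi> x *\<^sub>R G x) \<le> norm (B *\<^sub>R G x)"
        using order_trans[OF B abs_ge_self, of x] by (cases "x \<in> K") (auto simp: G_def intro: mult_right_mono)
    qed
  qed
  also have "(\<lambda>x. \<psi> x *\<^sub>R G x) = (\<lambda>x. if x \<in> \<Omega> then \<psi> x *\<^sub>R g x else 0)"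
    using K(3,4) by (auto simp: G_def fun_eq_iff)
  finally show ?thesis by (simp add: Lebesgue_Measure.integrable_restrict_UNIV[OF \<Omega>])
qed

lemma sqint_loc_integrable:
  fixes f :: "real ^ 'd \<Rightarrow> 'b::euclidean_space"
  assumes \<Omega>: "\<Omega> \<in> sets lebesgue" and f: "sqint (lebesgue_on \<Omega>) f"
  shows "loc_integrable \<Omega> f"
  unfolding loc_integrable_def
proof (intro allI impI)
  fix K assume K: "compact K \<and> K \<subseteq> \<Omega>"
  have sK: "K \<in> sets lebesgue" using K by (simp add: borel_compact)
  have m: "(\<lambda>x. indicator \<Omega> x *\<^sub>R f x) \<in> borel_measurable lebesgue"
    using f \<Omega> by (subst borel_measurable_restrict_space_iff[symmetric]) (auto simp: sqint_def)
  have "(\<lambda>x. indicator K x *\<^sub>R (indicator \<Omega> x *\<^sub>R f x)) \<in> borel_measurable lebesgue"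
    using m sK by measurable
  also have "(\<lambda>x. indicator K x *\<^sub>R (indicator \<Omega> x *\<^sub>R f x)) = (\<lambda>x. if x \<in> K then f x else 0)"
    using K by (auto simp: fun_eq_iff indicator_def)
  finally have mK: "(\<lambda>x. if x \<in> K then f x else 0) \<in> borel_measurable lebesgue" .
  have i1: "integrable lebesgue (\<lambda>x. indicator K x :: real)"
    using sK emeasure_compact_finite[of K] K by (intro integrable_real_indicator) (simp_all add: borel_compact)
  have i2: "integrable lebesgue (\<lambda>x. if x \<in> \<Omega> then (norm (f x))\<^sup>2 else 0)"
    using f by (simp add: Lebesgue_Measure.integrable_restrict_UNIV[OF \<Omega>] sqint_def)
  have "integrable lebesgue (\<lambda>x. if x \<in> K then f x else 0)"
  proof (rule Bochner_Integration.integrable_bound[OF Bochner_Integration.integrable_add[OF i1 i2] mK], rule AE_I2)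
    fix x
    have "2 * norm (f x) * 1 \<le> (norm (f x))\<^sup>2 + 1\<^sup>2" by (rule sum_squares_bound)
    then have "norm (f x) \<le> 1 + (norm (f x))\<^sup>2" using norm_ge_zero[of "f x"] by (simp only: power_one)
    then show "norm (if x \<in> K then f x else 0) \<le> norm (indicator K x + (if x \<in> \<Omega> then (norm (f x))\<^sup>2 else 0))"
      using K by (auto simp: indicator_def)
  qed
  then show "integrable (lebesgue_on K) f" by (simp add: Lebesgue_Measure.integrable_restrict_UNIV[OF sK])
qed

text \<open>Fundamental lemma of the calculus of variations. Smooth bumps converge boundedly to the
  indicators of boxes, so \<open>g\<close> has integral 0 over every small box; Lebesgue
  differentiation along shrinking cubes then gives \<open>g = 0\<close> almost everywhere.\<close>

lemma AE_zero_of_test_integrals_zero: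
  fixes g :: "real ^ 'd \<Rightarrow> 'b::euclidean_space"
  assumes \<Omega>: "open \<Omega>" and g: "loc_integrable \<Omega> g"
    and z: "\<And>\<psi>::real ^ 'd \<Rightarrow> real. \<psi> \<in> test_fun \<Omega> \<Longrightarrow> (LINT x|lebesgue_on \<Omega>. \<psi> x *\<^sub>R g x) = 0"
  shows "AE x in lebesgue_on \<Omega>. g x = 0"
proof -
  have s\<Omega>: "\<Omega> \<in> sets lebesgue" using \<Omega> by simp
  have box: "\<exists>N. negligible N \<and> (\<forall>x \<in> cbox a b. x \<notin> N \<longrightarrow> g x = 0)" if ab: "cbox a b \<subseteq> \<Omega>" for a b
  proof -
    define G where "G = (\<lambda>x. if x \<in> cbox a b then g x else 0)"
    have "integrable (lebesgue_on (cbox a b)) g" using g ab by (simp add: loc_integrable_def)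
    then have G: "integrable lebesgue G"
      unfolding G_def by (subst Lebesgue_Measure.integrable_restrict_UNIV) auto
    have zero: "integral (cbox c d) G = 0" if cd: "cbox c d \<subseteq> cbox a b" for c d
    proof -
      have "(\<lambda>n. LINT x|lebesgue. box_bump (real n) c d x *\<^sub>R G x) \<longlonglongrightarrow>
          (LINT x|lebesgue. indicator (box c d) x *\<^sub>R G x)"
      proof (rule integral_dominated_convergence[where w = "\<lambda>x. norm (G x)"])
        show "(\<lambda>x. indicator (box c d) x *\<^sub>R G x) \<in> borel_measurable lebesgue"
          using G by (intro borel_measurable_scaleR borel_measurable_indicator) auto
        have "box_bump (real n) c d \<in> borel_measurable lebesgue" for n
          by (intro measurable_completion) (simp add: smooth_borel_measurable[OF smooth_box_bump])
        then show "(\<lambda>x. box_bump (real n) c d x *\<^sub>R G x) \<in> borel_measurable lebesgue" for n 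
          using G by auto
        show "integrable lebesgue (\<lambda>x. norm (G x))" using G by simp
        show "AE x in lebesgue. (\<lambda>n. box_bump (real n) c d x *\<^sub>R G x) \<longlonglongrightarrow> indicator (box c d) x *\<^sub>R G x"
          by (intro AE_I2 tendsto_scaleR box_bump_tendsto tendsto_const)
        show "AE x in lebesgue. norm (box_bump (real n) c d x *\<^sub>R G x) \<le> norm (G x)" for n
          using box_bump_bounds[of n c d] by (intro AE_I2) (simp add: mult_left_le_one_le)
      qed
      moreover have "(LINT x|lebesgue. box_bump (real n) c d x *\<^sub>R G x) = 0" for n
      proof -
        have t: "box_bump (real n) c d \<in> test_fun \<Omega>" using ab cd by (intro box_bump_test_fun) auto
        have "box_bump (real n) c d x = 0" if "x \<notin> cbox a b" for x
          using that cd box_subset_cbox[of c d] by (intro box_bump_eq_0) auto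
        then have "(\<lambda>x. box_bump (real n) c d x *\<^sub>R G x) = (\<lambda>x. if x \<in> \<Omega> then box_bump (real n) c d x *\<^sub>R g x else 0)"
          using ab by (auto simp: G_def fun_eq_iff)
        then show ?thesis
          using z[OF t] by (simp add: Lebesgue_Measure.integral_restrict_UNIV[OF s\<Omega>])
      qed
      ultimately have "(LINT x|lebesgue. indicator (box c d) x *\<^sub>R G x) = 0"
        by (simp add: LIMSEQ_const_iff)
      moreover have "set_integrable lebesgue (box c d) G"
        unfolding set_integrable_def by (rule integrable_mult_indicator[OF _ G]) simp
      ultimately have "integral (box c d) G = 0"
        using set_lebesgue_integral_eq_integral(2)[of "box c d" G] by (simp add: set_lebesgue_integral_def)
      then show ?thesis by (simp add: integral_open_interval)
    qed
    \<comment> \<open>The differentiation theorem used next averages over cubes with lower corner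
      \<open>x\<close> and requires integrability on every box.\<close>
    have "G integrable_on cbox c d" for c d
      using integrable_on_lebesgue[OF G] integrable_on_subcbox by blast
    then obtain N where N: "negligible N"
      "\<And>x e. x \<notin> N \<Longrightarrow> 0 < e \<Longrightarrow> \<exists>d>0. \<forall>h. 0 < h \<and> h < d \<longrightarrow>
           norm (integral (cbox x (x + h *\<^sub>R One)) G /\<^sub>R h ^ DIM(real ^ 'd) - G x) < e"
      using integrable_ccontinuous_explicit by blast
    have "g x = 0" if x: "x \<in> box a b" "x \<notin> N" for x
    proof (rule ccontr)
      assume nz: "g x \<noteq> 0"
      have Gx: "G x = g x" using x(1) box_subset_cbox[of a b] by (auto simp: G_def)
      obtain d where d: "d > 0" "\<And>h. 0 < h \<Longrightarrow> h < d \<Longrightarrow>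
           norm (integral (cbox x (x + h *\<^sub>R One)) G /\<^sub>R h ^ DIM(real ^ 'd) - G x) < norm (g x)"
        using N(2)[OF x(2), of "norm (g x)"] nz by auto
      obtain r where r: "r > 0" "ball x r \<subseteq> box a b" using x(1) open_box open_contains_ball by blast
      \<comment> \<open>Small enough for the differentiation theorem, and, since the norm is at most
        the sum of the coordinates' absolute values, for the cube of side \<open>h\<close> at
        \<open>x\<close> to fit into \<open>ball x r\<close>.\<close>
      define h where "h = min (d / 2) (r / (2 * real DIM(real ^ 'd)))"
      have h: "0 < h" "h < d" "h * real DIM(real ^ 'd) < r"
      proof -
        show "0 < h" "h < d" using d r by (auto simp: h_def)
        have "h * real DIM(real ^ 'd) \<le> r / (2 * real DIM(real ^ 'd)) * real DIM(real ^ 'd)"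
          unfolding h_def by (intro mult_right_mono) auto
        also have "\<dots> = r / 2" by simp
        finally show "h * real DIM(real ^ 'd) < r" using r by simp
      qed
      have "cbox x (x + h *\<^sub>R One) \<subseteq> ball x r"
      proof
        fix y assume y: "y \<in> cbox x (x + h *\<^sub>R One)"
        have "norm (y - x) \<le> (\<Sum>b\<in>Basis. \<bar>(y - x) \<bullet> b\<bar>)" by (rule norm_le_l1)
        also have "\<dots> \<le> (\<Sum>b\<in>(Basis::(real ^ 'd) set). h)"
          using y by (intro sum_mono) (auto simp: mem_box inner_diff_left inner_add_left)
        finally show "y \<in> ball x r" using h by (simp add: dist_norm norm_minus_commute mult.commute)
      qed
      then have "cbox x (x + h *\<^sub>R One) \<subseteq> cbox a b" using r(2) box_subset_cbox[of a b] by blast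
      then show False using d(2)[OF h(1,2)] by (simp add: zero Gx)
    qed
    then have "\<forall>x \<in> cbox a b. x \<notin> N \<union> (cbox a b - box a b) \<longrightarrow> g x = 0" by blast
    moreover have "negligible (N \<union> (cbox a b - box a b))"
      using N(1) negligible_frontier_interval by (rule negligible_Un)
    ultimately show ?thesis by blast
  qed
  obtain D where D: "countable D" "D \<subseteq> Pow \<Omega>" "\<And>X. X \<in> D \<Longrightarrow> \<exists>a b. X = cbox a b" "\<Union>D = \<Omega>"
    using open_countable_Union_open_cbox[OF \<Omega>] by metis
  have "\<exists>N. negligible N \<and> (\<forall>x \<in> X. x \<notin> N \<longrightarrow> g x = 0)" if "X \<in> D" for X
    using box D(2,3) that by (metis PowD subsetD)
  then obtain N where N: "\<And>X. X \<in> D \<Longrightarrow> negligible (N X)" "\<And>X x. X \<in> D \<Longrightarrow> x \<in> X \<Longrightarrow> x \<notin> N X \<Longrightarrow> g x = 0"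
    by metis
  have "negligible (\<Union>X\<in>D. N X)" using D(1) N(1) by (intro negligible_countable_Union) auto
  then have "(\<Union>X\<in>D. N X) \<in> null_sets lebesgue" by (simp add: negligible_iff_null_sets)
  then have "AE x in lebesgue. x \<notin> (\<Union>X\<in>D. N X)" by (rule AE_not_in)
  then have "AE x in lebesgue. x \<in> \<Omega> \<longrightarrow> g x = 0"
  proof eventually_elim
    case (elim x)
    show ?case
    proof
      assume "x \<in> \<Omega>"
      then obtain X where "X \<in> D" "x \<in> X" using D(4) by blast
      with elim N(2) show "g x = 0" by blast
    qed
  qed
  then show ?thesis by (simp add: AE_lebesgue_on_iff[OF s\<Omega>])
qed

section \<open>Uniqueness and calculation rules for weak derivatives\<close>

lemma has_weak_partial_unique:
  fixes g g' :: "real ^ 'd \<Rightarrow> 'b::euclidean_space"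
  assumes \<Omega>: "open \<Omega>" and g: "has_weak_partial \<Omega> i u g" and g': "has_weak_partial \<Omega> i u g'"
  shows "AE x in lebesgue_on \<Omega>. g x = g' x"
proof -
  have s\<Omega>: "\<Omega> \<in> sets lebesgue" using \<Omega> by simp
  have l: "loc_integrable \<Omega> g" "loc_integrable \<Omega> g'" using g g' by (auto simp: has_weak_partial_def)
  have "AE x in lebesgue_on \<Omega>. g x - g' x = 0"
  proof (rule AE_zero_of_test_integrals_zero[OF \<Omega>])
    show "loc_integrable \<Omega> (\<lambda>x. g x - g' x)" using l by (auto simp: loc_integrable_def)
    fix \<psi> :: "real ^ 'd \<Rightarrow> real" assume \<psi>: "\<psi> \<in> test_fun \<Omega>"
    have "(LINT x|lebesgue_on \<Omega>. \<psi> x *\<^sub>R g x) = (LINT x|lebesgue_on \<Omega>. \<psi> x *\<^sub>R g' x)"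
      using g g' \<psi> unfolding has_weak_partial_def by (metis minus_equation_iff)
    then show "(LINT x|lebesgue_on \<Omega>. \<psi> x *\<^sub>R (g x - g' x)) = 0"
      using loc_integrable_test_scaleR[OF s\<Omega> l(1) \<psi>] loc_integrable_test_scaleR[OF s\<Omega> l(2) \<psi>]
      by (simp add: scaleR_diff_right)
  qed
  then show ?thesis by simp
qed

text \<open>The chosen \<open>wpartial\<close> is handled by exhibiting any weak derivative and
  comparing the two almost everywhere.\<close>

lemma wpartial_AE:
  fixes g :: "real ^ 'd \<Rightarrow> 'b::euclidean_space"
  assumes "open \<Omega>" "has_weak_partial \<Omega> i u g"
  shows "AE x in lebesgue_on \<Omega>. wpartial \<Omega> i u x = g x"
  unfolding wpartial_def
  using has_weak_partial_unique[OF assms(1) someI[of "has_weak_partial \<Omega> i u", OF assms(2)] assms(2)] .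

lemma has_weak_partial_bounded_linear:
  fixes T :: "'b::euclidean_space \<Rightarrow> 'c::euclidean_space" and \<Omega> :: "(real ^ 'd) set"
  assumes \<Omega>: "\<Omega> \<in> sets lebesgue" and T: "bounded_linear T" and g: "has_weak_partial \<Omega> i u g"
  shows "has_weak_partial \<Omega> i (\<lambda>x. T (u x)) (\<lambda>x. T (g x))"
proof -
  have l: "loc_integrable \<Omega> u" "loc_integrable \<Omega> g" using g by (auto simp: has_weak_partial_def)
  have "loc_integrable \<Omega> (\<lambda>x. T (u x))" "loc_integrable \<Omega> (\<lambda>x. T (g x))"
    using l integrable_bounded_linear[OF T] by (auto simp: loc_integrable_def)
  moreover have "(LINT x|lebesgue_on \<Omega>. partial i \<psi> x *\<^sub>R T (u x)) = - (LINT x|lebesgue_on \<Omega>. \<psi> x *\<^sub>R T (g x))"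
    if \<psi>: "\<psi> \<in> test_fun \<Omega>" for \<psi> :: "real ^ 'd \<Rightarrow> real"
  proof -
    have "(LINT x|lebesgue_on \<Omega>. partial i \<psi> x *\<^sub>R T (u x)) = (LINT x|lebesgue_on \<Omega>. T (partial i \<psi> x *\<^sub>R u x))"
      by (simp add: linear_scale[OF bounded_linear.linear[OF T]])
    also have "\<dots> = T (LINT x|lebesgue_on \<Omega>. partial i \<psi> x *\<^sub>R u x)"
      by (rule integral_bounded_linear[OF T loc_integrable_test_scaleR[OF \<Omega> l(1) test_fun_partial[OF \<psi>]]])
    also have "\<dots> = - T (LINT x|lebesgue_on \<Omega>. \<psi> x *\<^sub>R g x)"
      using g \<psi> by (simp add: has_weak_partial_def linear_neg[OF bounded_linear.linear[OF T]])
    also have "T (LINT x|lebesgue_on \<Omega>. \<psi> x *\<^sub>R g x) = (LINT x|lebesgue_on \<Omega>. T (\<psi> x *\<^sub>R g x))"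
      by (rule integral_bounded_linear[OF T loc_integrable_test_scaleR[OF \<Omega> l(2) \<psi>], symmetric])
    finally show ?thesis by (simp add: linear_scale[OF bounded_linear.linear[OF T]])
  qed
  ultimately show ?thesis by (simp add: has_weak_partial_def)
qed

lemma has_weak_partial_add:
  fixes u :: "real ^ 'd \<Rightarrow> 'b::euclidean_space"
  assumes \<Omega>: "\<Omega> \<in> sets lebesgue" and g: "has_weak_partial \<Omega> i u g" "has_weak_partial \<Omega> i u' g'"
  shows "has_weak_partial \<Omega> i (\<lambda>x. u x + u' x) (\<lambda>x. g x + g' x)"
proof -
  have l: "loc_integrable \<Omega> u" "loc_integrable \<Omega> g" "loc_integrable \<Omega> u'" "loc_integrable \<Omega> g'" 
    using g by (auto simp: has_weak_partial_def)
  have "loc_integrable \<Omega> (\<lambda>x. u x + u' x)" "loc_integrable \<Omega> (\<lambda>x. g x + g' x)"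
    using l by (auto simp: loc_integrable_def)
  moreover have "(LINT x|lebesgue_on \<Omega>. partial i \<psi> x *\<^sub>R (u x + u' x)) = - (LINT x|lebesgue_on \<Omega>. \<psi> x *\<^sub>R (g x + g' x))"
    if \<psi>: "\<psi> \<in> test_fun \<Omega>" for \<psi> :: "real ^ 'd \<Rightarrow> real"
    using g \<psi> l
    by (simp add: scaleR_add_right loc_integrable_test_scaleR[OF \<Omega> _ \<psi>] 
        loc_integrable_test_scaleR[OF \<Omega> _ test_fun_partial[OF \<psi>]] has_weak_partial_def)
  ultimately show ?thesis by (simp add: has_weak_partial_def)
qed

lemma integral_partial_eq_0_vector:
  fixes f :: "real ^ 'd \<Rightarrow> 'b::euclidean_space"
  assumes "f \<in> test_fun \<Omega>"
  shows "(LINT x|lborel. partial i f x) = 0"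
proof (rule euclidean_eqI)
  fix b :: 'b assume "b \<in> Basis"
  have bl: "bounded_linear (\<lambda>y. y \<bullet> b)" by (rule bounded_linear_inner_left)
  have "(LINT x|lborel. partial i f x) \<bullet> b = (LINT x|lborel. partial i f x \<bullet> b)"
    by (rule integral_inner_left[symmetric]) (rule impI[THEN mp], rule test_fun_integrable[OF test_fun_partial[OF assms]], simp)
  also have "\<dots> = (LINT x|lborel. partial i (\<lambda>x. f x \<bullet> b) x)"
    using partial_bounded_linear[OF bl smooth_differentiable[OF test_fun_smooth[OF assms]]] by simp
  also have "\<dots> = 0" by (rule integral_partial_eq_0[OF test_fun_bounded_linear[OF bl assms]])
  finally show "(LINT x|lborel. partial i f x) \<bullet> b = 0 \<bullet> b" by simp
qed

lemma has_weak_partial_test_fun: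
  fixes \<eta> :: "real ^ 'd \<Rightarrow> 'b::euclidean_space"
  assumes \<Omega>: "\<Omega> \<in> sets lebesgue" and \<eta>: "\<eta> \<in> test_fun \<Omega>"
  shows "has_weak_partial \<Omega> i \<eta> (partial i \<eta>)"
proof -
  have l: "loc_integrable \<Omega> \<eta>" "loc_integrable \<Omega> (partial i \<eta>)"
    using test_fun_sqint[OF _ \<Omega>] \<eta> test_fun_partial by (blast intro: sqint_loc_integrable[OF \<Omega>])+
  moreover have "(LINT x|lebesgue_on \<Omega>. partial i \<psi> x *\<^sub>R \<eta> x) = - (LINT x|lebesgue_on \<Omega>. \<psi> x *\<^sub>R partial i \<eta> x)"
    if \<psi>: "\<psi> \<in> test_fun \<Omega>" for \<psi> :: "real ^ 'd \<Rightarrow> real"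
  proof -
    have t: "(\<lambda>x. \<psi> x *\<^sub>R \<eta> x) \<in> test_fun \<Omega>"
      by (rule test_fun_bilinear[OF bounded_bilinear_scaleR \<psi> test_fun_smooth[OF \<eta>]])
    have p: "partial i (\<lambda>x. \<psi> x *\<^sub>R \<eta> x) x = \<psi> x *\<^sub>R partial i \<eta> x + partial i \<psi> x *\<^sub>R \<eta> x" for x
      by (rule partial_bilinear[OF bounded_bilinear_scaleR]) 
        (auto intro: smooth_differentiable test_fun_smooth \<psi> \<eta>)
    have "0 = (LINT x|lborel. partial i (\<lambda>x. \<psi> x *\<^sub>R \<eta> x) x)"
      by (rule integral_partial_eq_0_vector[OF t, symmetric])
    also have "\<dots> = (LINT x|lebesgue_on \<Omega>. partial i (\<lambda>x. \<psi> x *\<^sub>R \<eta> x) x)"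
      by (rule integral_lebesgue_on_eq_lborel(1)[symmetric, OF _ \<Omega>])
         (auto intro: smooth_borel_measurable test_fun_smooth test_fun_partial[OF t] test_fun_outside[OF test_fun_partial[OF t]])
    also have "\<dots> = (LINT x|lebesgue_on \<Omega>. \<psi> x *\<^sub>R partial i \<eta> x) + (LINT x|lebesgue_on \<Omega>. partial i \<psi> x *\<^sub>R \<eta> x)"
      unfolding p by (intro Bochner_Integration.integral_add loc_integrable_test_scaleR[OF \<Omega>] l \<psi> test_fun_partial)
    finally show ?thesis by (simp add: add_eq_0_iff)
  qed
  ultimately show ?thesis by (simp add: has_weak_partial_def)
qed

text \<open>Unlike \<open>W12_0\<close>, this does not mention the chosen representatives \<open>wpartial\<close>.\<close>

definition grad_in_W120 :: "(real ^ 'd) set \<Rightarrow> (real ^ 'd \<Rightarrow> 'b::euclidean_space) \<Rightarrow> ('d \<Rightarrow> real ^ 'd \<Rightarrow> 'b) \<Rightarrow> bool" where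
  "grad_in_W120 \<Omega> v g \<longleftrightarrow> sqint (lebesgue_on \<Omega>) v \<and> (\<forall>i. sqint (lebesgue_on \<Omega>) (g i)) \<and>
     (\<exists>\<eta>. (\<forall>k::nat. \<eta> k \<in> test_fun \<Omega>) \<and> (\<lambda>k. nsq (lebesgue_on \<Omega>) (\<lambda>x. \<eta> k x - v x)) \<longlonglongrightarrow> 0 \<and>
        (\<forall>i. (\<lambda>k. nsq (lebesgue_on \<Omega>) (\<lambda>x. partial i (\<eta> k) x - g i x)) \<longlonglongrightarrow> 0))"

section \<open>Functions approximable by test functions together with their gradients\<close>

lemma grad_in_W120_test_fun:
  assumes "\<Omega> \<in> sets lebesgue" "v \<in> test_fun \<Omega>"
  shows "grad_in_W120 \<Omega> v (\<lambda>i. partial i v)"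
  unfolding grad_in_W120_def using assms
  by (auto intro!: test_fun_sqint test_fun_partial exI[of _ "\<lambda>_. v"] simp: nsq_def)

text \<open>Both sides of the integration by parts formula are continuous in L2, so the formula
  passes from the approximating test functions to the limit.\<close>

lemma grad_in_W120_has_weak_partial:
  fixes v :: "real ^ 'd \<Rightarrow> 'b::euclidean_space"
  assumes \<Omega>: "\<Omega> \<in> sets lebesgue" and v: "grad_in_W120 \<Omega> v g"
  shows "has_weak_partial \<Omega> i v (g i)"
proof -
  define M where "M = lebesgue_on \<Omega>"
  obtain \<eta> where s: "sqint M v" "\<And>i. sqint M (g i)" and \<eta>: "\<And>k::nat. \<eta> k \<in> test_fun \<Omega>"
    "(\<lambda>k. nsq M (\<lambda>x. \<eta> k x - v x)) \<longlonglongrightarrow> 0" "\<And>i. (\<lambda>k. nsq M (\<lambda>x. partial i (\<eta> k) x - g i x)) \<longlonglongrightarrow> 0"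
    using v unfolding grad_in_W120_def M_def by blast
  have sm: "sqint M (\<eta> k)" "sqint M (partial i (\<eta> k))" for i k
    unfolding M_def by (intro test_fun_sqint(1)[OF _ \<Omega>] test_fun_partial \<eta>(1))+
  have "(LINT x|M. partial i \<psi> x *\<^sub>R v x) = - (LINT x|M. \<psi> x *\<^sub>R g i x)"
    if \<psi>: "\<psi> \<in> test_fun \<Omega>" for \<psi> :: "real ^ 'd \<Rightarrow> real"
  proof -
    have "(\<lambda>k. LINT x|M. partial i \<psi> x *\<^sub>R \<eta> k x) \<longlonglongrightarrow> (LINT x|M. partial i \<psi> x *\<^sub>R v x)"
      by (rule bilinear_integral_tendsto[OF bounded_bilinear.flip[OF bounded_bilinear_scaleR] sm(1) s(1) _ \<eta>(2)])
         (unfold M_def, intro test_fun_sqint(1)[OF _ \<Omega>] test_fun_partial \<psi>)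
    moreover have "(\<lambda>k. LINT x|M. \<psi> x *\<^sub>R partial i (\<eta> k) x) \<longlonglongrightarrow> (LINT x|M. \<psi> x *\<^sub>R g i x)"
      by (rule bilinear_integral_tendsto[OF bounded_bilinear.flip[OF bounded_bilinear_scaleR] sm(2) s(2) _ \<eta>(3)])
         (unfold M_def, intro test_fun_sqint(1)[OF _ \<Omega>] \<psi>)
    then have "(\<lambda>k. - (LINT x|M. \<psi> x *\<^sub>R partial i (\<eta> k) x)) \<longlonglongrightarrow> - (LINT x|M. \<psi> x *\<^sub>R g i x)"
      by (rule tendsto_minus)
    moreover have "(LINT x|M. partial i \<psi> x *\<^sub>R \<eta> k x) = - (LINT x|M. \<psi> x *\<^sub>R partial i (\<eta> k) x)" for k
      using has_weak_partial_test_fun[OF \<Omega> \<eta>(1)] \<psi> by (simp add: has_weak_partial_def M_def)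
    ultimately show ?thesis using LIMSEQ_unique by simp
  qed
  then show ?thesis
    using sqint_loc_integrable[OF \<Omega> s(1)[unfolded M_def]] sqint_loc_integrable[OF \<Omega> s(2)[unfolded M_def]]
    by (simp add: has_weak_partial_def M_def)
qed

lemma grad_in_W120_bounded_linear:
  fixes T :: "'b::euclidean_space \<Rightarrow> 'c::euclidean_space" and \<Omega> :: "(real ^ 'd) set"
  assumes \<Omega>: "\<Omega> \<in> sets lebesgue" and T: "bounded_linear T" and v: "grad_in_W120 \<Omega> v g"
  shows "grad_in_W120 \<Omega> (\<lambda>x. T (v x)) (\<lambda>i x. T (g i x))"
proof -
  define M where "M = lebesgue_on \<Omega>"
  obtain \<eta> where s: "sqint M v" "\<And>i. sqint M (g i)" and \<eta>: "\<And>k::nat. \<eta> k \<in> test_fun \<Omega>"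
    "(\<lambda>k. nsq M (\<lambda>x. \<eta> k x - v x)) \<longlonglongrightarrow> 0" "\<And>i. (\<lambda>k. nsq M (\<lambda>x. partial i (\<eta> k) x - g i x)) \<longlonglongrightarrow> 0"
    using v unfolding grad_in_W120_def M_def by blast
  have sm: "sqint M (\<eta> k)" "sqint M (partial i (\<eta> k))" for i k
    unfolding M_def by (intro test_fun_sqint(1)[OF _ \<Omega>] test_fun_partial \<eta>(1))+
  have p: "partial i (\<lambda>x. T (\<eta> k x)) x = T (partial i (\<eta> k) x)" for i k x
    by (rule partial_bounded_linear[OF T smooth_differentiable[OF test_fun_smooth[OF \<eta>(1)]]])
  have "(\<lambda>k. nsq M (\<lambda>x. T (\<eta> k x) - T (v x))) \<longlonglongrightarrow> 0"
    by (rule nsq_bounded_linear_tendsto[OF T sm(1) s(1) \<eta>(2)])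
  moreover have "(\<lambda>k. nsq M (\<lambda>x. partial i (\<lambda>x. T (\<eta> k x)) x - T (g i x))) \<longlonglongrightarrow> 0" for i
    unfolding p by (rule nsq_bounded_linear_tendsto[OF T sm(2) s(2) \<eta>(3)])
  moreover have "(\<lambda>x. T (\<eta> k x)) \<in> test_fun \<Omega>" for k by (rule test_fun_bounded_linear[OF T \<eta>(1)])
  ultimately show ?thesis
    using sqint_bounded_linear[OF T s(1)] sqint_bounded_linear[OF T s(2)]
    unfolding grad_in_W120_def M_def[symmetric] by (intro conjI allI exI[of _ "\<lambda>k x. T (\<eta> k x)"]) auto
qed

lemma nsq_add_tendsto_0:
  assumes "\<And>k. sqint M (a k)" "\<And>k. sqint M (b k)"
    and "(\<lambda>k. nsq M (a k)) \<longlonglongrightarrow> 0" "(\<lambda>k. nsq M (b k)) \<longlonglongrightarrow> 0"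
  shows "(\<lambda>k. nsq M (\<lambda>x. a k x + b k x)) \<longlonglongrightarrow> 0"
proof (rule Lim_null_comparison[OF always_eventually[OF allI]])
  show "norm (nsq M (\<lambda>x. a k x + b k x)) \<le> 2 * nsq M (a k) + 2 * nsq M (b k)" for k
    using sqint_add(2)[OF assms(1,2)] by simp
  have "(\<lambda>k. 2 * nsq M (a k) + 2 * nsq M (b k)) \<longlonglongrightarrow> 2 * 0 + 2 * 0"
    by (intro tendsto_intros assms)
  then show "(\<lambda>k. 2 * nsq M (a k) + 2 * nsq M (b k)) \<longlonglongrightarrow> 0" by simp
qed

lemma grad_in_W120_add:
  fixes v v' :: "real ^ 'd \<Rightarrow> 'b::euclidean_space"
  assumes \<Omega>: "\<Omega> \<in> sets lebesgue" and v: "grad_in_W120 \<Omega> v g" and v': "grad_in_W120 \<Omega> v' g'"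
  shows "grad_in_W120 \<Omega> (\<lambda>x. v x + v' x) (\<lambda>i x. g i x + g' i x)"
proof -
  define M where "M = lebesgue_on \<Omega>"
  obtain \<eta> where s: "sqint M v" "\<And>i. sqint M (g i)" and \<eta>: "\<And>k::nat. \<eta> k \<in> test_fun \<Omega>"
    "(\<lambda>k. nsq M (\<lambda>x. \<eta> k x - v x)) \<longlonglongrightarrow> 0" "\<And>i. (\<lambda>k. nsq M (\<lambda>x. partial i (\<eta> k) x - g i x)) \<longlonglongrightarrow> 0"
    using v unfolding grad_in_W120_def M_def by blast
  obtain \<eta>' where s': "sqint M v'" "\<And>i. sqint M (g' i)" and \<eta>': "\<And>k::nat. \<eta>' k \<in> test_fun \<Omega>"
    "(\<lambda>k. nsq M (\<lambda>x. \<eta>' k x - v' x)) \<longlonglongrightarrow> 0" "\<And>i. (\<lambda>k. nsq M (\<lambda>x. partial i (\<eta>' k) x - g' i x)) \<longlonglongrightarrow> 0"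
    using v' unfolding grad_in_W120_def M_def by blast
  have sm: "sqint M (\<eta> k)" "sqint M (partial i (\<eta> k))" "sqint M (\<eta>' k)" "sqint M (partial i (\<eta>' k))" for i k
    unfolding M_def by (intro test_fun_sqint(1)[OF _ \<Omega>] test_fun_partial \<eta>(1) \<eta>'(1))+
  have p: "partial i (\<lambda>x. \<eta> k x + \<eta>' k x) x = partial i (\<eta> k) x + partial i (\<eta>' k) x" for i k x
    by (rule partial_add[OF smooth_differentiable[OF test_fun_smooth[OF \<eta>(1)]]
          smooth_differentiable[OF test_fun_smooth[OF \<eta>'(1)]]])
  have r: "a + b - (c + d) = (a - c) + (b - d)" for a b c d :: 'b by simp
  have "(\<lambda>k. nsq M (\<lambda>x. \<eta> k x + \<eta>' k x - (v x + v' x))) \<longlonglongrightarrow> 0"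
    unfolding r by (intro nsq_add_tendsto_0 sqint_diff sm s s' \<eta>(2) \<eta>'(2))
  moreover have "(\<lambda>k. nsq M (\<lambda>x. partial i (\<lambda>x. \<eta> k x + \<eta>' k x) x - (g i x + g' i x))) \<longlonglongrightarrow> 0" for i
    unfolding p r by (intro nsq_add_tendsto_0 sqint_diff sm s s' \<eta>(3) \<eta>'(3))
  ultimately show ?thesis
    using sqint_add(1)[OF s(1) s'(1)] sqint_add(1)[OF s(2) s'(2)] test_fun_add[OF \<eta>(1) \<eta>'(1)]
    unfolding grad_in_W120_def M_def[symmetric] by (intro conjI allI exI[of _ "\<lambda>k x. \<eta> k x + \<eta>' k x"]) auto
qed

text \<open>Diagonal argument. There are finitely many directions, so a single test function
  approximates \<open>u k\<close> and all the \<open>G k i\<close> up to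
  \<open>1 / (k + 1)\<close>.\<close>

lemma grad_in_W120_closed:
  fixes v :: "real ^ 'd \<Rightarrow> 'b::euclidean_space"
  assumes \<Omega>: "\<Omega> \<in> sets lebesgue" and u: "\<And>k::nat. grad_in_W120 \<Omega> (u k) (G k)"
    and v: "sqint (lebesgue_on \<Omega>) v" "\<And>i. sqint (lebesgue_on \<Omega>) (g i)"
    and lim: "(\<lambda>k. nsq (lebesgue_on \<Omega>) (\<lambda>x. u k x - v x)) \<longlonglongrightarrow> 0"
      "\<And>i. (\<lambda>k. nsq (lebesgue_on \<Omega>) (\<lambda>x. G k i x - g i x)) \<longlonglongrightarrow> 0"
  shows "grad_in_W120 \<Omega> v g"
proof -
  define M where "M = lebesgue_on \<Omega>"
  have su: "sqint M (u k)" "sqint M (G k i)" for k i using u by (auto simp: grad_in_W120_def M_def)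
  have "\<exists>\<eta> \<in> test_fun \<Omega>. nsq M (\<lambda>x. \<eta> x - u k x) < inverse (Suc k) \<and>
      (\<forall>i\<in>UNIV. nsq M (\<lambda>x. partial i \<eta> x - G k i x) < inverse (Suc k))" for k
  proof -
    obtain \<eta> where \<eta>: "\<And>j::nat. \<eta> j \<in> test_fun \<Omega>"
      "(\<lambda>j. nsq M (\<lambda>x. \<eta> j x - u k x)) \<longlonglongrightarrow> 0" "\<And>i. (\<lambda>j. nsq M (\<lambda>x. partial i (\<eta> j) x - G k i x)) \<longlonglongrightarrow> 0"
      using u[of k] unfolding grad_in_W120_def M_def by blast
    have pos: "0 < inverse (real (Suc k))" by simp
    have "\<forall>\<^sub>F j in sequentially. nsq M (\<lambda>x. \<eta> j x - u k x) < inverse (Suc k) \<and>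
      (\<forall>i\<in>UNIV. nsq M (\<lambda>x. partial i (\<eta> j) x - G k i x) < inverse (Suc k))"
      by (intro eventually_conj eventually_ball_finite ballI finite_class.finite_UNIV
          order_tendstoD(2)[OF \<eta>(2) pos] order_tendstoD(2)[OF \<eta>(3) pos])
    from eventually_happens'[OF sequentially_bot this]
    obtain j where "nsq M (\<lambda>x. \<eta> j x - u k x) < inverse (Suc k) \<and>
      (\<forall>i\<in>UNIV. nsq M (\<lambda>x. partial i (\<eta> j) x - G k i x) < inverse (Suc k))"
      by blast
    then show ?thesis using \<eta>(1) by blast
  qed
  then obtain \<eta> where \<eta>: "\<And>k. \<eta> k \<in> test_fun \<Omega>" "\<And>k. nsq M (\<lambda>x. \<eta> k x - u k x) < inverse (Suc k)"
      "\<And>k i. nsq M (\<lambda>x. partial i (\<eta> k) x - G k i x) < inverse (Suc k)"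
    by (metis UNIV_I)
  have sm: "sqint M (\<eta> k)" "sqint M (partial i (\<eta> k))" for i k
    unfolding M_def by (intro test_fun_sqint(1)[OF _ \<Omega>] test_fun_partial \<eta>(1))+
  have sv: "sqint M v" "sqint M (g i)" for i using v by (auto simp: M_def)
  have diag: "(\<lambda>k. nsq M (\<lambda>x. a k x - c x)) \<longlonglongrightarrow> 0"
    if "\<And>k. sqint M (a k)" "\<And>k. sqint M (b k)" "sqint M c" "\<And>k. nsq M (\<lambda>x. a k x - b k x) < inverse (Suc k)"
      "(\<lambda>k. nsq M (\<lambda>x. b k x - c x)) \<longlonglongrightarrow> 0" for a b and c :: "real ^ 'd \<Rightarrow> 'b"
  proof -
    have "(\<lambda>k. nsq M (\<lambda>x. a k x - b k x)) \<longlonglongrightarrow> 0"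
      by (rule Lim_null_comparison[OF always_eventually[OF allI] LIMSEQ_inverse_real_of_nat])
         (use that(4) less_imp_le in auto)
    from nsq_add_tendsto_0[OF sqint_diff[OF that(1,2)] sqint_diff[OF that(2,3)] this that(5)]
    show ?thesis by simp
  qed
  have "(\<lambda>k. nsq M (\<lambda>x. \<eta> k x - v x)) \<longlonglongrightarrow> 0"
    by (rule diag[OF sm(1) su(1) sv(1) \<eta>(2)]) (use lim in \<open>simp add: M_def\<close>)
  moreover have "(\<lambda>k. nsq M (\<lambda>x. partial i (\<eta> k) x - g i x)) \<longlonglongrightarrow> 0" for i
    by (rule diag[OF sm(2) su(2) sv(2) \<eta>(3)]) (use lim in \<open>simp add: M_def\<close>)
  ultimately show ?thesis
    using \<eta>(1) v unfolding grad_in_W120_def M_def by blast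
qed

lemma Lp_norm_2: "(Lp_norm \<Omega> 2 f)\<^sup>2 = nsq (lebesgue_on \<Omega>) f"
  by (simp add: Lp_norm_def nsq_def powr_half_sqrt)

lemma W12_norm_eq: "W12_norm \<Omega> u = sqrt (nsq (lebesgue_on \<Omega>) u + (\<Sum>i\<in>UNIV. nsq (lebesgue_on \<Omega>) (wpartial \<Omega> i u)))"
  by (simp add: W12_norm_def Lp_norm_2)

lemma nsq_AE_cong:
  assumes "AE x in M. f x = g x" "f \<in> borel_measurable M" "g \<in> borel_measurable M"
  shows "nsq M f = nsq M g"
  unfolding nsq_def using assms by (intro integral_cong_AE) auto

lemma wpartial_sqint:
  fixes g :: "real ^ 'd \<Rightarrow> 'b::euclidean_space"
  assumes "open \<Omega>" "has_weak_partial \<Omega> i u g" "sqint (lebesgue_on \<Omega>) g"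
  shows "sqint (lebesgue_on \<Omega>) (wpartial \<Omega> i u)"
proof -
  have ae: "AE x in lebesgue_on \<Omega>. wpartial \<Omega> i u x = g x" by (rule wpartial_AE[OF assms(1,2)])
  have "wpartial \<Omega> i u \<in> borel_measurable (lebesgue_on \<Omega>)"
    by (rule measurable_lebesgue_on_AE_cong[OF _ ae sqint_measurable[OF assms(3)]]) (use assms(1) in simp)
  moreover have "AE x in lebesgue_on \<Omega>. g x = wpartial \<Omega> i u x"
    using ae by eventually_elim simp
  ultimately show ?thesis using sqint_AE_cong[OF _ assms(3)] by blast
qed

lemma W12_D:
  fixes u :: "real ^ 'd \<Rightarrow> 'b::euclidean_space"
  assumes "open \<Omega>" "u \<in> W12 \<Omega>"
  shows "sqint (lebesgue_on \<Omega>) u" "sqint (lebesgue_on \<Omega>) (wpartial \<Omega> i u)" "has_weak_partial \<Omega> i u (wpartial \<Omega> i u)"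
proof -
  show "sqint (lebesgue_on \<Omega>) u" using assms(2) by (simp add: W12_def L2_iff_sqint)
  obtain g where g: "sqint (lebesgue_on \<Omega>) g" "has_weak_partial \<Omega> i u g"
    using assms(2) unfolding W12_def L2_iff_sqint[symmetric] by blast
  show "sqint (lebesgue_on \<Omega>) (wpartial \<Omega> i u)" by (rule wpartial_sqint[OF assms(1) g(2,1)])
  show "has_weak_partial \<Omega> i u (wpartial \<Omega> i u)"
    unfolding wpartial_def by (rule someI[of "has_weak_partial \<Omega> i u", OF g(2)])
qed

text \<open>Together with \<open>W12_0_I\<close> this translates between \<open>W12_0\<close>, whose
  norm involves chosen representatives of the derivatives of \<open>u - \<eta> k\<close>, and the
  representative-free \<open>grad_in_W120\<close>.\<close>

lemma W12_0_D:
  fixes u :: "real ^ 'd \<Rightarrow> 'b::euclidean_space"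
  assumes \<Omega>: "open \<Omega>" and u: "u \<in> W12_0 \<Omega>"
  shows "grad_in_W120 \<Omega> u (\<lambda>i. wpartial \<Omega> i u)"
proof -
  define M where "M = lebesgue_on \<Omega>"
  have s\<Omega>: "\<Omega> \<in> sets lebesgue" using \<Omega> by simp
  have uW: "u \<in> W12 \<Omega>" using u by (simp add: W12_0_def)
  note U = W12_D[OF \<Omega> uW, folded M_def]
  obtain \<eta> where \<eta>: "\<And>k::nat. \<eta> k \<in> test_fun \<Omega>" "(\<lambda>k. W12_norm \<Omega> (\<lambda>x. u x - \<eta> k x)) \<longlonglongrightarrow> 0"
    using u unfolding W12_0_def by blast
  have sm: "sqint M (\<eta> k)" "sqint M (partial i (\<eta> k))" for i k
    unfolding M_def by (intro test_fun_sqint(1)[OF _ s\<Omega>] test_fun_partial \<eta>(1))+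
  \<comment> \<open>Linearity of \<open>wpartial\<close> holds only up to null sets, so a weak
    derivative of \<open>u - \<eta> k\<close> is exhibited first and then compared.\<close>
  have w: "nsq M (wpartial \<Omega> i (\<lambda>x. u x - \<eta> k x)) = nsq M (\<lambda>x. partial i (\<eta> k) x - wpartial \<Omega> i u x)" for i k
  proof -
    have "has_weak_partial \<Omega> i (\<lambda>x. u x + - \<eta> k x) (\<lambda>x. wpartial \<Omega> i u x + - partial i (\<eta> k) x)"
      by (intro has_weak_partial_add[OF s\<Omega>] U has_weak_partial_bounded_linear[OF s\<Omega>, where T = uminus]
          has_weak_partial_test_fun[OF s\<Omega>] \<eta> bounded_linear_minus[OF bounded_linear_ident])
    then have h: "has_weak_partial \<Omega> i (\<lambda>x. u x - \<eta> k x) (\<lambda>x. wpartial \<Omega> i u x - partial i (\<eta> k) x)" by simp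
    have s: "sqint M (\<lambda>x. wpartial \<Omega> i u x - partial i (\<eta> k) x)" by (intro sqint_diff U sm)
    have "nsq M (wpartial \<Omega> i (\<lambda>x. u x - \<eta> k x)) = nsq M (\<lambda>x. wpartial \<Omega> i u x - partial i (\<eta> k) x)"
      using nsq_AE_cong[OF wpartial_AE[OF \<Omega> h] sqint_measurable[OF wpartial_sqint[OF \<Omega> h]]
          sqint_measurable] s unfolding M_def by blast
    then show ?thesis by (rule trans[OF _ nsq_minus_commute])
  qed
  have sq: "(\<lambda>k. (W12_norm \<Omega> (\<lambda>x. u x - \<eta> k x))\<^sup>2) \<longlonglongrightarrow> 0"
    using tendsto_power[OF \<eta>(2), of 2] by simp
  have eq: "(W12_norm \<Omega> (\<lambda>x. u x - \<eta> k x))\<^sup>2 = nsq M (\<lambda>x. \<eta> k x - u x)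
      + (\<Sum>i\<in>UNIV. nsq M (\<lambda>x. partial i (\<eta> k) x - wpartial \<Omega> i u x))" for k
    unfolding W12_norm_eq M_def[symmetric] w
    by (subst real_sqrt_pow2) (simp_all add: sum_nonneg nsq_minus_commute[of M u])
  have "(\<lambda>k. nsq M (\<lambda>x. \<eta> k x - u x)) \<longlonglongrightarrow> 0"
    by (rule Lim_null_comparison[OF always_eventually[OF allI] sq]) (simp add: eq sum_nonneg)
  moreover have "(\<lambda>k. nsq M (\<lambda>x. partial i (\<eta> k) x - wpartial \<Omega> i u x)) \<longlonglongrightarrow> 0" for i
  proof (rule Lim_null_comparison[OF always_eventually[OF allI] sq])
    fix k
    have "nsq M (\<lambda>x. partial i (\<eta> k) x - wpartial \<Omega> i u x) \<le> (\<Sum>i\<in>UNIV. nsq M (\<lambda>x. partial i (\<eta> k) x - wpartial \<Omega> i u x))"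
      by (rule member_le_sum) auto
    then show "norm (nsq M (\<lambda>x. partial i (\<eta> k) x - wpartial \<Omega> i u x)) \<le> (W12_norm \<Omega> (\<lambda>x. u x - \<eta> k x))\<^sup>2"
      unfolding eq by (simp add: add_increasing)
  qed
  ultimately show ?thesis
    using U \<eta>(1) unfolding grad_in_W120_def M_def[symmetric] by blast
qed

lemma W12_0_I:
  fixes u :: "real ^ 'd \<Rightarrow> 'b::euclidean_space"
  assumes \<Omega>: "open \<Omega>" and u: "grad_in_W120 \<Omega> u g"
  shows "u \<in> W12_0 \<Omega>"
proof -
  define M where "M = lebesgue_on \<Omega>"
  have s\<Omega>: "\<Omega> \<in> sets lebesgue" using \<Omega> by simp
  obtain \<eta> where s: "sqint M u" "\<And>i. sqint M (g i)" and \<eta>: "\<And>k::nat. \<eta> k \<in> test_fun \<Omega>"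
    "(\<lambda>k. nsq M (\<lambda>x. \<eta> k x - u x)) \<longlonglongrightarrow> 0" "\<And>i. (\<lambda>k. nsq M (\<lambda>x. partial i (\<eta> k) x - g i x)) \<longlonglongrightarrow> 0"
    using u unfolding grad_in_W120_def M_def by blast
  note hu = grad_in_W120_has_weak_partial[OF s\<Omega> u]
  have sm: "sqint M (\<eta> k)" "sqint M (partial i (\<eta> k))" for i k
    unfolding M_def by (intro test_fun_sqint(1)[OF _ s\<Omega>] test_fun_partial \<eta>(1))+
  have uW: "u \<in> W12 \<Omega>"
    using s hu unfolding W12_def L2_iff_sqint[symmetric] M_def by blast
  have w: "nsq M (wpartial \<Omega> i (\<lambda>x. u x - \<eta> k x)) = nsq M (\<lambda>x. partial i (\<eta> k) x - g i x)" for i k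
  proof -
    have "has_weak_partial \<Omega> i (\<lambda>x. u x + - \<eta> k x) (\<lambda>x. g i x + - partial i (\<eta> k) x)"
      by (intro has_weak_partial_add[OF s\<Omega>] hu has_weak_partial_bounded_linear[OF s\<Omega>, where T = uminus]
          has_weak_partial_test_fun[OF s\<Omega>] \<eta> bounded_linear_minus[OF bounded_linear_ident])
    then have h: "has_weak_partial \<Omega> i (\<lambda>x. u x - \<eta> k x) (\<lambda>x. g i x - partial i (\<eta> k) x)" by simp
    have s': "sqint M (\<lambda>x. g i x - partial i (\<eta> k) x)" by (intro sqint_diff s sm)
    have "nsq M (wpartial \<Omega> i (\<lambda>x. u x - \<eta> k x)) = nsq M (\<lambda>x. g i x - partial i (\<eta> k) x)"
      using nsq_AE_cong[OF wpartial_AE[OF \<Omega> h] sqint_measurable[OF wpartial_sqint[OF \<Omega> h]]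
          sqint_measurable] s' unfolding M_def by blast
    then show ?thesis by (rule trans[OF _ nsq_minus_commute])
  qed
  have eq: "W12_norm \<Omega> (\<lambda>x. u x - \<eta> k x) = sqrt (nsq M (\<lambda>x. \<eta> k x - u x)
      + (\<Sum>i\<in>UNIV. nsq M (\<lambda>x. partial i (\<eta> k) x - g i x)))" for k
    unfolding W12_norm_eq M_def[symmetric] w by (simp add: nsq_minus_commute[of M u])
  have "(\<lambda>k. sqrt (nsq M (\<lambda>x. \<eta> k x - u x) + (\<Sum>i\<in>UNIV. nsq M (\<lambda>x. partial i (\<eta> k) x - g i x))))
      \<longlonglongrightarrow> sqrt (0 + (\<Sum>i\<in>(UNIV::'d set). 0))"
    by (intro tendsto_intros \<eta>)
  then show ?thesis using \<eta>(1) uW unfolding W12_0_def eq[symmetric] by (intro CollectI conjI exI[of _ \<eta>]) simp_all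
qed

section \<open>Helmholtz decomposition\<close>

lemma bounded_linear_vec_map:
  fixes \<tau> :: "'a::euclidean_space \<Rightarrow> 'b::euclidean_space"
  assumes "bounded_linear \<tau>"
  shows "bounded_linear (\<lambda>x::'a ^ 'n. \<chi> j. \<tau> (x $ j))"
  using bounded_linear.linear[OF assms]
  by (intro linear_conv_bounded_linear[THEN iffD1] linearI)
     (simp_all add: vec_eq_iff linear_add linear_scale)

lemma sqint_sum: "(\<And>i. i \<in> I \<Longrightarrow> sqint M (f i)) \<Longrightarrow> sqint M (\<lambda>x. \<Sum>i\<in>I. f i x)"
  by (induction I rule: infinite_finite_induct) (auto intro: sqint_add(1))

lemma sqint_vec:
  fixes h :: "'n::finite \<Rightarrow> 'a \<Rightarrow> 'b::euclidean_space"
  assumes "\<And>i. sqint M (h i)"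
  shows "sqint M (\<lambda>x. \<chi> i. h i x)"
proof -
  have bl: "bounded_linear (axis i :: 'b \<Rightarrow> 'b ^ 'n)" for i
    by (intro linear_conv_bounded_linear[THEN iffD1] linearI) (simp_all add: vec_eq_iff axis_def)
  have eq: "(\<lambda>x. \<chi> i. h i x) = (\<lambda>x. \<Sum>i\<in>UNIV. axis i (h i x))"
    by (auto simp: vec_eq_iff axis_def if_distrib cong: if_cong)
  show ?thesis unfolding eq
    by (intro sqint_sum sqint_bounded_linear[OF bl] assms)
qed

lemma bounded_bilinear_cdot: "bounded_bilinear cdot"
  by (intro bilinear_conv_bounded_bilinear[THEN iffD1])
     (auto simp: bilinear_def linear_iff cdot_def algebra_simps sum.distrib scaleR_sum_right)

text \<open>The inner product behind \<open>ip\<close> is real, while the weak formulations use the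
  complex bilinear \<open>cdot\<close>. Testing with the conjugate of a field recovers the real part
  of a complex identity, and with \<open>\<i>\<close> times the conjugate its imaginary
  part.\<close>

lemma inner_cnj_eq_Re_cdot: "a \<bullet> (\<chi> j. cnj (b $ j)) = Re (cdot a b)"
  by (simp add: inner_vec_def inner_complex_def cdot_def)

lemma inner_ii_cnj_eq_Im_cdot: "a \<bullet> (\<chi> j. \<i> * cnj (b $ j)) = Im (cdot a b)"
  by (simp add: inner_vec_def inner_complex_def cdot_def)

proposition orthogonal_divfree_imp_gradient_real:
  fixes \<Omega> :: "(real ^ 'd) set" and f :: "real ^ 'd \<Rightarrow> real ^ 'd"
  assumes \<Omega>: "bounded_lipschitz_domain \<Omega>" and f: "sqint (lebesgue_on \<Omega>) f"
    and orth: "\<And>v. v \<in> test_fun \<Omega> \<Longrightarrow> (\<And>x. divg v x = 0) \<Longrightarrow> ip (lebesgue_on \<Omega>) f v = 0"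
  obtains q where "sqint (lebesgue_on \<Omega>) q" "\<And>i. has_weak_partial \<Omega> i q (\<lambda>x. f x $ i)"
proof -
  define M where "M = lebesgue_on \<Omega>"
  have o: "open \<Omega>" using \<Omega> by (simp add: bounded_lipschitz_domain_def)
  have s\<Omega>: "\<Omega> \<in> sets lebesgue" using o by simp
  have sf: "sqint M f" using f by (simp add: M_def)
  have st: "sqint M \<Psi>" if "\<Psi> \<in> test_fun \<Omega>" for \<Psi> :: "real ^ 'd \<Rightarrow> real ^ 'd"
    unfolding M_def by (rule test_fun_sqint(1)[OF that s\<Omega>])
  have d: "\<Psi> differentiable (at x)" if "\<Psi> \<in> test_fun \<Omega>" for \<Psi> :: "real ^ 'd \<Rightarrow> real ^ 'd" and x
    using that test_fun_smooth smooth_differentiable by blast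
  obtain C where C: "\<And>\<Psi>. \<Psi> \<in> test_fun \<Omega> \<Longrightarrow> \<exists>\<Phi> \<in> test_fun \<Omega>. (\<forall>x. divg \<Phi> x = divg \<Psi> x) \<and>
      nsq lborel \<Phi> \<le> C * nsq lborel (divg \<Psi> :: real ^ 'd \<Rightarrow> real)"
    by (rule divergence_right_inverse_bound[OF \<Omega>]) (rule that)
  have wd: "ip M f \<Psi> = ip M f \<Phi>" if \<Psi>: "\<Psi> \<in> test_fun \<Omega>" and \<Phi>: "\<Phi> \<in> test_fun \<Omega>"
    and e: "\<And>x. divg \<Phi> x = divg \<Psi> x" for \<Psi> \<Phi>
  proof -
    have n: "(\<lambda>x. - 1 *\<^sub>R \<Phi> x) \<in> test_fun \<Omega>" by (rule test_fun_scaleR[OF \<Phi>])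
    have "divg (\<lambda>x. \<Psi> x + (- 1 *\<^sub>R \<Phi> x)) x = 0" for x
      unfolding divg_add[OF d[OF \<Psi>] d[OF n]] divg_scaleR[OF d[OF \<Phi>]] by (simp add: e)
    from orth[OF test_fun_add[OF \<Psi> n] this]
    have "ip M f (\<lambda>x. \<Psi> x + (- 1 *\<^sub>R \<Phi> x)) = 0" by (simp add: M_def)
    then show ?thesis
      using ip_diff_left[OF st[OF \<Psi>] st[OF \<Phi>] sf] by (simp add: ip_commute[of M f])
  qed
  define S :: "(real ^ 'd \<Rightarrow> real) set" where "S = divg ` test_fun \<Omega>"
  \<comment> \<open>By \<open>wd\<close> the value does not depend on the chosen preimage; this is
    where orthogonality to divergence-free fields is used. The sign is that of integration by
    parts.\<close>
  define L :: "(real ^ 'd \<Rightarrow> real) \<Rightarrow> real" where "L h = - ip M f (SOME \<Psi>. \<Psi> \<in> test_fun \<Omega> \<and> divg \<Psi> = h)" for h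
  have L: "L (divg \<Psi>) = - ip M f \<Psi>" if \<Psi>: "\<Psi> \<in> test_fun \<Omega>" for \<Psi>
  proof -
    define \<Phi> where "\<Phi> = (SOME \<Phi>. \<Phi> \<in> test_fun \<Omega> \<and> divg \<Phi> = divg \<Psi>)"
    have "\<Phi> \<in> test_fun \<Omega> \<and> divg \<Phi> = divg \<Psi>"
      unfolding \<Phi>_def by (rule someI[of _ \<Psi>]) (simp add: \<Psi>)
    then have "ip M f \<Psi> = ip M f \<Phi>" by (intro wd[OF \<Psi>]) simp_all
    then show ?thesis by (simp add: L_def \<Phi>_def)
  qed
  have add: "(\<lambda>x. divg \<Psi> x + divg \<Phi> x) = divg (\<lambda>x. \<Psi> x + \<Phi> x)"
    if "\<Psi> \<in> test_fun \<Omega>" "\<Phi> \<in> test_fun \<Omega>" for \<Psi> \<Phi> :: "real ^ 'd \<Rightarrow> real ^ 'd"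
    using divg_add[OF d[OF that(1)] d[OF that(2)]] by auto
  have scale: "(\<lambda>x. c *\<^sub>R divg \<Psi> x) = divg (\<lambda>x. c *\<^sub>R \<Psi> x)"
    if "\<Psi> \<in> test_fun \<Omega>" for \<Psi> :: "real ^ 'd \<Rightarrow> real ^ 'd" and c
    using divg_scaleR[OF d[OF that], of c] by auto
  obtain p where p: "sqint M p" "\<And>h. h \<in> S \<Longrightarrow> ip M p h = L h"
  proof (rule sqint_riesz[of S M L "nsq M f * \<bar>C\<bar>"])
    show "sqint M h" if "h \<in> S" for h
      using that unfolding M_def S_def by (auto intro: test_fun_sqint(1)[OF divg_test_fun s\<Omega>])
    show "S \<noteq> {}" unfolding S_def using test_fun_zero by blast
    show "(\<lambda>x. u x + v x) \<in> S" if "u \<in> S" "v \<in> S" for u v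
      using that unfolding S_def by (auto simp: add intro: test_fun_add)
    show "(\<lambda>x. c *\<^sub>R v x) \<in> S" if vS: "v \<in> S" for c v
    proof -
      obtain \<Psi> where P: "\<Psi> \<in> test_fun \<Omega>" "v = divg \<Psi>" using vS unfolding S_def by blast
      show ?thesis unfolding P(2) scale[OF P(1)] S_def using test_fun_scaleR[OF P(1)] by blast
    qed
    show "L (\<lambda>x. u x + v x) = L u + L v" if uv: "u \<in> S" "v \<in> S" for u v
    proof -
      obtain \<Psi> \<Phi> where P: "\<Psi> \<in> test_fun \<Omega>" "\<Phi> \<in> test_fun \<Omega>" "u = divg \<Psi>" "v = divg \<Phi>"
        using uv unfolding S_def by blast
      have "ip M f (\<lambda>x. \<Psi> x + \<Phi> x) = ip M f \<Psi> + ip M f \<Phi>"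
        using ip_add_left[OF st[OF P(1)] st[OF P(2)] sf] by (simp add: ip_commute[of M f])
      then show ?thesis unfolding P(3,4) add[OF P(1,2)] L[OF P(1)] L[OF P(2)] L[OF test_fun_add[OF P(1,2)]] by simp
    qed
    show "L (\<lambda>x. c *\<^sub>R v x) = c * L v" if vS: "v \<in> S" for c v
    proof -
      obtain \<Psi> where P: "\<Psi> \<in> test_fun \<Omega>" "v = divg \<Psi>" using vS unfolding S_def by blast
      show ?thesis unfolding P(2) scale[OF P(1)] L[OF P(1)] L[OF test_fun_scaleR[OF P(1)]]
        by (simp add: ip_scaleR_right)
    qed
    show "(L v)\<^sup>2 \<le> nsq M f * \<bar>C\<bar> * nsq M v" if vS: "v \<in> S" for v
    proof -
      obtain \<Psi> where P: "\<Psi> \<in> test_fun \<Omega>" "v = divg \<Psi>" using vS unfolding S_def by blast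
      \<comment> \<open>The field \<open>\<Psi>\<close> may be arbitrarily large compared with its
        divergence; by \<open>wd\<close> it can be replaced by the controlled preimage
        \<open>\<Phi>\<close>.\<close>
      obtain \<Phi> where \<Phi>: "\<Phi> \<in> test_fun \<Omega>" "\<And>x. divg \<Phi> x = divg \<Psi> x" "nsq lborel \<Phi> \<le> C * nsq lborel (divg \<Psi>)"
        using C[OF P(1)] by blast
      have n: "nsq M \<Phi> = nsq lborel \<Phi>" "nsq M v = nsq lborel (divg \<Psi>)"
        unfolding M_def P(2) by (rule test_fun_sqint(2)[OF _ s\<Omega>], intro \<Phi> divg_test_fun P)+
      have "(L v)\<^sup>2 = (ip M f \<Phi>)\<^sup>2"
        unfolding P(2) L[OF P(1)] using wd[OF P(1) \<Phi>(1) \<Phi>(2)] by simp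
      also have "\<dots> \<le> nsq M f * nsq M \<Phi>" by (rule ip_sq_le[OF sf st[OF \<Phi>(1)]])
      also have "\<dots> \<le> nsq M f * (\<bar>C\<bar> * nsq M v)"
      proof (rule mult_left_mono)
        have "C * nsq M v \<le> \<bar>C\<bar> * nsq M v" by (intro mult_right_mono) auto
        then show "nsq M \<Phi> \<le> \<bar>C\<bar> * nsq M v" using \<Phi>(3) n by simp
      qed simp
      finally show ?thesis by (simp add: mult.assoc)
    qed
  qed (rule that)
  have "has_weak_partial \<Omega> i p (\<lambda>x. f x $ i)" for i
  proof -
    have "loc_integrable \<Omega> p" by (rule sqint_loc_integrable[OF s\<Omega> p(1)[unfolded M_def]])
    moreover have "loc_integrable \<Omega> (\<lambda>x. f x $ i)"
      by (rule sqint_loc_integrable[OF s\<Omega> sqint_bounded_linear[OF bounded_linear_vec_nth f]])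
    moreover have "(LINT x|M. partial i \<psi> x *\<^sub>R p x) = - (LINT x|M. \<psi> x *\<^sub>R (f x $ i))"
      if \<psi>: "\<psi> \<in> test_fun \<Omega>" for \<psi> :: "real ^ 'd \<Rightarrow> real"
    proof -
      \<comment> \<open>The divergence of this field is \<open>partial i \<psi>\<close>, so the
        Riesz identity for it is the definition of the weak derivative of \<open>p\<close>.\<close>
      define \<Psi> :: "real ^ 'd \<Rightarrow> real ^ 'd" where "\<Psi> = (\<lambda>x. \<psi> x *\<^sub>R axis i 1)"
      have \<Psi>: "\<Psi> \<in> test_fun \<Omega>" unfolding \<Psi>_def
        by (rule test_fun_bounded_linear[OF bounded_linear_scaleR_left \<psi>])
      have "partial j \<Psi> x = partial j \<psi> x *\<^sub>R axis i 1" for j x unfolding \<Psi>_def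
        by (rule partial_bounded_linear[OF bounded_linear_scaleR_left smooth_differentiable[OF test_fun_smooth[OF \<psi>]]])
      then have dv: "divg \<Psi> x = partial i \<psi> x" for x
        by (simp add: divg_def axis_def if_distrib cong: if_cong)
      have "(LINT x|M. partial i \<psi> x *\<^sub>R p x) = ip M p (divg \<Psi>)"
        by (simp add: ip_def dv mult.commute)
      also have "\<dots> = - ip M f \<Psi>" using p(2)[of "divg \<Psi>"] L[OF \<Psi>] \<Psi> by (simp add: S_def)
      also have "ip M f \<Psi> = (LINT x|M. \<psi> x *\<^sub>R (f x $ i))"
        by (simp add: ip_def \<Psi>_def inner_axis)
      finally show ?thesis .
    qed
    ultimately show ?thesis by (simp add: has_weak_partial_def M_def)
  qed
  then show ?thesis using that p(1) by (simp add: M_def)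
qed

section \<open>Solenoidal fields with zero boundary values\<close>

definition solenoidal :: "(real ^ 'd) set \<Rightarrow> (real ^ 'd \<Rightarrow> 'a::euclidean_space ^ 'd) \<Rightarrow> ('d \<Rightarrow> real ^ 'd \<Rightarrow> 'a ^ 'd) \<Rightarrow> bool" where
  "solenoidal \<Omega> v g \<longleftrightarrow> grad_in_W120 \<Omega> v g \<and> (AE x in lebesgue_on \<Omega>. (\<Sum>i\<in>UNIV. g i x $ i) = 0)"

lemma solenoidal_sqint:
  assumes "solenoidal \<Omega> v g"
  shows "sqint (lebesgue_on \<Omega>) v" "sqint (lebesgue_on \<Omega>) (g i)"
  using assms by (auto simp: solenoidal_def grad_in_W120_def)

text \<open>The divergence commutes with a linear map applied to all components. Instances are real
  scaling, the embeddings of real fields as real or imaginary ones, and conjugation with or without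
  a factor \<open>\<i>\<close>.\<close>

lemma solenoidal_map:
  fixes \<tau> :: "'a::euclidean_space \<Rightarrow> 'b::euclidean_space" and v :: "real ^ 'd \<Rightarrow> 'a ^ 'd"
  assumes \<Omega>: "\<Omega> \<in> sets lebesgue" and \<tau>: "bounded_linear \<tau>" and v: "solenoidal \<Omega> v g"
  shows "solenoidal \<Omega> (\<lambda>x. \<chi> j. \<tau> (v x $ j)) (\<lambda>i x. \<chi> j. \<tau> (g i x $ j))"
  unfolding solenoidal_def
proof
  show "grad_in_W120 \<Omega> (\<lambda>x. \<chi> j. \<tau> (v x $ j)) (\<lambda>i x. \<chi> j. \<tau> (g i x $ j))"
    using grad_in_W120_bounded_linear[OF \<Omega> bounded_linear_vec_map[OF \<tau>]] v unfolding solenoidal_def by blast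
  have "AE x in lebesgue_on \<Omega>. (\<Sum>i\<in>UNIV. g i x $ i) = 0" using v by (simp add: solenoidal_def)
  then show "AE x in lebesgue_on \<Omega>. (\<Sum>i\<in>UNIV. (\<chi> j. \<tau> (g i x $ j)) $ i) = 0"
  proof eventually_elim
    case (elim x)
    have "(\<Sum>i\<in>UNIV. (\<chi> j. \<tau> (g i x $ j)) $ i) = \<tau> (\<Sum>i\<in>UNIV. g i x $ i)"
      by (simp add: linear_sum[OF bounded_linear.linear[OF \<tau>]])
    then show ?case by (simp add: elim linear_0[OF bounded_linear.linear[OF \<tau>]])
  qed
qed

lemma solenoidal_test_fun:
  assumes "\<Omega> \<in> sets lebesgue" "v \<in> test_fun \<Omega>" "\<And>x. divg v x = 0"
  shows "solenoidal \<Omega> v (\<lambda>i. partial i v)"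
  using grad_in_W120_test_fun[OF assms(1,2)] assms(3) by (simp add: solenoidal_def divg_def)

lemma solenoidal_add:
  fixes v v' :: "real ^ 'd \<Rightarrow> 'a::euclidean_space ^ 'd"
  assumes \<Omega>: "\<Omega> \<in> sets lebesgue" and v: "solenoidal \<Omega> v g" and v': "solenoidal \<Omega> v' g'"
  shows "solenoidal \<Omega> (\<lambda>x. v x + v' x) (\<lambda>i x. g i x + g' i x)"
  unfolding solenoidal_def
proof
  show "grad_in_W120 \<Omega> (\<lambda>x. v x + v' x) (\<lambda>i x. g i x + g' i x)"
    using grad_in_W120_add[OF \<Omega>] v v' unfolding solenoidal_def by blast
  have "AE x in lebesgue_on \<Omega>. (\<Sum>i\<in>UNIV. g i x $ i) = 0" "AE x in lebesgue_on \<Omega>. (\<Sum>i\<in>UNIV. g' i x $ i) = 0"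
    using v v' by (auto simp: solenoidal_def)
  then show "AE x in lebesgue_on \<Omega>. (\<Sum>i\<in>UNIV. (g i x + g' i x) $ i) = 0"
    by eventually_elim (simp add: sum.distrib)
qed

lemma solenoidal_scaleR:
  fixes v :: "real ^ 'd \<Rightarrow> 'a::euclidean_space ^ 'd"
  assumes \<Omega>: "\<Omega> \<in> sets lebesgue" and v: "solenoidal \<Omega> v g"
  shows "solenoidal \<Omega> (\<lambda>x. c *\<^sub>R v x) (\<lambda>i x. c *\<^sub>R g i x)"
proof -
  have "(\<chi> j. c *\<^sub>R (y $ j)) = c *\<^sub>R y" for y :: "'a ^ 'd" by (simp add: vec_eq_iff)
  then show ?thesis using solenoidal_map[OF \<Omega> bounded_linear_scaleR_right v, of c] by simp
qed

lemma nsq_sum_tendsto_0: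
  assumes "finite I" "\<And>i k. i \<in> I \<Longrightarrow> sqint M (a i k)" "\<And>i. i \<in> I \<Longrightarrow> (\<lambda>k. nsq M (a i k)) \<longlonglongrightarrow> 0"
  shows "(\<lambda>k. nsq M (\<lambda>x. \<Sum>i\<in>I. a i k x)) \<longlonglongrightarrow> 0"
  using assms
proof (induction I rule: finite_induct)
  case empty
  then show ?case by (simp add: nsq_def)
next
  case (insert j I)
  have "(\<lambda>k. nsq M (\<lambda>x. a j k x + (\<Sum>i\<in>I. a i k x))) \<longlonglongrightarrow> 0"
    using insert by (intro nsq_add_tendsto_0 sqint_sum insert.IH) auto
  then show ?case using insert.hyps by simp
qed

text \<open>The pair of a field and its gradient is what converges, so closedness of
  \<open>grad_in_W120\<close> applies; the divergence is a finite sum of gradient components and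
  survives the L2 limit.\<close>

lemma solenoidal_closed:
  fixes v :: "real ^ 'd \<Rightarrow> 'a::euclidean_space ^ 'd"
  assumes \<Omega>: "\<Omega> \<in> sets lebesgue" and u: "\<And>k::nat. solenoidal \<Omega> (u k) (G k)"
    and v: "sqint (lebesgue_on \<Omega>) v" "\<And>i. sqint (lebesgue_on \<Omega>) (g i)"
    and lim: "(\<lambda>k. nsq (lebesgue_on \<Omega>) (\<lambda>x. u k x - v x)) \<longlonglongrightarrow> 0"
      "\<And>i. (\<lambda>k. nsq (lebesgue_on \<Omega>) (\<lambda>x. G k i x - g i x)) \<longlonglongrightarrow> 0"
  shows "solenoidal \<Omega> v g"
  unfolding solenoidal_def
proof
  define M where "M = lebesgue_on \<Omega>"
  have "\<And>k. grad_in_W120 \<Omega> (u k) (G k)" using u by (simp add: solenoidal_def)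
  then show "grad_in_W120 \<Omega> v g" by (rule grad_in_W120_closed[OF \<Omega> _ v lim])
  have sG: "sqint M (G k i)" for k i using solenoidal_sqint(2)[OF u] by (simp add: M_def)
  have sg: "sqint M (g i)" for i using v by (simp add: M_def)
  have sgi: "sqint M (\<lambda>x. g i x $ i)" for i by (rule sqint_bounded_linear[OF bounded_linear_vec_nth sg])
  have s: "sqint M (\<lambda>x. \<Sum>i\<in>UNIV. g i x $ i)" by (intro sqint_sum sgi)
  have sGi: "sqint M (\<lambda>x. G k i x $ i - g i x $ i)" for k i 
    by (intro sqint_diff sgi sqint_bounded_linear[OF bounded_linear_vec_nth sG])
  have "(\<lambda>k. nsq M (\<lambda>x. G k i x $ i - g i x $ i)) \<longlonglongrightarrow> 0" for i
    by (rule nsq_bounded_linear_tendsto[OF bounded_linear_vec_nth sG sg]) (use lim(2) in \<open>simp add: M_def\<close>)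
  then have "(\<lambda>k. nsq M (\<lambda>x. \<Sum>i\<in>UNIV. G k i x $ i - g i x $ i)) \<longlonglongrightarrow> 0"
    by (intro nsq_sum_tendsto_0 sGi) auto
  \<comment> \<open>As the divergence of \<open>u k\<close> vanishes, this sequence is constant in
    \<open>k\<close>, equal to the squared norm of the limit's divergence; tending to 0, it is
    0.\<close>
  moreover have "nsq M (\<lambda>x. \<Sum>i\<in>UNIV. G k i x $ i - g i x $ i) = nsq M (\<lambda>x. \<Sum>i\<in>UNIV. g i x $ i)" for k
  proof -
    have "nsq M (\<lambda>x. \<Sum>i\<in>UNIV. G k i x $ i - g i x $ i) = nsq M (\<lambda>x. - (\<Sum>i\<in>UNIV. g i x $ i))"
    proof (rule nsq_AE_cong)
      have "AE x in M. (\<Sum>i\<in>UNIV. G k i x $ i) = 0" using u[of k] unfolding solenoidal_def M_def by blast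
      then show "AE x in M. (\<Sum>i\<in>UNIV. G k i x $ i - g i x $ i) = - (\<Sum>i\<in>UNIV. g i x $ i)"
        by eventually_elim (simp add: sum_subtractf)
    qed (intro sqint_measurable sqint_sum sGi sqint_minus s)+
    then show ?thesis by (simp add: nsq_def)
  qed
  ultimately have "nsq M (\<lambda>x. \<Sum>i\<in>UNIV. g i x $ i) = 0" by (simp add: LIMSEQ_const_iff)
  then show "AE x in lebesgue_on \<Omega>. (\<Sum>i\<in>UNIV. g i x $ i) = 0"
    using iffD1[OF nsq_eq_0_AE[OF s]] unfolding M_def by blast
qed

section \<open>Identification with \<open>W12_0_divfree\<close>, gradients as orthogonal
  complement\<close>

lemma W12_0_divfree_D:
  assumes "open \<Omega>" "v \<in> W12_0_divfree \<Omega>"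
  shows "solenoidal \<Omega> v (\<lambda>i. wpartial \<Omega> i v)"
  using W12_0_D[OF assms(1), of v] assms(2) by (simp add: W12_0_divfree_def solenoidal_def wdiv_def)

lemma solenoidal_wpartial_AE:
  assumes "open \<Omega>" "solenoidal \<Omega> v g"
  shows "AE x in lebesgue_on \<Omega>. \<forall>i\<in>UNIV. wpartial \<Omega> i v x = g i x"
proof (rule AE_finite_allI)
  fix i
  have "grad_in_W120 \<Omega> v g" using assms(2) by (simp add: solenoidal_def)
  then show "AE x in lebesgue_on \<Omega>. wpartial \<Omega> i v x = g i x"
    using assms(1) by (intro wpartial_AE[OF assms(1) grad_in_W120_has_weak_partial]) simp_all
qed simp

lemma W12_0_divfree_I:
  assumes \<Omega>: "open \<Omega>" and v: "solenoidal \<Omega> v g"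
  shows "v \<in> W12_0_divfree \<Omega>"
proof -
  have "AE x in lebesgue_on \<Omega>. (\<Sum>i\<in>UNIV. g i x $ i) = 0" using v by (simp add: solenoidal_def)
  with solenoidal_wpartial_AE[OF \<Omega> v] have "AE x in lebesgue_on \<Omega>. wdiv \<Omega> v x = 0"
    by eventually_elim (simp add: wdiv_def)
  then show ?thesis using W12_0_I[OF \<Omega>] v by (auto simp: W12_0_divfree_def solenoidal_def)
qed

text \<open>Testing with a real field \<open>v\<close> sees only the real part of \<open>F\<close>,
  testing with \<open>\<i> * v\<close> only its imaginary part; the real case yields a potential for
  each.\<close>

proposition orthogonal_solenoidal_imp_gradient:
  fixes \<Omega> :: "(real ^ 'd) set" and F :: "real ^ 'd \<Rightarrow> complex ^ 'd"
  assumes \<Omega>: "bounded_lipschitz_domain \<Omega>" and F: "sqint (lebesgue_on \<Omega>) F"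
    and orth: "\<And>v g. solenoidal \<Omega> v g \<Longrightarrow> ip (lebesgue_on \<Omega>) F v = 0"
  obtains \<phi> where "sqint (lebesgue_on \<Omega>) \<phi>" "\<And>i. has_weak_partial \<Omega> i \<phi> (\<lambda>x. F x $ i)"
proof -
  have o: "open \<Omega>" using \<Omega> by (simp add: bounded_lipschitz_domain_def)
  have s\<Omega>: "\<Omega> \<in> sets lebesgue" using o by simp
  have bl: "bounded_linear (\<lambda>r::real. complex_of_real r)" "bounded_linear (\<lambda>r::real. \<i> * complex_of_real r)"
    by (intro bounded_linear_of_real bounded_linear_const_mult)+
  define f1 f2 where "f1 = (\<lambda>x. \<chi> j. Re (F x $ j))" and "f2 = (\<lambda>x. \<chi> j. Im (F x $ j))"
  have s: "sqint (lebesgue_on \<Omega>) f1" "sqint (lebesgue_on \<Omega>) f2" unfolding f1_def f2_def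
    by (intro sqint_bounded_linear[OF bounded_linear_vec_map F] bounded_linear_Re bounded_linear_Im)+
  have "ip (lebesgue_on \<Omega>) f1 v = 0" if v: "v \<in> test_fun \<Omega>" "\<And>x. divg v x = 0" for v
  proof -
    have "ip (lebesgue_on \<Omega>) F (\<lambda>x. \<chi> j. complex_of_real (v x $ j)) = 0"
      by (rule orth[OF solenoidal_map[OF s\<Omega> bl(1) solenoidal_test_fun[OF s\<Omega> v]]])
    then show ?thesis by (simp add: ip_def f1_def inner_vec_def inner_complex_def)
  qed
  then obtain q1 where q1: "sqint (lebesgue_on \<Omega>) q1" "\<And>i. has_weak_partial \<Omega> i q1 (\<lambda>x. f1 x $ i)"
    using orthogonal_divfree_imp_gradient_real[OF \<Omega> s(1)] by metis
  have "ip (lebesgue_on \<Omega>) f2 v = 0" if v: "v \<in> test_fun \<Omega>" "\<And>x. divg v x = 0" for v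
  proof -
    have "ip (lebesgue_on \<Omega>) F (\<lambda>x. \<chi> j. \<i> * complex_of_real (v x $ j)) = 0"
      by (rule orth[OF solenoidal_map[OF s\<Omega> bl(2) solenoidal_test_fun[OF s\<Omega> v]]])
    then show ?thesis by (simp add: ip_def f2_def inner_vec_def inner_complex_def)
  qed
  then obtain q2 where q2: "sqint (lebesgue_on \<Omega>) q2" "\<And>i. has_weak_partial \<Omega> i q2 (\<lambda>x. f2 x $ i)"
    using orthogonal_divfree_imp_gradient_real[OF \<Omega> s(2)] by metis
  have eq: "complex_of_real (f1 x $ i) + \<i> * complex_of_real (f2 x $ i) = F x $ i" for x i
    by (simp add: f1_def f2_def complex_eq[symmetric])
  have "has_weak_partial \<Omega> i (\<lambda>x. complex_of_real (q1 x) + \<i> * complex_of_real (q2 x))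
      (\<lambda>x. complex_of_real (f1 x $ i) + \<i> * complex_of_real (f2 x $ i))" for i
    by (rule has_weak_partial_add[OF s\<Omega> has_weak_partial_bounded_linear[OF s\<Omega> bl(1) q1(2)]
        has_weak_partial_bounded_linear[OF s\<Omega> bl(2) q2(2)]])
  then have "has_weak_partial \<Omega> i (\<lambda>x. complex_of_real (q1 x) + \<i> * complex_of_real (q2 x)) (\<lambda>x. F x $ i)" for i
    unfolding eq .
  moreover have "sqint (lebesgue_on \<Omega>) (\<lambda>x. complex_of_real (q1 x) + \<i> * complex_of_real (q2 x))"
    by (intro sqint_add(1) sqint_bounded_linear[OF bl(1) q1(1)] sqint_bounded_linear[OF bl(2) q2(1)])
  ultimately show ?thesis using that by blast
qed

text \<open>Weak derivatives are defined by real test functions, so the complex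
  \<open>\<eta>\<close> is split into real and imaginary part.\<close>

lemma complex_test_integration_by_parts:
  fixes \<eta> \<psi> :: "real ^ 'd \<Rightarrow> complex"
  assumes \<Omega>: "\<Omega> \<in> sets lebesgue" and \<eta>: "\<eta> \<in> test_fun \<Omega>" and \<psi>: "has_weak_partial \<Omega> i \<psi> G"
  shows "(LINT x|lebesgue_on \<Omega>. \<eta> x * G x) = - (LINT x|lebesgue_on \<Omega>. partial i \<eta> x * \<psi> x)"
proof -
  define a b where "a = (\<lambda>x. Re (\<eta> x))" and "b = (\<lambda>x. Im (\<eta> x))"
  have ab: "a \<in> test_fun \<Omega>" "b \<in> test_fun \<Omega>" unfolding a_def b_def
    by (intro test_fun_bounded_linear[OF bounded_linear_Re \<eta>] test_fun_bounded_linear[OF bounded_linear_Im \<eta>])+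
  have p: "partial i a x = Re (partial i \<eta> x)" "partial i b x = Im (partial i \<eta> x)" for x
    unfolding a_def b_def using smooth_differentiable[OF test_fun_smooth[OF \<eta>]]
    by (auto intro: partial_bounded_linear bounded_linear_Re bounded_linear_Im)
  have l: "loc_integrable \<Omega> \<psi>" "loc_integrable \<Omega> G" using \<psi> by (auto simp: has_weak_partial_def)
  have dec: "z * y = Re z *\<^sub>R y + \<i> * (Im z *\<^sub>R y)" for z y :: complex
    by (simp add: complex_eq_iff)
  have parts: "(LINT x|M. A x + \<i> * B x) = (LINT x|M. A x) + \<i> * (LINT x|M. B x)"
    if "integrable M A" "integrable M B" for M and A B :: "real ^ 'd \<Rightarrow> complex"
    using that by simp
  have "(LINT x|lebesgue_on \<Omega>. \<eta> x * G x) = (LINT x|lebesgue_on \<Omega>. a x *\<^sub>R G x) + \<i> * (LINT x|lebesgue_on \<Omega>. b x *\<^sub>R G x)"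
    unfolding dec[of "\<eta> _"] a_def[symmetric] b_def[symmetric]
    using parts[OF loc_integrable_test_scaleR[OF \<Omega> l(2) ab(1)] loc_integrable_test_scaleR[OF \<Omega> l(2) ab(2)]]
    unfolding a_def b_def .
  moreover have "(LINT x|lebesgue_on \<Omega>. partial i \<eta> x * \<psi> x) =
      (LINT x|lebesgue_on \<Omega>. partial i a x *\<^sub>R \<psi> x) + \<i> * (LINT x|lebesgue_on \<Omega>. partial i b x *\<^sub>R \<psi> x)"
    unfolding dec[of "partial i \<eta> _"] p[symmetric]
    by (rule parts[OF loc_integrable_test_scaleR[OF \<Omega> l(1) test_fun_partial[OF ab(1)]]
          loc_integrable_test_scaleR[OF \<Omega> l(1) test_fun_partial[OF ab(2)]]])
  ultimately show ?thesis
    using \<psi> ab unfolding has_weak_partial_def by simp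
qed

text \<open>Follows from the case of test functions, since both sides are continuous in L2 with
  respect to the pair of \<open>v\<close> and its gradient.\<close>

lemma W120_integration_by_parts:
  fixes v \<psi> :: "real ^ 'd \<Rightarrow> complex"
  assumes \<Omega>: "open \<Omega>" and v: "grad_in_W120 \<Omega> v g" and \<psi>: "\<psi> \<in> W12 \<Omega>"
  shows "(LINT x|lebesgue_on \<Omega>. v x * wpartial \<Omega> i \<psi> x) = - (LINT x|lebesgue_on \<Omega>. g i x * \<psi> x)"
proof -
  define M where "M = lebesgue_on \<Omega>"
  have s\<Omega>: "\<Omega> \<in> sets lebesgue" using \<Omega> by simp
  note W = W12_D[OF \<Omega> \<psi>, folded M_def]
  obtain \<eta> where s: "sqint M v" "\<And>i. sqint M (g i)" and \<eta>: "\<And>k::nat. \<eta> k \<in> test_fun \<Omega>"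
    "(\<lambda>k. nsq M (\<lambda>x. \<eta> k x - v x)) \<longlonglongrightarrow> 0" "\<And>i. (\<lambda>k. nsq M (\<lambda>x. partial i (\<eta> k) x - g i x)) \<longlonglongrightarrow> 0"
    using v unfolding grad_in_W120_def M_def by blast
  have sm: "sqint M (\<eta> k)" "sqint M (partial i (\<eta> k))" for i k
    unfolding M_def by (intro test_fun_sqint(1)[OF _ s\<Omega>] test_fun_partial \<eta>(1))+
  have "(\<lambda>k. LINT x|M. \<eta> k x * wpartial \<Omega> i \<psi> x) \<longlonglongrightarrow> (LINT x|M. v x * wpartial \<Omega> i \<psi> x)"
    by (rule bilinear_integral_tendsto[OF bounded_bilinear_mult sm(1) s(1) W(2) \<eta>(2)])
  moreover have "(\<lambda>k. - (LINT x|M. partial i (\<eta> k) x * \<psi> x)) \<longlonglongrightarrow> - (LINT x|M. g i x * \<psi> x)"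
    by (intro tendsto_minus bilinear_integral_tendsto[OF bounded_bilinear_mult sm(2) s(2) W(1) \<eta>(3)])
  moreover have "(LINT x|M. \<eta> k x * wpartial \<Omega> i \<psi> x) = - (LINT x|M. partial i (\<eta> k) x * \<psi> x)" for k
    unfolding M_def by (rule complex_test_integration_by_parts[OF s\<Omega> \<eta>(1) W(3)])
  ultimately show ?thesis using LIMSEQ_unique by (simp add: M_def)
qed

lemma wgrad_sqint: "open \<Omega> \<Longrightarrow> \<psi> \<in> W12 \<Omega> \<Longrightarrow> sqint (lebesgue_on \<Omega>) (wgrad \<Omega> \<psi>)"
  unfolding wgrad_def[abs_def] by (intro sqint_vec W12_D(2))

text \<open>Converse to \<open>orthogonal_solenoidal_imp_gradient\<close>: integrating by parts in
  each component leaves the divergence of \<open>v\<close> multiplied by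
  \<open>\<psi>\<close>.\<close>

lemma solenoidal_orthogonal_wgrad:
  fixes v :: "real ^ 'd \<Rightarrow> complex ^ 'd"
  assumes \<Omega>: "open \<Omega>" and v: "solenoidal \<Omega> v g" and \<psi>: "\<psi> \<in> W12 \<Omega>"
  shows "(LINT x|lebesgue_on \<Omega>. cdot (v x) (wgrad \<Omega> \<psi> x)) = 0"
proof -
  define M where "M = lebesgue_on \<Omega>"
  have s\<Omega>: "\<Omega> \<in> sets lebesgue" using \<Omega> by simp
  note W = W12_D[OF \<Omega> \<psi>, folded M_def]
  have gv: "grad_in_W120 \<Omega> v g" using v by (simp add: solenoidal_def)
  have sc: "sqint M (\<lambda>x. v x $ i)" "sqint M (\<lambda>x. g i x $ i)" for i
    by (intro sqint_bounded_linear[OF bounded_linear_vec_nth] solenoidal_sqint[OF v, folded M_def])+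
  have int: "integrable M (\<lambda>x. v x $ i * wpartial \<Omega> i \<psi> x)" "integrable M (\<lambda>x. g i x $ i * \<psi> x)" for i
    by (intro sqint_bounded_bilinear_integrable[OF bounded_bilinear_mult] sc W)+
  have "(LINT x|M. cdot (v x) (wgrad \<Omega> \<psi> x)) = (\<Sum>i\<in>UNIV. LINT x|M. v x $ i * wpartial \<Omega> i \<psi> x)"
    unfolding cdot_def wgrad_def using int(1) by (simp add: Bochner_Integration.integral_sum)
  also have "\<dots> = (\<Sum>i\<in>UNIV. - (LINT x|M. g i x $ i * \<psi> x))"
    unfolding M_def
    by (intro sum.cong refl W120_integration_by_parts[OF \<Omega> _ \<psi>] grad_in_W120_bounded_linear[OF s\<Omega> bounded_linear_vec_nth gv])
  also have "\<dots> = - (LINT x|M. (\<Sum>i\<in>UNIV. g i x $ i * \<psi> x))"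
    using int(2) by (simp add: Bochner_Integration.integral_sum sum_negf)
  also have "(LINT x|M. (\<Sum>i\<in>UNIV. g i x $ i * \<psi> x)) = 0"
  proof (rule integral_eq_zero_AE)
    have "AE x in M. (\<Sum>i\<in>UNIV. g i x $ i) = 0" using v unfolding solenoidal_def M_def by blast
    then show "AE x in M. (\<Sum>i\<in>UNIV. g i x $ i * \<psi> x) = 0"
      by eventually_elim (simp add: sum_distrib_right[symmetric])
  qed
  finally show ?thesis by (simp add: M_def)
qed

lemma integral_cdot_AE_cong:
  assumes "AE x in M. a x = a' x" "AE x in M. b x = b' x"
    and "sqint M a" "sqint M a'" "sqint M b" "sqint M b'"
  shows "(LINT x|M. cdot (a x) (b x)) = (LINT x|M. cdot (a' x) (b' x))"
proof (rule integral_cong_AE)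
  show "AE x in M. cdot (a x) (b x) = cdot (a' x) (b' x)" using assms(1,2) by eventually_elim simp
qed (intro borel_measurable_integrable sqint_bounded_bilinear_integrable[OF bounded_bilinear_cdot] assms)+

text \<open>
  The hypotheses on \<open>w\<close> say that it is the orthogonal projection of \<open>f\<close> onto the \<open>L\<^sup>2\<close> closure of
  the solenoidal \<open>W\<^sup>1\<^sup>,\<^sup>2\<^sub>0\<close> fields.
\<close>

proposition helmholtz_AE_eq_projection:
  fixes \<Omega> :: "(real ^ 'd) set" and f w :: "real ^ 'd \<Rightarrow> complex ^ 'd"
  assumes \<Omega>: "bounded_lipschitz_domain \<Omega>" and f: "sqint (lebesgue_on \<Omega>) f" and w: "sqint (lebesgue_on \<Omega>) w"
    and u: "\<And>k::nat. solenoidal \<Omega> (u k) (G k)" "(\<lambda>k. nsq (lebesgue_on \<Omega>) (\<lambda>x. u k x - w x)) \<longlonglongrightarrow> 0"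
    and orth: "\<And>v g. solenoidal \<Omega> v g \<Longrightarrow> ip (lebesgue_on \<Omega>) w v = ip (lebesgue_on \<Omega>) f v"
  shows "AE x in lebesgue_on \<Omega>. helmholtz \<Omega> f x = w x" "sqint (lebesgue_on \<Omega>) (helmholtz \<Omega> f)"
proof -
  define M where "M = lebesgue_on \<Omega>"
  have o: "open \<Omega>" using \<Omega> by (simp add: bounded_lipschitz_domain_def)
  have s\<Omega>: "\<Omega> \<in> sets lebesgue" using o by simp
  note f = f[folded M_def] and w = w[folded M_def]
  define F where "F = (\<lambda>x. f x - w x)"
  have sF: "sqint M F" unfolding F_def by (rule sqint_diff[OF f w])
  have "ip (lebesgue_on \<Omega>) F v = 0" if "solenoidal \<Omega> v g" for v g
    using ip_diff_left[OF f w solenoidal_sqint(1)[OF that, folded M_def]] orth[OF that] by (simp add: F_def M_def)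
  then obtain \<phi> where \<phi>: "sqint (lebesgue_on \<Omega>) \<phi>" "\<And>i. has_weak_partial \<Omega> i \<phi> (\<lambda>x. F x $ i)"
    using orthogonal_solenoidal_imp_gradient[OF \<Omega> sF[unfolded M_def]] by metis
  have sFi: "sqint (lebesgue_on \<Omega>) (\<lambda>x. F x $ i)" for i
    by (rule sqint_bounded_linear[OF bounded_linear_vec_nth sF[unfolded M_def]])
  have \<phi>W: "\<phi> \<in> W12 \<Omega>" unfolding W12_def Bex_def L2_iff_sqint using \<phi> sFi by blast
  have g\<phi>: "AE x in M. wgrad \<Omega> \<phi> x = F x"
  proof -
    have "AE x in lebesgue_on \<Omega>. \<forall>i\<in>UNIV. wpartial \<Omega> i \<phi> x = F x $ i"
      by (intro AE_finite_allI wpartial_AE[OF o \<phi>(2)]) auto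
    then show ?thesis unfolding M_def by eventually_elim (simp add: wgrad_def vec_eq_iff)
  qed
  have sg: "sqint M (wgrad \<Omega> \<psi>)" if "\<psi> \<in> W12 \<Omega>" for \<psi> unfolding M_def by (rule wgrad_sqint[OF o that])
  note ci = sqint_bounded_bilinear_integrable[OF bounded_bilinear_cdot]
  have "weak_neumann_solution \<Omega> f \<phi>"
    unfolding weak_neumann_solution_def M_def[symmetric]
  proof (intro conjI ballI \<phi>W)
    fix \<psi> :: "real ^ 'd \<Rightarrow> complex" assume \<psi>: "\<psi> \<in> W12 \<Omega>"
    \<comment> \<open>As a limit of solenoidal fields, \<open>w\<close> is annihilated by gradients,
      so in the Neumann problem \<open>F = f - w\<close> has the same effect as
      \<open>f\<close>.\<close>
    have "(\<lambda>k. LINT x|M. cdot (u k x) (wgrad \<Omega> \<psi> x)) \<longlonglongrightarrow> (LINT x|M. cdot (w x) (wgrad \<Omega> \<psi> x))"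
      by (rule bilinear_integral_tendsto[OF bounded_bilinear_cdot _ w sg[OF \<psi>]])
         (use solenoidal_sqint(1)[OF u(1)] u(2) in \<open>simp_all add: M_def\<close>)
    moreover have "(LINT x|M. cdot (u k x) (wgrad \<Omega> \<psi> x)) = 0" for k
      unfolding M_def by (rule solenoidal_orthogonal_wgrad[OF o u(1) \<psi>])
    ultimately have w0: "(LINT x|M. cdot (w x) (wgrad \<Omega> \<psi> x)) = 0" by (simp add: LIMSEQ_const_iff)
    have "(LINT x|M. cdot (wgrad \<Omega> \<phi> x) (wgrad \<Omega> \<psi> x)) = (LINT x|M. cdot (F x) (wgrad \<Omega> \<psi> x))"
      by (intro integral_cdot_AE_cong g\<phi> sg \<phi>W \<psi> sF) simp
    also have "\<dots> = (LINT x|M. cdot (f x) (wgrad \<Omega> \<psi> x)) - (LINT x|M. cdot (w x) (wgrad \<Omega> \<psi> x))"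
      unfolding F_def bounded_bilinear.diff_left[OF bounded_bilinear_cdot]
      by (intro Bochner_Integration.integral_diff ci f w sg \<psi>)
    finally show "(LINT x|M. cdot (wgrad \<Omega> \<phi> x) (wgrad \<Omega> \<psi> x)) = (LINT x|M. cdot (f x) (wgrad \<Omega> \<psi> x))"
      by (simp add: w0)
  qed
  note N = this
  \<comment> \<open>This is the solution that \<open>helmholtz\<close> happens to choose; its
    gradient has to be compared with that of the constructed \<open>\<phi>\<close>.\<close>
  define \<phi>' where "\<phi>' = (SOME \<phi>. weak_neumann_solution \<Omega> f \<phi>)"
  have N': "weak_neumann_solution \<Omega> f \<phi>'" unfolding \<phi>'_def by (rule someI[of "weak_neumann_solution \<Omega> f", OF N])
  have \<phi>'W: "\<phi>' \<in> W12 \<Omega>" using N' by (simp add: weak_neumann_solution_def)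
  define E where "E = (\<lambda>x. wgrad \<Omega> \<phi>' x - wgrad \<Omega> \<phi> x)"
  have sE: "sqint M E" unfolding E_def by (intro sqint_diff sg \<phi>W \<phi>'W)
  \<comment> \<open>The Neumann problem is bilinear without conjugation; testing with the conjugated
    difference turns it into the squared norm of the gradient difference \<open>E\<close>.\<close>
  define \<psi> where "\<psi> = (\<lambda>x. cnj (\<phi>' x + - \<phi> x))"
  have bl: "bounded_linear (uminus :: complex \<Rightarrow> complex)" by (rule bounded_linear_minus[OF bounded_linear_ident])
  have h\<psi>: "has_weak_partial \<Omega> i \<psi> (\<lambda>x. cnj (wpartial \<Omega> i \<phi>' x + - wpartial \<Omega> i \<phi> x))" for i
    unfolding \<psi>_def
    by (intro has_weak_partial_bounded_linear[OF s\<Omega> bounded_linear_cnj] has_weak_partial_add[OF s\<Omega>]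
        has_weak_partial_bounded_linear[OF s\<Omega> bl] W12_D(3)[OF o] \<phi>W \<phi>'W)
  have s\<psi>: "sqint (lebesgue_on \<Omega>) \<psi>" "sqint (lebesgue_on \<Omega>) (\<lambda>x. cnj (wpartial \<Omega> i \<phi>' x + - wpartial \<Omega> i \<phi> x))" for i
    unfolding \<psi>_def
    by (intro sqint_bounded_linear[OF bounded_linear_cnj] sqint_add(1) sqint_minus W12_D(1,2)[OF o] \<phi>W \<phi>'W)+
  have \<psi>W: "\<psi> \<in> W12 \<Omega>" unfolding W12_def Bex_def L2_iff_sqint using h\<psi> s\<psi> by blast
  have g\<psi>: "AE x in M. wgrad \<Omega> \<psi> x = (\<chi> j. cnj (E x $ j))"
  proof -
    have "AE x in lebesgue_on \<Omega>. \<forall>i\<in>UNIV. wpartial \<Omega> i \<psi> x = cnj (wpartial \<Omega> i \<phi>' x + - wpartial \<Omega> i \<phi> x)"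
      by (intro AE_finite_allI wpartial_AE[OF o h\<psi>]) auto
    then show ?thesis unfolding M_def by eventually_elim (simp add: wgrad_def E_def vec_eq_iff)
  qed
  have scE: "sqint M (\<lambda>x. \<chi> j. cnj (E x $ j))"
    by (rule sqint_bounded_linear[OF bounded_linear_vec_map[OF bounded_linear_cnj] sE])
  have "(LINT x|M. cdot (wgrad \<Omega> \<phi>' x) (wgrad \<Omega> \<psi> x)) = (LINT x|M. cdot (wgrad \<Omega> \<phi> x) (wgrad \<Omega> \<psi> x))"
    using N N' \<psi>W by (simp add: weak_neumann_solution_def M_def)
  then have "0 = (LINT x|M. cdot (E x) (wgrad \<Omega> \<psi> x))"
    unfolding E_def bounded_bilinear.diff_left[OF bounded_bilinear_cdot]
    by (subst Bochner_Integration.integral_diff) (intro ci sg \<phi>W \<phi>'W \<psi>W | simp)+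
  also have "\<dots> = (LINT x|M. cdot (E x) (\<chi> j. cnj (E x $ j)))"
    by (intro integral_cdot_AE_cong g\<psi> sE scE sg \<psi>W) simp
  finally have "0 = Re (LINT x|M. cdot (E x) (\<chi> j. cnj (E x $ j)))" by simp
  also have "\<dots> = (LINT x|M. Re (cdot (E x) (\<chi> j. cnj (E x $ j))))"
    by (rule integral_bounded_linear[OF bounded_linear_Re ci[OF sE scE], symmetric])
  also have "\<dots> = nsq M E"
    unfolding inner_cnj_eq_Re_cdot[symmetric] nsq_def power2_norm_eq_inner by simp
  finally have "AE x in M. E x = 0" using nsq_eq_0_AE[OF sE] by simp
  with g\<phi> show "AE x in lebesgue_on \<Omega>. helmholtz \<Omega> f x = w x"
    unfolding M_def by eventually_elim (simp add: helmholtz_def \<phi>'_def[symmetric] E_def F_def)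
  show "sqint (lebesgue_on \<Omega>) (helmholtz \<Omega> f)"
    using sqint_diff[OF f sg[OF \<phi>'W]] by (simp add: helmholtz_def[abs_def] \<phi>'_def[symmetric] M_def)
qed

section \<open>The Stokes resolvent problem\<close>

text \<open>
  With \<open>g = \<nabla>v\<close> and \<open>\<mu>\<^sup>2 = 1 / \<lambda>\<close>, the \<open>L\<^sup>2\<close> projection of \<open>(f, 0)\<close> onto these pairs is
  \<open>(\<lambda> u, \<mu> \<nabla>(\<lambda> u))\<close> for the Stokes resolvent solution \<open>u\<close>.
\<close>

definition stokes_pair :: "real \<Rightarrow> (real ^ 'd \<Rightarrow> complex ^ 'd) \<Rightarrow> ('d \<Rightarrow> real ^ 'd \<Rightarrow> complex ^ 'd) \<Rightarrow>
    real ^ 'd \<Rightarrow> (complex ^ 'd) \<times> ((complex ^ 'd) ^ 'd)" where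
  "stokes_pair \<mu> v g x = (v x, \<chi> i. \<mu> *\<^sub>R g i x)"

lemma sqint_stokes_pair:
  assumes "sqint M v" "\<And>i. sqint M (g i)"
  shows "sqint M (stokes_pair \<mu> v g)"
proof -
  have b1: "bounded_linear (\<lambda>y::complex ^ 'd. (y, 0 :: (complex ^ 'd) ^ 'd))"
    and b2: "bounded_linear (\<lambda>y::(complex ^ 'd) ^ 'd. (0 :: complex ^ 'd, y))"
    by (intro bounded_linear_Pair bounded_linear_ident bounded_linear_zero)+
  have "stokes_pair \<mu> v g = (\<lambda>x. (v x, 0) + (0, \<chi> i. \<mu> *\<^sub>R g i x))"
    by (simp add: stokes_pair_def fun_eq_iff)
  then show ?thesis
    using sqint_add(1)[OF sqint_bounded_linear[OF b1 assms(1)]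
        sqint_bounded_linear[OF b2 sqint_vec[of M "\<lambda>i x. \<mu> *\<^sub>R g i x"]]] sqint_scaleR[OF assms(2)]
    by simp
qed

lemma ip_stokes_pair:
  assumes "sqint M v" "\<And>i. sqint M (g i)" "sqint M v'" "\<And>i. sqint M (g' i)"
  shows "ip M (stokes_pair \<mu> v g) (stokes_pair \<mu> v' g') = ip M v v' + \<mu>\<^sup>2 * (\<Sum>i\<in>UNIV. ip M (g i) (g' i))"
proof -
  have "stokes_pair \<mu> v g x \<bullet> stokes_pair \<mu> v' g' x = v x \<bullet> v' x + \<mu>\<^sup>2 * (\<Sum>i\<in>UNIV. g i x \<bullet> g' i x)" for x
    by (simp add: stokes_pair_def inner_Pair inner_vec_def[of "\<chi> i. \<mu> *\<^sub>R g i x"] sum_distrib_left power2_eq_square mult.assoc)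
  then show ?thesis
    using assms by (simp add: ip_def sqint_inner_integrable Bochner_Integration.integral_sum)
qed

lemma nsq_stokes_pair:
  assumes "sqint M v" "\<And>i. sqint M (g i)"
  shows "nsq M (stokes_pair \<mu> v g) = nsq M v + \<mu>\<^sup>2 * (\<Sum>i\<in>UNIV. nsq M (g i))"
  using ip_stokes_pair[where g = g and g' = g, OF assms assms] by (simp add: ip_self)

text \<open>By \<open>orth\<close> the data \<open>f\<close> and \<open>w\<close> act identically on
  solenoidal fields, so projecting \<open>(w, 0)\<close> yields the same solution as
  \<open>(f, 0)\<close>. The gain is that minimality now bounds the distance of \<open>lam u\<close>
  from the expected limit \<open>w\<close> directly, with an arbitrary competitor on the
  right.\<close>

proposition stokes_solution_exists:
  fixes \<Omega> :: "(real ^ 'd) set" and f w :: "real ^ 'd \<Rightarrow> complex ^ 'd"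
  assumes \<Omega>: "open \<Omega>" and f: "sqint (lebesgue_on \<Omega>) f" and w: "sqint (lebesgue_on \<Omega>) w"
    and orth: "\<And>v g. solenoidal \<Omega> v g \<Longrightarrow> ip (lebesgue_on \<Omega>) w v = ip (lebesgue_on \<Omega>) f v" and lam: "lam > 0"
  obtains u where "stokes_weak_solution \<Omega> lam f u" "sqint (lebesgue_on \<Omega>) (\<lambda>x. lam *\<^sub>R u x)"
    "\<And>v g. solenoidal \<Omega> v g \<Longrightarrow> nsq (lebesgue_on \<Omega>) (\<lambda>x. lam *\<^sub>R u x - w x)
      \<le> nsq (lebesgue_on \<Omega>) (\<lambda>x. v x - w x) + (\<Sum>i\<in>UNIV. nsq (lebesgue_on \<Omega>) (g i)) / lam"
proof -
  define M where "M = lebesgue_on \<Omega>"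
  have s\<Omega>: "\<Omega> \<in> sets lebesgue" using \<Omega> by simp
  note f = f[folded M_def] and w = w[folded M_def]
  \<comment> \<open>The weight appears squared in the norm of the pair, hence the square
    root.\<close>
  define \<mu> where "\<mu> = sqrt (1 / lam)"
  have \<mu>: "\<mu>\<^sup>2 = 1 / lam" "\<mu> \<noteq> 0" using lam by (auto simp: \<mu>_def)
  have so: "sqint M v" "sqint M (g i)" if "solenoidal \<Omega> v g" for v :: "real ^ 'd \<Rightarrow> complex ^ 'd" and g i
    using solenoidal_sqint[OF that] by (auto simp: M_def)
  define P where "P = stokes_pair \<mu> w (\<lambda>i x. 0)"
  have sP: "sqint M P" unfolding P_def by (intro sqint_stokes_pair w sqint_zero)
  define S where "S = {stokes_pair \<mu> v g | v g. solenoidal \<Omega> v g}"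
  have SI: "stokes_pair \<mu> v g \<in> S" if "solenoidal \<Omega> v g" for v g using that by (auto simp: S_def)
  have SE: "\<exists>v g. V = stokes_pair \<mu> v g \<and> solenoidal \<Omega> v g" if "V \<in> S" for V using that by (auto simp: S_def)
  have sS: "sqint M V" if "V \<in> S" for V
    using SE[OF that] so by (auto intro: sqint_stokes_pair)
  have Sscale: "(\<lambda>x. c *\<^sub>R V x) \<in> S" if V: "V \<in> S" for c V
  proof -
    obtain v g where vg: "V = stokes_pair \<mu> v g" "solenoidal \<Omega> v g" using SE[OF V] by blast
    have "(\<lambda>x. c *\<^sub>R V x) = stokes_pair \<mu> (\<lambda>x. c *\<^sub>R v x) (\<lambda>i x. c *\<^sub>R g i x)"
      by (simp add: vg(1) stokes_pair_def fun_eq_iff vec_eq_iff)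
    then show ?thesis using SI[OF solenoidal_scaleR[OF s\<Omega> vg(2)]] by simp
  qed
  have Sadd: "(\<lambda>x. U x + V x) \<in> S" if U: "U \<in> S" and V: "V \<in> S" for U V
  proof -
    obtain v g where vg: "V = stokes_pair \<mu> v g" "solenoidal \<Omega> v g" using SE[OF V] by blast
    obtain v' g' where vg': "U = stokes_pair \<mu> v' g'" "solenoidal \<Omega> v' g'" using SE[OF U] by blast
    have "(\<lambda>x. U x + V x) = stokes_pair \<mu> (\<lambda>x. v' x + v x) (\<lambda>i x. g' i x + g i x)"
      by (simp add: vg(1) vg'(1) stokes_pair_def fun_eq_iff vec_eq_iff scaleR_add_right)
    then show ?thesis using SI[OF solenoidal_add[OF s\<Omega> vg'(2) vg(2)]] by simp
  qed
  have Sdiff: "(\<lambda>x. U x - V x) \<in> S" if U: "U \<in> S" and V: "V \<in> S" for U V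
    using Sadd[OF U Sscale[OF V, of "-1"]] by simp
  obtain Z U where Z: "sqint M Z" "\<And>k::nat. U k \<in> S" "(\<lambda>k. nsq M (\<lambda>x. U k x - Z x)) \<longlonglongrightarrow> 0"
    "\<And>V. V \<in> S \<Longrightarrow> ip M Z V = ip M V P"
  proof (rule sqint_riesz[of S M "\<lambda>V. ip M V P" "nsq M P"])
    have "(\<lambda>x::real ^ 'd. 0 :: complex ^ 'd) \<in> test_fun \<Omega>" by simp
    moreover have "divg (\<lambda>x::real ^ 'd. 0 :: complex ^ 'd) x = 0" for x
      unfolding divg_def partial_eq[OF has_derivative_const[of "0 :: complex ^ 'd"]] by simp
    ultimately show "S \<noteq> {}" using SI[OF solenoidal_test_fun[OF s\<Omega>]] by blast
    show "(ip M V P)\<^sup>2 \<le> nsq M P * nsq M V" if "V \<in> S" for V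
      using ip_sq_le[OF sS[OF that] sP] by (simp add: mult.commute)
  qed ((rule that, assumption+) | simp add: sS Sadd Sscale sP ip_add_left ip_scaleR_left)+
  have "\<exists>V G. \<forall>k. U k = stokes_pair \<mu> (V k) (G k) \<and> solenoidal \<Omega> (V k) (G k)"
    using SE[OF Z(2)] by metis
  then obtain V G where VG: "\<And>k. U k = stokes_pair \<mu> (V k) (G k)" "\<And>k. solenoidal \<Omega> (V k) (G k)" by blast
  \<comment> \<open>Recovers the gradient from the second component of a pair, so that convergence
    of pairs gives convergence of gradients.\<close>
  define T where "T i y = (1 / \<mu>) *\<^sub>R (snd y $ i)" for i :: 'd and y :: "(complex ^ 'd) \<times> ((complex ^ 'd) ^ 'd)"
  have T: "bounded_linear (T i)" for i unfolding T_def
    by (rule bounded_linear_compose[OF bounded_linear_scaleR_right bounded_linear_compose[OF bounded_linear_vec_nth bounded_linear_snd]])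
  define z where "z = (\<lambda>x. fst (Z x))"
  define g where "g = (\<lambda>i x. T i (Z x))"
  have sz: "sqint M z" and sg: "sqint M (g i)" for i
    unfolding z_def g_def by (intro sqint_bounded_linear[OF bounded_linear_fst Z(1)] sqint_bounded_linear[OF T Z(1)])+
  have Zeq: "Z = stokes_pair \<mu> z g"
    using \<mu>(2) by (simp add: stokes_pair_def z_def g_def T_def fun_eq_iff prod_eq_iff vec_eq_iff)
  have sol: "solenoidal \<Omega> z g"
  proof (rule solenoidal_closed[OF s\<Omega> VG(2)])
    show "(\<lambda>k. nsq (lebesgue_on \<Omega>) (\<lambda>x. V k x - z x)) \<longlonglongrightarrow> 0"
      using nsq_bounded_linear_tendsto[OF bounded_linear_fst sS[OF Z(2)] Z(1,3)]
      by (simp add: VG(1) stokes_pair_def z_def M_def)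
    show "(\<lambda>k. nsq (lebesgue_on \<Omega>) (\<lambda>x. G k i x - g i x)) \<longlonglongrightarrow> 0" for i
      using nsq_bounded_linear_tendsto[OF T sS[OF Z(2)] Z(1,3), of i] \<mu>(2)
      by (simp add: VG(1) stokes_pair_def g_def M_def T_def)
  qed (use sz sg in \<open>simp_all add: M_def\<close>)
  \<comment> \<open>The orthogonality relation of the projection. With \<open>u = z / lam\<close> it
    is the weak Stokes equation, up to the passage from the real \<open>ip\<close> to
    \<open>cdot\<close>.\<close>
  have weak: "ip M z v + \<mu>\<^sup>2 * (\<Sum>i\<in>UNIV. ip M (g i) (h i)) = ip M f v" if vh: "solenoidal \<Omega> v h" for v h
  proof -
    have "ip M z v + \<mu>\<^sup>2 * (\<Sum>i\<in>UNIV. ip M (g i) (h i)) = ip M Z (stokes_pair \<mu> v h)"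
      unfolding Zeq by (rule ip_stokes_pair[symmetric]) (intro sz sg so[OF vh])+
    also have "\<dots> = ip M P (stokes_pair \<mu> v h)" using Z(4)[OF SI[OF vh]] by (simp add: ip_commute)
    also have "\<dots> = ip M w v + \<mu>\<^sup>2 * (\<Sum>i\<in>UNIV. ip M (\<lambda>x. 0) (h i))"
      unfolding P_def by (rule ip_stokes_pair) (intro w sqint_zero so[OF vh])+
    also have "\<dots> = ip M w v" by (simp add: ip_def)
    finally show ?thesis using orth[OF vh] by (simp add: M_def)
  qed
  define u where "u = (\<lambda>x. (1 / lam) *\<^sub>R z x)"
  define gu where "gu = (\<lambda>i x. (1 / lam) *\<^sub>R g i x)"
  have solu: "solenoidal \<Omega> u gu" unfolding u_def gu_def by (rule solenoidal_scaleR[OF s\<Omega> sol])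
  have lu: "lam *\<^sub>R u x = z x" for x using lam by (simp add: u_def)
  note ci = sqint_bounded_bilinear_integrable[OF bounded_bilinear_cdot]
  have st: "stokes_weak_solution \<Omega> lam f u"
    unfolding stokes_weak_solution_def M_def[symmetric]
  proof (intro conjI ballI)
    show "u \<in> W12_0_divfree \<Omega>" by (rule W12_0_divfree_I[OF \<Omega> solu])
    fix v assume "v \<in> W12_0_divfree \<Omega>"
    from W12_0_divfree_D[OF \<Omega> this] have vh: "solenoidal \<Omega> v (\<lambda>i. wpartial \<Omega> i v)" .
    define h where "h = (\<lambda>i. wpartial \<Omega> i v)"
    note vh = vh[folded h_def]
    define A where "A = (\<Sum>i\<in>UNIV. LINT x|M. cdot (g i x) (h i x))"
    define B where "B = (LINT x|M. cdot (z x) (v x))"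
    define D where "D = (LINT x|M. cdot (f x) (v x))"
    \<comment> \<open>The conjugate of a solenoidal field and \<open>\<i>\<close> times it are again
      solenoidal; as test fields they give the real and the imaginary part of the complex
      equation.\<close>
    have re: "ip M a (\<lambda>x. \<chi> j. cnj (b x $ j)) = Re (LINT x|M. cdot (a x) (b x))"
      if "sqint M a" "sqint M b" for a b
      unfolding ip_def inner_cnj_eq_Re_cdot by (rule integral_bounded_linear[OF bounded_linear_Re ci[OF that]])
    have im: "ip M a (\<lambda>x. \<chi> j. \<i> * cnj (b x $ j)) = Im (LINT x|M. cdot (a x) (b x))"
      if "sqint M a" "sqint M b" for a b
      unfolding ip_def inner_ii_cnj_eq_Im_cdot by (rule integral_bounded_linear[OF bounded_linear_Im ci[OF that]])
    have bl: "bounded_linear (\<lambda>y. \<i> * cnj y)"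
      by (rule bounded_linear_compose[OF bounded_linear_mult_right bounded_linear_cnj])
    have "Re (B + \<mu>\<^sup>2 * A) = Re D"
      using weak[OF solenoidal_map[OF s\<Omega> bounded_linear_cnj vh]]
      by (simp add: re sz sg so[OF vh] f A_def B_def D_def)
    moreover have "Im (B + \<mu>\<^sup>2 * A) = Im D"
      using weak[OF solenoidal_map[OF s\<Omega> bl vh]]
      by (simp add: im sz sg so[OF vh] f A_def B_def D_def)
    ultimately have main: "B + \<mu>\<^sup>2 * A = D" by (rule complex_eqI)
    have ae: "AE x in M. \<forall>i\<in>UNIV. wpartial \<Omega> i u x = gu i x"
      unfolding M_def by (rule solenoidal_wpartial_AE[OF \<Omega> solu])
    have mg: "sqint M (wpartial \<Omega> i u)" for i
      using so(2)[OF W12_0_divfree_D[OF \<Omega> W12_0_divfree_I[OF \<Omega> solu]]] .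
    have "(LINT x|M. (\<Sum>i\<in>UNIV. cdot (wpartial \<Omega> i u x) (wpartial \<Omega> i v x)))
        = (\<Sum>i\<in>UNIV. LINT x|M. cdot (wpartial \<Omega> i u x) (h i x))"
      unfolding h_def[symmetric] using ci[OF mg so(2)[OF vh]] by (simp add: h_def Bochner_Integration.integral_sum)
    also have "\<dots> = (\<Sum>i\<in>UNIV. LINT x|M. cdot (gu i x) (h i x))"
    proof (intro sum.cong refl integral_cdot_AE_cong mg so[OF solu] so[OF vh])
      show "AE x in M. wpartial \<Omega> i u x = gu i x" for i using ae by eventually_elim simp
    qed simp
    also have "\<dots> = (1 / lam) *\<^sub>R A"
      by (simp add: A_def gu_def bounded_bilinear.scaleR_left[OF bounded_bilinear_cdot] scaleR_sum_right)
    finally have 1: "(LINT x|M. (\<Sum>i\<in>UNIV. cdot (wpartial \<Omega> i u x) (wpartial \<Omega> i v x))) = (1 / lam) *\<^sub>R A" .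
    have 2: "(LINT x|M. cdot (u x) (v x)) = (1 / lam) *\<^sub>R B"
      by (simp add: B_def u_def bounded_bilinear.scaleR_left[OF bounded_bilinear_cdot])
    show "(LINT x|M. (\<Sum>i\<in>UNIV. cdot (wpartial \<Omega> i u x) (wpartial \<Omega> i v x))) + complex_of_real lam * (LINT x|M. cdot (u x) (v x))
        = (LINT x|M. cdot (f x) (v x))"
      unfolding 1 2 D_def[symmetric] main[symmetric] \<mu>(1) using lam by (simp add: scaleR_conv_of_real)
  qed
  show ?thesis
  proof (rule that[OF st])
    show "sqint (lebesgue_on \<Omega>) (\<lambda>x. lam *\<^sub>R u x)" using sz by (simp add: lu M_def)
    \<comment> \<open>Minimality against the competitor \<open>stokes_pair \<mu> v h\<close>; on the
      left the gradient component is dropped.\<close>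
    fix v :: "real ^ 'd \<Rightarrow> complex ^ 'd" and h assume vh: "solenoidal \<Omega> v h"
    have "nsq M (\<lambda>x. P x - Z x) \<le> nsq M (\<lambda>x. P x - stokes_pair \<mu> v h x)"
      by (rule best_approximation[OF sS sP Z(1) Sdiff Z(2,3) _ SI[OF vh]])
         (use Z(4) in \<open>simp_all add: ip_commute\<close>)
    also have "(\<lambda>x. P x - stokes_pair \<mu> v h x) = stokes_pair \<mu> (\<lambda>x. w x - v x) (\<lambda>i x. - h i x)"
      by (simp add: P_def stokes_pair_def fun_eq_iff vec_eq_iff)
    also have "nsq M \<dots> = nsq M (\<lambda>x. w x - v x) + \<mu>\<^sup>2 * (\<Sum>i\<in>UNIV. nsq M (\<lambda>x. - h i x))"
      by (intro nsq_stokes_pair sqint_diff sqint_minus w so[OF vh])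
    also have "\<dots> = nsq M (\<lambda>x. v x - w x) + (\<Sum>i\<in>UNIV. nsq M (h i)) / lam"
      by (simp add: nsq_minus_commute[of M w] \<mu>(1)) (simp add: nsq_def)
    finally have le: "nsq M (\<lambda>x. P x - Z x) \<le> nsq M (\<lambda>x. v x - w x) + (\<Sum>i\<in>UNIV. nsq M (h i)) / lam" .
    have "P x - Z x = (w x - z x, snd (P x - Z x))" for x
      by (simp add: prod_eq_iff P_def stokes_pair_def z_def)
    then have "norm (w x - z x) \<le> 1 * norm (P x - Z x)" for x
      using norm_fst_le[of "w x - z x" "snd (P x - Z x)"] by (metis mult_1)
    then have "nsq M (\<lambda>x. w x - z x) \<le> 1\<^sup>2 * nsq M (\<lambda>x. P x - Z x)"
      by (rule sqint_mono(2)[OF sqint_diff[OF sP Z(1)] sqint_measurable[OF sqint_diff[OF w sz]]])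
    with le show "nsq (lebesgue_on \<Omega>) (\<lambda>x. lam *\<^sub>R u x - w x)
      \<le> nsq (lebesgue_on \<Omega>) (\<lambda>x. v x - w x) + (\<Sum>i\<in>UNIV. nsq (lebesgue_on \<Omega>) (h i)) / lam"
      by (simp add: lu M_def nsq_minus_commute[of _ z])
  qed
qed

text \<open>A sequence of parameters tending to infinity is enough for bounding a supremum from
  below; \<open>Suc n\<close> keeps them positive.\<close>

proposition stokes_resolvent_limit:
  fixes \<Omega> :: "(real ^ 'd) set" and f g :: "real ^ 'd \<Rightarrow> complex ^ 'd"
  assumes \<Omega>: "bounded_lipschitz_domain \<Omega>" and f: "sqint (lebesgue_on \<Omega>) f" and g: "sqint (lebesgue_on \<Omega>) g"
  obtains u where "\<And>n. stokes_weak_solution \<Omega> (real (Suc n)) f (u n)"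
    "(\<lambda>n. real (Suc n) * cmod (L2_inner \<Omega> (u n) g)) \<longlonglongrightarrow> cmod (L2_inner \<Omega> (helmholtz \<Omega> f) g)"
proof -
  define M where "M = lebesgue_on \<Omega>"
  have o: "open \<Omega>" using \<Omega> by (simp add: bounded_lipschitz_domain_def)
  have s\<Omega>: "\<Omega> \<in> sets lebesgue" using o by simp
  note f = f[folded M_def] and g = g[folded M_def]
  define S where "S = {v :: real ^ 'd \<Rightarrow> complex ^ 'd. \<exists>h. solenoidal \<Omega> v h}"
  have sS: "sqint M v" if "v \<in> S" for v using that solenoidal_sqint(1) by (auto simp: S_def M_def)
  obtain w v where w: "sqint M w" "\<And>k::nat. v k \<in> S" "(\<lambda>k. nsq M (\<lambda>x. v k x - w x)) \<longlonglongrightarrow> 0"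
    "\<And>v. v \<in> S \<Longrightarrow> ip M w v = ip M v f"
  proof (rule sqint_riesz[of S M "\<lambda>v. ip M v f" "nsq M f"])
    have "(\<lambda>x::real ^ 'd. 0 :: complex ^ 'd) \<in> test_fun \<Omega>" by simp
    moreover have "divg (\<lambda>x::real ^ 'd. 0 :: complex ^ 'd) x = 0" for x
      unfolding divg_def partial_eq[OF has_derivative_const[of "0 :: complex ^ 'd"]] by simp
    ultimately show "S \<noteq> {}" using solenoidal_test_fun[OF s\<Omega>] unfolding S_def by blast
    show "(\<lambda>x. a x + b x) \<in> S" if "a \<in> S" "b \<in> S" for a b
      using that solenoidal_add[OF s\<Omega>] unfolding S_def by blast
    show "(\<lambda>x. c *\<^sub>R a x) \<in> S" if "a \<in> S" for c a
      using that solenoidal_scaleR[OF s\<Omega>] unfolding S_def by blast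
    show "(ip M v f)\<^sup>2 \<le> nsq M f * nsq M v" if "v \<in> S" for v
      using ip_sq_le[OF sS[OF that] f] by (simp add: mult.commute)
  qed ((rule that, assumption+) | simp add: sS f ip_add_left ip_scaleR_left)+
  obtain G where G: "\<And>k. solenoidal \<Omega> (v k) (G k)" using w(2) unfolding S_def by (simp, metis)
  have orth: "ip (lebesgue_on \<Omega>) w a = ip (lebesgue_on \<Omega>) f a" if "solenoidal \<Omega> a h" for a h
    using w(4)[of a] that by (auto simp: S_def M_def ip_commute)
  have H: "AE x in M. helmholtz \<Omega> f x = w x" "sqint M (helmholtz \<Omega> f)"
    unfolding M_def
    by (rule helmholtz_AE_eq_projection[OF \<Omega> f[unfolded M_def] w(1)[unfolded M_def] G w(3)[unfolded M_def] orth], assumption)+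
  define Q where "Q n u \<longleftrightarrow> stokes_weak_solution \<Omega> (real (Suc n)) f u \<and> sqint M (\<lambda>x. real (Suc n) *\<^sub>R u x) \<and>
    (\<forall>a h. solenoidal \<Omega> a h \<longrightarrow> nsq M (\<lambda>x. real (Suc n) *\<^sub>R u x - w x)
      \<le> nsq M (\<lambda>x. a x - w x) + (\<Sum>i\<in>UNIV. nsq M (h i)) / real (Suc n))" for n u
  have "\<exists>u. Q n u" for n
  proof -
    have pos: "0 < real (Suc n)" by simp
    show ?thesis
      by (rule stokes_solution_exists[OF o f[unfolded M_def] w(1)[unfolded M_def] orth pos])
         (assumption, unfold M_def Q_def, rule exI, intro conjI allI impI, assumption, assumption, blast)
  qed
  then obtain u where Q: "\<And>n. Q n (u n)" by metis
  have u: "\<And>n. stokes_weak_solution \<Omega> (real (Suc n)) f (u n)"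
    "\<And>n. sqint M (\<lambda>x. real (Suc n) *\<^sub>R u n x)"
    "\<And>n a h. solenoidal \<Omega> a h \<Longrightarrow> nsq M (\<lambda>x. real (Suc n) *\<^sub>R u n x - w x)
      \<le> nsq M (\<lambda>x. a x - w x) + (\<Sum>i\<in>UNIV. nsq M (h i)) / real (Suc n)"
    using Q[unfolded Q_def] by blast+
  have lim: "(\<lambda>n. nsq M (\<lambda>x. real (Suc n) *\<^sub>R u n x - w x)) \<longlonglongrightarrow> 0"
  proof (rule order_tendstoI)
    fix e :: real assume e: "0 < e"
    \<comment> \<open>The competitor is fixed before the parameter: \<open>w\<close> itself may have
      no square-integrable gradient and the gradients of \<open>v k\<close> may blow up, but for
      fixed \<open>k\<close> their contribution divided by the parameter tends to 0.\<close>
    obtain k where k: "nsq M (\<lambda>x. v k x - w x) < e / 2"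
      using eventually_happens'[OF sequentially_bot order_tendstoD(2)[OF w(3), of "e / 2"]] e by auto
    define B where "B = (\<Sum>i\<in>UNIV. nsq M (G k i))"
    have "(\<lambda>n. inverse (real (Suc n)) * B) \<longlonglongrightarrow> 0 * B"
      by (intro tendsto_intros LIMSEQ_inverse_real_of_nat)
    then have "\<forall>\<^sub>F n in sequentially. inverse (real (Suc n)) * B < e / 2"
      using e by (intro order_tendstoD(2)) auto
    then show "\<forall>\<^sub>F n in sequentially. nsq M (\<lambda>x. real (Suc n) *\<^sub>R u n x - w x) < e"
    proof eventually_elim
      case (elim n)
      have "nsq M (\<lambda>x. real (Suc n) *\<^sub>R u n x - w x) \<le> nsq M (\<lambda>x. v k x - w x) + inverse (real (Suc n)) * B"
        using u(3)[OF G, of n k] by (simp add: B_def divide_inverse mult.commute)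
      also have "\<dots> < e / 2 + e / 2" using k elim by (rule add_strict_mono)
      finally show ?case by simp
    qed
  next
    fix e :: real assume "e < 0"
    then show "\<forall>\<^sub>F n in sequentially. e < nsq M (\<lambda>x. real (Suc n) *\<^sub>R u n x - w x)"
      by (intro always_eventually allI less_le_trans[OF _ nsq_nonneg])
  qed
  \<comment> \<open>The integrand of \<open>L2_inner\<close>. It is conjugate linear in the second
    argument, hence bilinear over the reals, as \<open>bilinear_integral_tendsto\<close>
    requires.\<close>
  define J :: "complex ^ 'd \<Rightarrow> complex ^ 'd \<Rightarrow> complex" where "J a b = (\<Sum>i\<in>UNIV. a $ i * cnj (b $ i))" for a b
  have J: "bounded_bilinear J"
    by (intro bilinear_conv_bounded_bilinear[THEN iffD1])
       (auto simp: bilinear_def linear_iff J_def algebra_simps sum.distrib scaleR_sum_right)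
  have "(\<lambda>n. LINT x|M. J (real (Suc n) *\<^sub>R u n x) (g x)) \<longlonglongrightarrow> (LINT x|M. J (w x) (g x))"
    by (rule bilinear_integral_tendsto[OF J u(2) w(1) g lim])
  also have "(LINT x|M. J (w x) (g x)) = L2_inner \<Omega> (helmholtz \<Omega> f) g"
  proof -
    have "(LINT x|M. J (w x) (g x)) = (LINT x|M. J (helmholtz \<Omega> f x) (g x))"
    proof (rule integral_cong_AE)
      show "AE x in M. J (w x) (g x) = J (helmholtz \<Omega> f x) (g x)" using H(1) by eventually_elim simp
    qed (intro borel_measurable_integrable sqint_bounded_bilinear_integrable[OF J] w(1) g H(2))+
    then show ?thesis by (simp add: L2_inner_def J_def M_def)
  qed
  also have "(\<lambda>n. LINT x|M. J (real (Suc n) *\<^sub>R u n x) (g x)) = (\<lambda>n. real (Suc n) *\<^sub>R L2_inner \<Omega> (u n) g)"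
    unfolding bounded_bilinear.scaleR_left[OF J] by (simp add: L2_inner_def J_def M_def)
  finally have "(\<lambda>n. cmod (real (Suc n) *\<^sub>R L2_inner \<Omega> (u n) g)) \<longlonglongrightarrow> cmod (L2_inner \<Omega> (helmholtz \<Omega> f) g)"
    by (rule tendsto_norm)
  then show ?thesis using that[OF u(1)] by simp
qed

theorem theoremB1:
  fixes \<Omega> :: "(real ^ 'd) set" and p p' :: real
  assumes "CARD('d) \<ge> 2"
    and "bounded_lipschitz_domain \<Omega>"
    and "1 < p" and "p' = p / (p - 1)"
    and "Sup {ereal (cmod (L2_inner \<Omega> (helmholtz \<Omega> f) g) / (Lp_norm \<Omega> p f * Lp_norm \<Omega> p' g)) | f g.
           f \<in> test_fun \<Omega> \<and> g \<in> test_fun \<Omega> \<and> f \<noteq> (\<lambda>_. 0) \<and> g \<noteq> (\<lambda>_. 0)} = \<infinity>"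
  shows "Sup {ereal (lam * cmod (L2_inner \<Omega> u g) / (Lp_norm \<Omega> p f * Lp_norm \<Omega> p' g)) | f g lam u.
           f \<in> test_fun \<Omega> \<and> g \<in> test_fun \<Omega> \<and> f \<noteq> (\<lambda>_. 0) \<and> g \<noteq> (\<lambda>_. 0) \<and> lam > 0 \<and>
           stokes_weak_solution \<Omega> lam f u} = \<infinity>"
    (is "Sup ?R = \<infinity>")
proof -
  have s\<Omega>: "\<Omega> \<in> sets lebesgue" using assms(2) by (simp add: bounded_lipschitz_domain_def)
  have "Sup {ereal (cmod (L2_inner \<Omega> (helmholtz \<Omega> f) g) / (Lp_norm \<Omega> p f * Lp_norm \<Omega> p' g)) | f g.
           f \<in> test_fun \<Omega> \<and> g \<in> test_fun \<Omega> \<and> f \<noteq> (\<lambda>_. 0) \<and> g \<noteq> (\<lambda>_. 0)} \<le> Sup ?R"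
  proof (rule Sup_least, clarify)
    fix f g :: "real ^ 'd \<Rightarrow> complex ^ 'd"
    assume f: "f \<in> test_fun \<Omega>" "f \<noteq> (\<lambda>_. 0)" and g: "g \<in> test_fun \<Omega>" "g \<noteq> (\<lambda>_. 0)"
    define c where "c = Lp_norm \<Omega> p f * Lp_norm \<Omega> p' g"
    obtain u where u: "\<And>n. stokes_weak_solution \<Omega> (real (Suc n)) f (u n)"
      "(\<lambda>n. real (Suc n) * cmod (L2_inner \<Omega> (u n) g)) \<longlonglongrightarrow> cmod (L2_inner \<Omega> (helmholtz \<Omega> f) g)"
      by (rule stokes_resolvent_limit[OF assms(2) test_fun_sqint(1)[OF f(1) s\<Omega>] test_fun_sqint(1)[OF g(1) s\<Omega>]]) (rule that)
    \<comment> \<open>Read as multiplication by the constant \<open>inverse c\<close>, so the limit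
      holds for every value of \<open>c\<close>.\<close>
    have "(\<lambda>n. ereal (real (Suc n) * cmod (L2_inner \<Omega> (u n) g) / c)) \<longlonglongrightarrow> ereal (cmod (L2_inner \<Omega> (helmholtz \<Omega> f) g) / c)"
      unfolding divide_inverse by (intro tendsto_intros u(2))
    moreover have "ereal (real (Suc n) * cmod (L2_inner \<Omega> (u n) g) / c) \<le> Sup ?R" for n
    proof (rule Sup_upper)
      show "ereal (real (Suc n) * cmod (L2_inner \<Omega> (u n) g) / c) \<in> ?R"
        using f g u(1)[of n] unfolding c_def
        by (intro CollectI exI[of _ f] exI[of _ g] exI[of _ "real (Suc n)"] exI[of _ "u n"]) simp
    qed
    ultimately show "ereal (cmod (L2_inner \<Omega> (helmholtz \<Omega> f) g) / (Lp_norm \<Omega> p f * Lp_norm \<Omega> p' g)) \<le> Sup ?R"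
      unfolding c_def[symmetric] by (intro LIMSEQ_le_const2[where X = "\<lambda>n. ereal (real (Suc n) * cmod (L2_inner \<Omega> (u n) g) / c)"]) auto
  qed
  then show ?thesis using assms(5) by simp
qed

end
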